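(* Let $G$ be an abelian group and $H$ an arbitrary subgroup of $G$. (a) If $\zeta$ is a precompact group topology on $H$, then $(\bar{\zeta})^+$ is the finest precompact extension of $\zeta$ on $G$. (b) For a precompact group topology $\tau$ on $G$ and $\zeta=\tau|_H$, the following assertions are equivalent: (b$_1$) $\tau$ is the finest precompact extension of $\zeta$ on $G$. (b$_2$) $H$ is $B$-embedded in $(G,\tau)$. (b$_3$) $(G,\tau)^\ast=(j^\wedge)^{-1}\big((H,\zeta)^\ast\big)$, where $j:H_d\to G_d$ is the inclusion map and $j^\wedge:(G_d)^\wedge\to(H_d)^\wedge$, $\chi\mapsto\chi\circ j$, is its dual map. (b$_4$) $\tau=(\bar{\zeta})^+$.
   Context: All topological groups are Hausdorff and abelian. $\mathbb{T}=\mathbb{R}/\mathbb{Z}$. A group topology on $G$ is precompact if it is Hausdorff and for every neighborhood $U$ of $0$ there is a finite $F\subseteq G$ with $F+U=G$. $G_d$ is $G$ with the discrete topology, so that $(G_d)^\wedge$ consists of all homomorphisms $G\to\mathbb{T}$. For a topological abelian group $(G,\tau)$, $(G,\tau)^\ast$ is the group of all continuous characters $G\to\mathbb{T}$ (a subgroup of $(G_d)^\wedge$), and $\tau^+$ (the Bohr modification of $\tau$) is the coarsest group topology on $G$ making all members of $(G,\tau)^\ast$ continuous. If $H$ is a subgroup of $G$ and $\zeta$ is a Hausdorff group topology on $H$, then $\bar{\zeta}$ is the Hausdorff group topology on $G$ for which the filter of $\zeta$-neighborhoods of $0$ in $H$ is a local base at $0$ in $G$. A precompact group topology $\zeta^\ast$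 on $G$ is called a finest precompact extension of a precompact topology $\zeta$ on $H$ if $\zeta^\ast|_H=\zeta$ and $\tau'\le\zeta^\ast$ for every precompact group topology $\tau'$ on $G$ with $\tau'|_H=\zeta$ (it is unique if it exists). A subgroup $H$ of a topological abelian group $G$ is $B$-embedded if every (algebraic) character $\chi:G/H\to\mathbb{T}$ is continuous in the quotient topology of $G/H$. *)

theory Defs
  imports "HOL-Analysis.Analysis" "HOL-Algebra.Coset"
begin

text \<open>
  Groups are abelian, written multiplicatively with an explicit carrier; a topology on such a
  group is an abstract topology whose \<^const>\<open>topspace\<close> is that carrier. The subgroup \<open>H\<close> of \<open>G\<close>,
  regarded as a group in its own right, is \<open>G\<lparr>carrier := H\<rparr>\<close>.
\<close>

text \<open>
  The Hausdorff axiom is kept separate from this definition: the coarsest group topology making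
  a set of characters continuous is Hausdorff only if these characters separate points.
\<close>

definition group_topology :: "('a, 'm) monoid_scheme \<Rightarrow> 'a topology \<Rightarrow> bool" where
  "group_topology G \<tau> \<longleftrightarrow>
     topspace \<tau> = carrier G \<and>
     continuous_map (prod_topology \<tau> \<tau>) \<tau> (\<lambda>(x, y). x \<otimes>\<^bsub>G\<^esub> y) \<and>
     continuous_map \<tau> \<tau> (\<lambda>x. inv\<^bsub>G\<^esub> x)"

definition neighbourhood_in :: "'a topology \<Rightarrow> 'a \<Rightarrow> 'a set \<Rightarrow> bool" where
  "neighbourhood_in \<tau> x N \<longleftrightarrow> N \<subseteq> topspace \<tau> \<and> (\<exists>U. openin \<tau> U \<and> x \<in> U \<and> U \<subseteq> N)"

definition coarser :: "'a topology \<Rightarrow> 'a topology \<Rightarrow> bool" where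
  "coarser \<sigma> \<tau> \<longleftrightarrow> (\<forall>U. openin \<sigma> U \<longrightarrow> openin \<tau> U)"

definition precompact_topology :: "('a, 'm) monoid_scheme \<Rightarrow> 'a topology \<Rightarrow> bool" where
  "precompact_topology G \<tau> \<longleftrightarrow>
     group_topology G \<tau> \<and> Hausdorff_space \<tau> \<and>
     (\<forall>U. neighbourhood_in \<tau> \<one>\<^bsub>G\<^esub> U \<longrightarrow>
        (\<exists>F. finite F \<and> F \<subseteq> carrier G \<and> F <#>\<^bsub>G\<^esub> U = carrier G))"

definition quotient_group_topology ::
    "('a, 'm) monoid_scheme \<Rightarrow> 'a set \<Rightarrow> 'a topology \<Rightarrow> 'a set topology" where
  "quotient_group_topology G H \<tau> =
     topology (\<lambda>U. U \<subseteq> carrier (G Mod H) \<and> openin \<tau> {x \<in> topspace \<tau>. H #>\<^bsub>G\<^esub> x \<in> U})"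

lemma openin_quotient_group_topology:
  "openin (quotient_group_topology G H \<tau>) U \<longleftrightarrow>
     U \<subseteq> carrier (G Mod H) \<and> openin \<tau> {x \<in> topspace \<tau>. H #>\<^bsub>G\<^esub> x \<in> U}"
proof -
  let ?P = "\<lambda>U. U \<subseteq> carrier (G Mod H) \<and> openin \<tau> {x \<in> topspace \<tau>. H #>\<^bsub>G\<^esub> x \<in> U}"
  have "?P (S \<inter> T)" if "?P S" "?P T" for S T
  proof -
    have "{x \<in> topspace \<tau>. H #>\<^bsub>G\<^esub> x \<in> S \<inter> T} =
          {x \<in> topspace \<tau>. H #>\<^bsub>G\<^esub> x \<in> S} \<inter> {x \<in> topspace \<tau>. H #>\<^bsub>G\<^esub> x \<in> T}" by blast
    with that show ?thesis by auto
  qed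
  moreover have "?P (\<Union>K)" if "\<forall>S\<in>K. ?P S" for K
  proof -
    have "{x \<in> topspace \<tau>. H #>\<^bsub>G\<^esub> x \<in> \<Union>K} =
          (\<Union>S\<in>K. {x \<in> topspace \<tau>. H #>\<^bsub>G\<^esub> x \<in> S})" by blast
    with that show ?thesis by (auto intro!: openin_Union)
  qed
  ultimately have "istopology ?P" unfolding istopology_def by blast
  then show ?thesis by (simp add: quotient_group_topology_def topology_inverse')
qed

lemma topspace_quotient_group_topology:
  assumes "topspace \<tau> = carrier G"
  shows "topspace (quotient_group_topology G H \<tau>) = carrier (G Mod H)"
proof -
  have pre: "{x \<in> topspace \<tau>. H #>\<^bsub>G\<^esub> x \<in> carrier (G Mod H)} = topspace \<tau>"
    using assms by (auto simp: FactGroup_def RCOSETS_def)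
  have "openin (quotient_group_topology G H \<tau>) (carrier (G Mod H))"
    by (simp add: openin_quotient_group_topology pre)
  then show ?thesis
    by (metis openin_quotient_group_topology openin_subset openin_topspace subset_antisym)
qed

lemma quotient_map_quotient_group_topology:
  assumes "topspace \<tau> = carrier G"
  shows "quotient_map \<tau> (quotient_group_topology G H \<tau>) (\<lambda>x. H #>\<^bsub>G\<^esub> x)"
proof -
  have "(\<lambda>x. H #>\<^bsub>G\<^esub> x) ` topspace \<tau> = carrier (G Mod H)"
    using assms by (auto simp: FactGroup_def RCOSETS_def)
  with assms show ?thesis
    by (auto simp: quotient_map_def openin_quotient_group_topology
        topspace_quotient_group_topology)
qed

text \<open>The torus is literally the quotient of the additive reals by the integers.\<close>

definition real_add_group :: "real monoid" where
  "real_add_group = \<lparr>carrier = UNIV, mult = (+), one = 0\<rparr>"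

definition torus :: "real set monoid" where
  "torus = real_add_group Mod \<int>"

definition torus_topology :: "real set topology" where
  "torus_topology = quotient_group_topology real_add_group \<int> euclidean"

text \<open>
  Characters are normalised to be \<^const>\<open>undefined\<close> outside the carrier, so that they
  are equal iff they agree on the carrier.
\<close>

definition continuous_characters ::
    "('a, 'm) monoid_scheme \<Rightarrow> 'a topology \<Rightarrow> ('a \<Rightarrow> real set) set" where
  "continuous_characters G \<tau> =
     {\<phi> \<in> hom G torus \<inter> extensional (carrier G). continuous_map \<tau> torus_topology \<phi>}"

abbreviation discrete_dual :: "('a, 'm) monoid_scheme \<Rightarrow> ('a \<Rightarrow> real set) set" where
  "discrete_dual G \<equiv> continuous_characters G (discrete_topology (carrier G))"

lemma discrete_dual_eq: "discrete_dual G = hom G torus \<inter> extensional (carrier G)"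
proof -
  have "topspace torus_topology = carrier torus"
    unfolding torus_topology_def torus_def
    by (rule topspace_quotient_group_topology) (simp add: real_add_group_def)
  then show ?thesis
    by (auto simp: continuous_characters_def hom_def)
qed

definition dual_map ::
    "('a, 'm) monoid_scheme \<Rightarrow> ('a \<Rightarrow> 'b) \<Rightarrow> ('b \<Rightarrow> real set) \<Rightarrow> 'a \<Rightarrow> real set" where
  "dual_map K f \<phi> = compose (carrier K) \<phi> f"

definition bohr_modification :: "('a, 'm) monoid_scheme \<Rightarrow> 'a topology \<Rightarrow> 'a topology" where
  "bohr_modification G \<tau> =
     (THE \<sigma>. group_topology G \<sigma> \<and>
        (\<forall>\<phi>\<in>continuous_characters G \<tau>. continuous_map \<sigma> torus_topology \<phi>) \<and>
        (\<forall>\<sigma>'. group_topology G \<sigma>' \<and>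
           (\<forall>\<phi>\<in>continuous_characters G \<tau>. continuous_map \<sigma>' torus_topology \<phi>) \<longrightarrow>
           coarser \<sigma> \<sigma>'))"

text \<open>
  For a Hausdorff group topology \<open>\<zeta>\<close> on \<open>H\<close> the topology described below exists; it is unique
  because a group topology is determined by its neighbourhoods of the unit.
\<close>

definition extension_topology ::
    "('a, 'm) monoid_scheme \<Rightarrow> 'a topology \<Rightarrow> 'a topology" where
  "extension_topology G \<zeta> =
     (THE \<sigma>. group_topology G \<sigma> \<and> Hausdorff_space \<sigma> \<and>
        (\<forall>N. neighbourhood_in \<zeta> \<one>\<^bsub>G\<^esub> N \<longrightarrow> neighbourhood_in \<sigma> \<one>\<^bsub>G\<^esub> N) \<and>
        (\<forall>M. neighbourhood_in \<sigma> \<one>\<^bsub>G\<^esub> M \<longrightarrow>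
           (\<exists>N. neighbourhood_in \<zeta> \<one>\<^bsub>G\<^esub> N \<and> N \<subseteq> M)))"

definition finest_precompact_extension ::
    "('a, 'm) monoid_scheme \<Rightarrow> 'a set \<Rightarrow> 'a topology \<Rightarrow> 'a topology \<Rightarrow> bool" where
  "finest_precompact_extension G H \<zeta> \<tau> \<longleftrightarrow>
     precompact_topology G \<tau> \<and> subtopology \<tau> H = \<zeta> \<and>
     (\<forall>\<tau>'. precompact_topology G \<tau>' \<and> subtopology \<tau>' H = \<zeta> \<longrightarrow> coarser \<tau>' \<tau>)"

text \<open>
  No continuity is required of the homomorphisms quantified over, and \<open>H\<close> need not be closed,
  so the quotient need not be Hausdorff.
\<close>

definition B_embedded :: "('a, 'm) monoid_scheme \<Rightarrow> 'a topology \<Rightarrow> 'a set \<Rightarrow> bool" where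
  "B_embedded G \<tau> H \<longleftrightarrow>
     (\<forall>\<phi>\<in>hom (G Mod H) torus.
        continuous_map (quotient_group_topology G H \<tau>) torus_topology \<phi>)"

end

theory Submission
  imports Defs "HOL-Algebra.Product_Groups" "HOL-Algebra.Multiplicative_Group"
begin

text \<open>
  The proof rests on the theorem of Comfort and Ross that a precompact group topology is the coarsest
  group topology for which its continuous characters are continuous (\<open>precompact_eq_bohr_topology\<close>).
  Characters are treated as homomorphisms into the complex unit circle; the torus and the circle are
  identified by \<open>circle_value\<close>.
  
  Let \<open>\<zeta>\<close> be a precompact topology on \<open>H\<close>, let \<open>X\<close> be the set of characters of \<open>G\<close> whose restriction to
  \<open>H\<close> is continuous for \<open>\<zeta>\<close>, and let \<open>\<sigma>\<close> be the topology generated by \<open>X\<close>. A precompact extension of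
  \<open>\<zeta>\<close> is generated by its continuous characters, which belong to \<open>X\<close>, so it is coarser than \<open>\<sigma>\<close>. Since
  characters extend from subgroups, \<open>\<sigma>\<close> is Hausdorff and restricts to \<open>\<zeta>\<close>; thus it is the finest
  precompact extension (\<open>finest_precompact_extension_bohr\<close>). Moreover \<open>H\<close> is open for the extension
  topology, so \<open>X\<close> consists of the characters continuous for that topology, and \<open>\<sigma>\<close> is its Bohr
  modification.
  
  For a precompact topology \<open>\<tau>\<close> on \<open>G\<close> with restriction \<open>\<zeta>\<close>, the continuous characters belong to \<open>X\<close>,
  and they exhaust \<open>X\<close> if and only if \<open>\<tau> = \<sigma>\<close>. In this case every character that is trivial on \<open>H\<close> is
  continuous, that is, \<open>H\<close> is \<open>B\<close>-embedded. Conversely, if \<open>H\<close> is \<open>B\<close>-embedded, then \<open>\<tau>\<close> and \<open>\<sigma>\<close> induce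
  the same topology on \<open>H\<close> and also on \<open>G/H\<close>, where the quotient of \<open>\<sigma>\<close> is described by characters
  (\<open>precompact_saturation_neighbourhood\<close>). Being comparable, the two topologies are equal
  (\<open>merzon_lemma\<close>).
  
  The theorem of Comfort and Ross amounts to finding, for a sequence of neighbourhoods of the unit, a
  finite set of characters that are continuous for this sequence and cut out a subset of its first
  member (\<open>characters_of_neighbourhood_sequence\<close>). The proof uses no integration. A sequence of
  neighbourhoods defines a totally bounded seminorm \<open>\<rho>\<close> (\<open>seminorm_of_sequence\<close>). For a finite subset
  \<open>S\<close> of \<open>G\<close> some power \<open>M\<close> brings all its elements near the unit, so a power of the integers modulo \<open>M\<close>
  maps almost homomorphically to \<open>G\<close> and covers \<open>S\<close> (\<open>finite_model\<close>). In this finite group the theorem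
  of Bogolyubov provides boundedly many characters, those at which a bump function around a point of
  \<open>G\<close> has large Fourier coefficients; they detect the elements at which \<open>\<rho>\<close> is large. Because the
  coefficients are large and the bump is Lipschitz for \<open>\<rho>\<close>, so are the characters, up to a small error
  (\<open>fourier_translate\<close>). A limit over all \<open>S\<close> and all errors, taken by compactness, consists of
  characters of \<open>G\<close> that are Lipschitz for \<open>\<rho>\<close> (\<open>characters_of_seminorm\<close>).
\<close>

section \<open>Characters with values in the unit circle\<close>

definition circle_characters :: "('a, 'm) monoid_scheme \<Rightarrow> ('a \<Rightarrow> complex) set" where
  "circle_characters G = {\<psi> \<in> extensional (carrier G).
     (\<forall>x\<in>carrier G. norm (\<psi> x) = 1) \<and>
     (\<forall>x\<in>carrier G. \<forall>y\<in>carrier G. \<psi> (x \<otimes>\<^bsub>G\<^esub> y) = \<psi> x * \<psi> y)}"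

lemma circle_character_norm:
  "\<psi> \<in> circle_characters G \<Longrightarrow> x \<in> carrier G \<Longrightarrow> norm (\<psi> x) = 1"
  by (simp add: circle_characters_def)

lemma circle_character_mult:
  "\<psi> \<in> circle_characters G \<Longrightarrow> x \<in> carrier G \<Longrightarrow> y \<in> carrier G \<Longrightarrow>
     \<psi> (x \<otimes>\<^bsub>G\<^esub> y) = \<psi> x * \<psi> y"
  by (simp add: circle_characters_def)

lemma (in group) circle_character_one:
  assumes "\<psi> \<in> circle_characters G"
  shows "\<psi> \<one> = 1"
proof -
  have "\<psi> \<one> * \<psi> \<one> = \<psi> \<one>"
    using circle_character_mult[OF assms, of \<one> \<one>] by simp
  moreover have "\<psi> \<one> \<noteq> 0"
    using circle_character_norm[OF assms, of \<one>] by auto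
  ultimately show ?thesis by simp
qed

lemma (in group) circle_character_inv:
  assumes "\<psi> \<in> circle_characters G" "x \<in> carrier G"
  shows "\<psi> (inv x) = cnj (\<psi> x)"
proof -
  have "\<psi> x * \<psi> (inv x) = 1"
    using circle_character_mult[OF assms(1,2), of "inv x"] assms
      circle_character_one[OF assms(1)] by simp
  moreover have "\<psi> x * cnj (\<psi> x) = 1"
    using circle_character_norm[OF assms] by (simp add: complex_norm_square [symmetric])
  ultimately show ?thesis
    by (metis mult_left_cancel mult_zero_left zero_neq_one)
qed

section \<open>Extension of characters from subgroups\<close>

text \<open>
  The graph of a homomorphism from a subgroup of \<open>G\<close> to the circle, encoded as a subgroup of the
  product group that meets the second factor trivially. For graphs, extension is inclusion and the
  union of a chain is again a graph, as Zorn's lemma requires.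
\<close>

definition partial_character :: "('a, 'm) monoid_scheme \<Rightarrow> ('a \<times> complex) set \<Rightarrow> bool" where
  "partial_character G R \<longleftrightarrow>
     R \<subseteq> carrier G \<times> sphere 0 1 \<and> (\<one>\<^bsub>G\<^esub>, 1) \<in> R \<and>
     (\<forall>x a y b. (x, a) \<in> R \<longrightarrow> (y, b) \<in> R \<longrightarrow> (x \<otimes>\<^bsub>G\<^esub> inv\<^bsub>G\<^esub> y, a / b) \<in> R) \<and>
     (\<forall>a. (\<one>\<^bsub>G\<^esub>, a) \<in> R \<longrightarrow> a = 1)"

context comm_group
begin

lemma partial_characterD:
  assumes "partial_character G R" "(x, a) \<in> R"
  shows "x \<in> carrier G" "norm a = 1" "a \<noteq> 0"
proof -
  have "(x, a) \<in> carrier G \<times> sphere 0 1"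
    using assms unfolding partial_character_def by blast
  then show "x \<in> carrier G" "norm a = 1" "a \<noteq> 0" by auto
qed

lemma partial_character_inv:
  assumes R: "partial_character G R" and x: "(x, a) \<in> R"
  shows "(inv x, inverse a) \<in> R"
proof -
  have "(\<one> \<otimes> inv x, 1 / a) \<in> R"
    using assms unfolding partial_character_def by blast
  then show ?thesis
    using partial_characterD[OF assms] by (simp add: divide_inverse)
qed

lemma partial_character_mult:
  assumes R: "partial_character G R" and x: "(x, a) \<in> R" and y: "(y, b) \<in> R"
  shows "(x \<otimes> y, a * b) \<in> R"
proof -
  have "(x \<otimes> inv (inv y), a / inverse b) \<in> R"
    using R x partial_character_inv[OF R y] unfolding partial_character_def by blast
  then show ?thesis
    using partial_characterD[OF R y] by (simp add: divide_inverse)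
qed

lemma partial_character_unique:
  assumes R: "partial_character G R" and x: "(x, a) \<in> R" and y: "(x, b) \<in> R"
  shows "a = b"
proof -
  have "(x \<otimes> inv x, a / b) \<in> R"
    using assms unfolding partial_character_def by blast
  then have "a / b = 1"
    using R partial_characterD[OF R x] unfolding partial_character_def by auto
  then show ?thesis by simp
qed

lemma partial_character_int_pow:
  assumes R: "partial_character G R" and x: "(x, a) \<in> R"
  shows "(x [^] (n::int), a powi n) \<in> R"
proof -
  have xc: "x \<in> carrier G" using partial_characterD[OF R x] by simp
  have nat: "(x [^] (n::nat), a ^ n) \<in> R" for n
  proof (induction n)
    case 0
    show ?case using R by (simp add: partial_character_def)
  next
    case (Suc n)
    show ?case using partial_character_mult[OF R Suc x] by (simp add: mult.commute)
  qed
  obtain m where "n = int m \<or> n = - int m" by (metis int_cases2)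
  then show ?thesis
  proof
    assume "n = int m"
    then show ?thesis using nat[of m] by (simp add: int_pow_int)
  next
    assume "n = - int m"
    then show ?thesis using partial_character_inv[OF R nat[of m]] xc
      by (simp add: int_pow_neg_int power_int_minus)
  qed
qed

text \<open>
  A value \<open>c\<close> at \<open>x\<close> has to agree with the values at those powers of \<open>x\<close> that lie in the domain. If
  a positive power does, the least such exponent \<open>d\<close> is at least \<open>2\<close>, and among the \<open>d\<close>-th roots of
  the prescribed value at least one differs from \<open>1\<close>; otherwise only the zeroth power lies in the
  domain, and \<open>-1\<close> serves. Avoiding \<open>1\<close> is what later separates points from subgroups.
\<close>

lemma partial_character_root:
  assumes R: "partial_character G R" and x: "x \<in> carrier G" "x \<notin> Domain R"
  obtains c where "norm c = 1" "c \<noteq> 1" "\<And>n a. (x [^] (n::int), a) \<in> R \<Longrightarrow> c powi n = a"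
proof (cases "\<exists>n::nat. 0 < n \<and> x [^] n \<in> Domain R")
  case False
  have zero: "n = 0" if "(x [^] (n::int), a) \<in> R" for n a
  proof (rule ccontr)
    assume "n \<noteq> 0"
    show False
    proof (cases "n > 0")
      case True
      then show False using that False int_pow_def2[of G x n]
        by (metis DomainI not_less_iff_gr_or_eq zero_less_nat_eq)
    next
      case neg: False
      have "(x [^] (-n), inverse a) \<in> R"
        using partial_character_inv[OF R that] x by (simp add: int_pow_neg)
      moreover have "-n > 0" using neg \<open>n \<noteq> 0\<close> by simp
      ultimately show False using False int_pow_def2[of G x "-n"]
        by (metis DomainI not_less_iff_gr_or_eq zero_less_nat_eq)
    qed
  qed
  have "(-1::complex) powi n = a" if "(x [^] (n::int), a) \<in> R" for n a
    using zero[OF that] that R by (simp add: partial_character_def)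
  then show thesis by (intro that[of "-1"]) auto
next
  case True
  define d where "d = (LEAST n::nat. 0 < n \<and> x [^] n \<in> Domain R)"
  have d: "0 < d" "x [^] d \<in> Domain R"
    using LeastI_ex[OF True] unfolding d_def by auto
  have least: "\<not> (0 < n \<and> x [^] n \<in> Domain R)" if "n < d" for n
    using not_less_Least that unfolding d_def by blast
  have "d \<noteq> 1" using d x by auto
  then have d2: "d \<ge> 2" using d by simp
  obtain a where a: "(x [^] d, a) \<in> R" using d by auto
  have na: "norm a = 1" using partial_characterD[OF R a] by simp
  obtain c where c: "norm c = 1" "c \<noteq> 1" "c ^ d = a"
  proof (cases "a = 1")
    case True
    have "real d * (2 * pi / d) = 2 * pi" using d by simp
    then have "cis (2 * pi / d) ^ d = 1" by (simp only: Complex.DeMoivre cis_2pi)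
    have "cis (2 * pi / d) \<noteq> 1"
    proof
      assume "cis (2 * pi / d) = 1"
      then have "cos (2 * pi / d) = 1" by (simp add: complex_eq_iff)
      moreover have "0 < 2 * pi / d" "2 * pi / d \<le> pi"
        using d d2 pi_gt_zero by (auto simp: field_simps)
      moreover have "cos (2 * pi / d) < cos 0"
        by (rule cos_monotone_0_pi) (use calculation in auto)
      ultimately show False by simp
    qed
    then show thesis
      using True \<open>cis (2 * pi / d) ^ d = 1\<close> by (intro that[of "cis (2 * pi / d)"]) simp_all
  next
    case False
    have "cis (Arg a / d) ^ d = a"
      using d na by (simp add: Complex.DeMoivre cis_Arg_unique) (metis cis_Arg div_by_1 na norm_zero of_real_1 sgn_eq zero_neq_one)
    then show thesis
      using False by (intro that[of "cis (Arg a / d)"]) auto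
  qed
  have "c powi n = b" if b: "(x [^] (n::int), b) \<in> R" for n b
  proof -
    let ?q = "n div int d" and ?r = "n mod int d"
    have q: "(x [^] (int d * ?q), a powi ?q) \<in> R"
      using partial_character_int_pow[OF R a, of ?q] x
      by (simp add: int_pow_int[symmetric] int_pow_pow)
    have "(x [^] n \<otimes> inv (x [^] (int d * ?q)), b * inverse (a powi ?q)) \<in> R"
      by (rule partial_character_mult[OF R b partial_character_inv[OF R q]])
    moreover have "x [^] n \<otimes> inv (x [^] (int d * ?q)) = x [^] ?r"
      using x by (simp add: int_pow_diff[symmetric] minus_mult_div_eq_mod)
    ultimately have r: "x [^] ?r \<in> Domain R" by auto
    have "?r = 0"
    proof (rule ccontr)
      assume "?r \<noteq> 0"
      moreover have "0 \<le> ?r" "?r < int d" using d by simp_all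
      ultimately have "0 < nat ?r" "nat ?r < d" by linarith+
      moreover have "x [^] nat ?r = x [^] ?r"
        using d by (simp add: int_pow_int[symmetric])
      ultimately show False using least r by metis
    qed
    then have n: "n = int d * ?q" by (simp add: minus_mult_div_eq_mod[symmetric])
    have "b = a powi ?q" using partial_character_unique[OF R b] q n by metis
    also have "\<dots> = c powi n" using c(3) by (subst n) (simp add: power_int_mult)
    finally show ?thesis by simp
  qed
  with c(1,2) show thesis by (rule that)
qed

lemma partial_character_step:
  assumes R: "partial_character G R" and x: "x \<in> carrier G" "x \<notin> Domain R"
  obtains R' c where "partial_character G R'" "R \<subseteq> R'" "(x, c) \<in> R'" "c \<noteq> 1"
proof -
  obtain c where c: "norm c = 1" "c \<noteq> 1"
    "\<And>n a. (x [^] (n::int), a) \<in> R \<Longrightarrow> c powi n = a"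
    using partial_character_root[OF assms] by blast
  have c0: "c \<noteq> 0" using c by auto
  define R' where "R' = {(k \<otimes> x [^] (n::int), a * c powi n) | k a n. (k, a) \<in> R}"
  have R'I: "(k \<otimes> x [^] (n::int), a * c powi n) \<in> R'" if "(k, a) \<in> R" for k a n
    using that unfolding R'_def by blast
  have RR': "(k, a) \<in> R'" if "(k, a) \<in> R" for k a
    using R'I[OF that, of 0] partial_characterD[OF R that] by simp
  have one: "(\<one>, 1) \<in> R" using R by (simp add: partial_character_def)
  have "partial_character G R'"
    unfolding partial_character_def
  proof (intro conjI allI impI)
    show "R' \<subseteq> carrier G \<times> sphere 0 1"
      using partial_characterD[OF R] x c by (auto simp: R'_def norm_mult norm_power_int)
    show "(\<one>, 1) \<in> R'" using RR' one by blast
  next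
    fix y a z b assume "(y, a) \<in> R'" "(z, b) \<in> R'"
    then obtain k a' n l b' m where
      1: "y = k \<otimes> x [^] (n::int)" "a = a' * c powi n" "(k, a') \<in> R" and
      2: "z = l \<otimes> x [^] (m::int)" "b = b' * c powi m" "(l, b') \<in> R"
      unfolding R'_def by blast
    have kl: "k \<in> carrier G" "l \<in> carrier G"
      using 1 2 partial_characterD[OF R] by auto
    have "y \<otimes> inv z = (k \<otimes> inv l) \<otimes> x [^] (n - m)"
      unfolding 1 2 using kl x by (simp add: inv_mult int_pow_diff m_ac)
    moreover have "a / b = (a' * inverse b') * c powi (n - m)"
      unfolding 1 2 using c0 by (simp add: power_int_diff divide_inverse)
    moreover have "(k \<otimes> inv l, a' * inverse b') \<in> R"
      using partial_character_mult[OF R 1(3) partial_character_inv[OF R 2(3)]] .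
    ultimately show "(y \<otimes> inv z, a / b) \<in> R'" using R'I by metis
  next
    fix a assume "(\<one>, a) \<in> R'"
    then obtain k a' n where
      1: "\<one> = k \<otimes> x [^] (n::int)" "a = a' * c powi n" "(k, a') \<in> R"
      unfolding R'_def by blast
    have k: "k \<in> carrier G" "a' \<noteq> 0" using 1 partial_characterD[OF R] by auto
    have "inv k = x [^] n"
      using k x 1(1) by (metis inv_equality int_pow_closed m_comm)
    then have "c powi n = inverse a'"
      using c(3) partial_character_inv[OF R 1(3)] by metis
    then show "a = 1" using 1 k by simp
  qed
  moreover have "(x, c) \<in> R'"
    using R'I[OF one, of 1] x by simp
  ultimately show thesis
    using that RR' c(2) by (metis subrelI)
qed

lemma partial_character_total:
  assumes R: "partial_character G R"
  obtains \<psi> where "\<psi> \<in> circle_characters G" "\<And>x a. (x, a) \<in> R \<Longrightarrow> \<psi> x = a"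
proof -
  let ?A = "{S. partial_character G S \<and> R \<subseteq> S}"
  have "\<exists>M\<in>?A. \<forall>X\<in>?A. M \<subseteq> X \<longrightarrow> X = M"
  proof (rule subset_Zorn_nonempty)
    show "?A \<noteq> {}" using R by auto
  next
    fix C assume C: "C \<noteq> {}" "subset.chain ?A C"
    have sub: "C \<subseteq> ?A" and tot: "\<And>X Y. X \<in> C \<Longrightarrow> Y \<in> C \<Longrightarrow> X \<subseteq> Y \<or> Y \<subseteq> X"
      using C unfolding subset_chain_def by blast+
    have "partial_character G (\<Union>C)"
      unfolding partial_character_def
    proof (intro conjI allI impI)
      show "\<Union>C \<subseteq> carrier G \<times> sphere 0 1" "(\<one>, 1) \<in> \<Union>C"
        using sub C(1) unfolding partial_character_def by blast+
    next
      fix y a z b assume "(y, a) \<in> \<Union>C" "(z, b) \<in> \<Union>C"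
      then obtain X Y where "X \<in> C" "Y \<in> C" "(y, a) \<in> X" "(z, b) \<in> Y" by blast
      then obtain Z where Z: "Z \<in> C" "(y, a) \<in> Z" "(z, b) \<in> Z" using tot by blast
      then have "partial_character G Z" using sub by blast
      then show "(y \<otimes> inv z, a / b) \<in> \<Union>C" using Z unfolding partial_character_def by blast
    next
      fix a assume "(\<one>, a) \<in> \<Union>C"
      then show "a = 1" using sub unfolding partial_character_def by blast
    qed
    then show "\<Union>C \<in> ?A" using sub C(1) by blast
  qed
  then obtain M where M: "M \<in> ?A" and "\<forall>X\<in>?A. M \<subseteq> X \<longrightarrow> X = M" ..
  then have max: "X = M" if "partial_character G X" "M \<subseteq> X" for X
    using that by blast
  have M: "partial_character G M" "R \<subseteq> M" using M by auto
  have dom: "x \<in> Domain M" if x: "x \<in> carrier G" for x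
  proof (rule ccontr)
    assume "x \<notin> Domain M"
    then obtain M' c where M': "partial_character G M'" "M \<subseteq> M'" "(x, c) \<in> M'"
      by (rule partial_character_step[OF M(1) x])
    have "M' = M" using M'(1,2) by (rule max)
    then show False using M'(3) \<open>x \<notin> Domain M\<close> by blast
  qed
  define \<psi> where "\<psi> = restrict (\<lambda>x. THE a. (x, a) \<in> M) (carrier G)"
  have val: "\<psi> x = a" if "(x, a) \<in> M" for x a
  proof -
    have "(THE b. (x, b) \<in> M) = a"
      using that partial_character_unique[OF M(1) _ that] by (rule the_equality)
    then show ?thesis using partial_characterD[OF M(1) that] by (simp add: \<psi>_def)
  qed
  have mem: "(x, \<psi> x) \<in> M" if x: "x \<in> carrier G" for x
  proof -
    obtain a where "(x, a) \<in> M" using dom[OF x] by blast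
    then show ?thesis using val by metis
  qed
  have "\<psi> (x \<otimes> y) = \<psi> x * \<psi> y" if "x \<in> carrier G" "y \<in> carrier G" for x y
    using that by (intro val partial_character_mult[OF M(1)] mem)
  moreover have "\<psi> \<in> extensional (carrier G)" by (simp add: \<psi>_def)
  ultimately have "\<psi> \<in> circle_characters G"
    using partial_characterD(2)[OF M(1) mem] by (simp add: circle_characters_def)
  moreover have "\<psi> x = a" if "(x, a) \<in> R" for x a
    using that M(2) by (intro val) blast
  ultimately show thesis by (rule that)
qed

lemma subgroup_is_comm_group:
  assumes "subgroup H G"
  shows "comm_group (G\<lparr>carrier := H\<rparr>)"
proof -
  have "group (G\<lparr>carrier := H\<rparr>)" by (rule subgroup_imp_group[OF assms])
  then show ?thesis
    by (rule group.group_comm_groupI) (simp add: m_comm subgroup.mem_carrier[OF assms])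
qed

lemma partial_character_of_subgroup:
  assumes H: "subgroup H G" and \<theta>: "\<theta> \<in> circle_characters (G\<lparr>carrier := H\<rparr>)"
  shows "partial_character G {(h, \<theta> h) | h. h \<in> H}"
proof -
  interpret H: comm_group "G\<lparr>carrier := H\<rparr>" by (rule subgroup_is_comm_group[OF H])
  have [simp]: "\<theta> \<one> = 1" using H.circle_character_one[OF \<theta>] by simp
  have "\<theta> (x \<otimes> inv y) = \<theta> x / \<theta> y" if "x \<in> H" "y \<in> H" for x y
  proof -
    have "\<theta> ((x \<otimes> inv y) \<otimes> y) = \<theta> (x \<otimes> inv y) * \<theta> y"
      using circle_character_mult[OF \<theta>, of "x \<otimes> inv y" y] that H
      by (simp add: subgroup.m_closed subgroup.m_inv_closed)
    moreover have "(x \<otimes> inv y) \<otimes> y = x"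
      using that H by (simp add: m_assoc subgroup.mem_carrier)
    moreover have "\<theta> y \<noteq> 0" using circle_character_norm[OF \<theta>, of y] that by auto
    ultimately show ?thesis by (simp add: field_simps)
  qed
  moreover have "norm (\<theta> h) = 1" "h \<in> carrier G" if "h \<in> H" for h
    using circle_character_norm[OF \<theta>] subgroup.mem_carrier[OF H] that by simp_all
  moreover have "x \<otimes> inv y \<in> H" if "x \<in> H" "y \<in> H" for x y
    using H that by (simp add: subgroup.m_closed subgroup.m_inv_closed)
  moreover have "\<one> \<in> H" using H by (rule subgroup.one_closed)
  ultimately show ?thesis
    unfolding partial_character_def by (intro conjI; force)
qed

theorem circle_character_extension:
  assumes "subgroup H G" "\<theta> \<in> circle_characters (G\<lparr>carrier := H\<rparr>)"
  obtains \<psi> where "\<psi> \<in> circle_characters G" "\<And>h. h \<in> H \<Longrightarrow> \<psi> h = \<theta> h"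
proof -
  obtain \<psi> where \<psi>: "\<psi> \<in> circle_characters G"
    "\<And>x a. (x, a) \<in> {(h, \<theta> h) | h. h \<in> H} \<Longrightarrow> \<psi> x = a"
    by (rule partial_character_total[OF partial_character_of_subgroup[OF assms]]) (rule that)
  have "\<psi> h = \<theta> h" if "h \<in> H" for h using \<psi>(2) that by simp
  then show thesis by (rule that[OF \<psi>(1)])
qed

text \<open>
  The trivial character of \<open>H\<close> is first extended to \<open>x\<close> with a value other than \<open>1\<close>, then to \<open>G\<close>.
\<close>

theorem circle_character_separates:
  assumes H: "subgroup H G" and x: "x \<in> carrier G" "x \<notin> H"
  obtains \<psi> where "\<psi> \<in> circle_characters G" "\<And>h. h \<in> H \<Longrightarrow> \<psi> h = 1" "\<psi> x \<noteq> 1"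
proof -
  let ?R = "{(h, restrict (\<lambda>_. 1) H h :: complex) | h. h \<in> H}"
  have "restrict (\<lambda>_. 1) H \<in> circle_characters (G\<lparr>carrier := H\<rparr>)"
    using H by (auto simp: circle_characters_def subgroup.m_closed)
  then have R: "partial_character G ?R" by (rule partial_character_of_subgroup[OF H])
  obtain R' c where R': "partial_character G R'" "?R \<subseteq> R'" "(x, c) \<in> R'" "c \<noteq> 1"
  proof (rule partial_character_step[OF R x(1)])
    show "x \<notin> Domain ?R" using x(2) by auto
  qed
  obtain \<psi> where \<psi>: "\<psi> \<in> circle_characters G" "\<And>x a. (x, a) \<in> R' \<Longrightarrow> \<psi> x = a"
    by (rule partial_character_total[OF R'(1)]) (rule that)
  have 1: "\<psi> h = 1" if "h \<in> H" for h
  proof (rule \<psi>(2))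
    have "(h, 1) \<in> ?R" using that by simp
    then show "(h, 1) \<in> R'" using R'(2) by blast
  qed
  have "\<psi> x \<noteq> 1" using \<psi>(2)[OF R'(3)] R'(4) by simp
  with \<psi>(1) 1 show thesis by (rule that)
qed

end

section \<open>Fourier analysis on finite abelian groups\<close>

context comm_group
begin

abbreviation trivial_character :: "'a \<Rightarrow> complex" where
  "trivial_character \<equiv> restrict (\<lambda>_. 1) (carrier G)"

lemma trivial_circle_character: "trivial_character \<in> circle_characters G"
  by (auto simp: circle_characters_def)

lemma circle_character_eqI:
  assumes "\<psi> \<in> circle_characters G" "\<phi> \<in> circle_characters G"
    and "\<And>x. x \<in> carrier G \<Longrightarrow> \<psi> x = \<phi> x"
  shows "\<psi> = \<phi>"
  using assms by (intro extensionalityI[of _ "carrier G"]) (auto simp: circle_characters_def)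

lemma circle_character_times:
  assumes "\<psi> \<in> circle_characters G" "\<phi> \<in> circle_characters G"
  shows "(\<lambda>x\<in>carrier G. \<psi> x * \<phi> x) \<in> circle_characters G"
  using assms by (auto simp: circle_characters_def norm_mult)

lemma circle_character_cnj:
  assumes "\<psi> \<in> circle_characters G"
  shows "(\<lambda>x\<in>carrier G. cnj (\<psi> x)) \<in> circle_characters G"
  using assms by (auto simp: circle_characters_def)

lemma finite_circle_characters:
  assumes fin: "finite (carrier G)"
  shows "finite (circle_characters G)"
proof (rule finite_subset)
  have "0 < order G" using fin by (simp add: order_gt_0_iff_finite)
  then show "finite (carrier G \<rightarrow>\<^sub>E {z::complex. z ^ order G = 1})"
    using fin by (intro finite_PiE finite_roots_unity) auto
  have "\<psi> x ^ n = \<psi> (x [^] n)" if \<psi>: "\<psi> \<in> circle_characters G" and x: "x \<in> carrier G" for \<psi> x and n :: nat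
    using x by (induction n)
      (simp_all add: circle_character_one[OF \<psi>] circle_character_mult[OF \<psi>] mult.commute)
  then have "\<psi> x ^ order G = 1" if "\<psi> \<in> circle_characters G" "x \<in> carrier G" for \<psi> x
    using that by (simp add: pow_order_eq_1 circle_character_one)
  then show "circle_characters G \<subseteq> carrier G \<rightarrow>\<^sub>E {z. z ^ order G = 1}"
    by (auto simp: PiE_def circle_characters_def)
qed

text \<open>
  Translation by an element \<open>u\<close> with \<open>\<psi> u \<noteq> 1\<close> permutes the summands and multiplies the sum by
  \<open>\<psi> u\<close>.
\<close>

lemma sum_circle_character:
  assumes \<psi>: "\<psi> \<in> circle_characters G" and nt: "\<psi> \<noteq> trivial_character"
  shows "(\<Sum>x\<in>carrier G. \<psi> x) = 0"
proof -
  obtain u where u: "u \<in> carrier G" "\<psi> u \<noteq> 1"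
    using circle_character_eqI[OF \<psi> trivial_circle_character] nt by auto
  have "(\<Sum>x\<in>carrier G. \<psi> x) = (\<Sum>x\<in>carrier G. \<psi> (u \<otimes> x))"
    by (rule sum.reindex_bij_betw[symmetric])
      (use u in \<open>auto intro!: bij_betwI[of _ _ _ "\<lambda>x. inv u \<otimes> x"] simp: m_assoc[symmetric]\<close>)
  also have "\<dots> = \<psi> u * (\<Sum>x\<in>carrier G. \<psi> x)"
    using u by (simp add: circle_character_mult[OF \<psi>] sum_distrib_left)
  finally have "(1 - \<psi> u) * (\<Sum>x\<in>carrier G. \<psi> x) = 0" by (simp add: algebra_simps)
  then show ?thesis using u by simp
qed

text \<open>
  The same argument in the dual group, with multiplication by a character that is nontrivial at \<open>x\<close>.
\<close>

lemma sum_over_circle_characters: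
  assumes x: "x \<in> carrier G" "x \<noteq> \<one>"
  shows "(\<Sum>\<psi>\<in>circle_characters G. \<psi> x) = 0"
proof -
  have "subgroup {\<one>} G" by (rule triv_subgroup)
  moreover have "x \<notin> {\<one>}" using x by simp
  ultimately obtain \<phi> where \<phi>: "\<phi> \<in> circle_characters G" "\<phi> x \<noteq> 1"
    using circle_character_separates[OF _ x(1)] by metis
  let ?m = "\<lambda>\<psi>. \<lambda>x\<in>carrier G. \<phi> x * \<psi> x"
  let ?m' = "\<lambda>\<psi>. \<lambda>x\<in>carrier G. cnj (\<phi> x) * \<psi> x"
  have c: "\<phi> x * cnj (\<phi> x) = 1" "cnj (\<phi> x) * \<phi> x = 1" if "x \<in> carrier G" for x
    using circle_character_norm[OF \<phi>(1) that] by (simp_all add: complex_norm_square [symmetric] mult.commute)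
  have "bij_betw ?m (circle_characters G) (circle_characters G)"
  proof (rule bij_betwI[of _ _ _ ?m'])
    show "?m \<in> circle_characters G \<rightarrow> circle_characters G"
      using circle_character_times[OF \<phi>(1)] by auto
    show "?m' \<in> circle_characters G \<rightarrow> circle_characters G"
    proof
      fix \<psi> assume "\<psi> \<in> circle_characters G"
      with circle_character_times[OF circle_character_cnj[OF \<phi>(1)] this]
      show "?m' \<psi> \<in> circle_characters G" by (simp cong: restrict_cong)
    qed
    show "?m' (?m \<psi>) = \<psi>" "?m (?m' \<psi>) = \<psi>" if "\<psi> \<in> circle_characters G" for \<psi>
      using that c
      by (auto intro!: extensionalityI[of _ "carrier G"] simp: circle_characters_def mult.assoc[symmetric])
  qed
  then have "(\<Sum>\<psi>\<in>circle_characters G. \<psi> x) = (\<Sum>\<psi>\<in>circle_characters G. ?m \<psi> x)"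
    by (rule sum.reindex_bij_betw[symmetric])
  also have "\<dots> = \<phi> x * (\<Sum>\<psi>\<in>circle_characters G. \<psi> x)"
    using x by (simp add: sum_distrib_left)
  finally have "(1 - \<phi> x) * (\<Sum>\<psi>\<in>circle_characters G. \<psi> x) = 0" by (simp add: algebra_simps)
  then show ?thesis using \<phi> by simp
qed

text \<open>
  Summing \<open>\<psi> x\<close> over all \<open>\<psi>\<close> and \<open>x\<close> gives either cardinality, depending on which sum is carried
  out first.
\<close>

lemma card_circle_characters:
  assumes fin: "finite (carrier G)"
  shows "card (circle_characters G) = card (carrier G)"
proof -
  have "(\<Sum>\<psi>\<in>circle_characters G. \<Sum>x\<in>carrier G. \<psi> x) =
        (\<Sum>\<psi>\<in>circle_characters G. if \<psi> = trivial_character then of_nat (card (carrier G)) else 0)"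
    using sum_circle_character by (intro sum.cong) auto
  also have "\<dots> = of_nat (card (carrier G))"
    using trivial_circle_character finite_circle_characters[OF fin] by simp
  finally have 1: "(\<Sum>\<psi>\<in>circle_characters G. \<Sum>x\<in>carrier G. \<psi> x) = of_nat (card (carrier G))" .
  have "(\<Sum>x\<in>carrier G. \<Sum>\<psi>\<in>circle_characters G. \<psi> x) =
        (\<Sum>x\<in>carrier G. if x = \<one> then of_nat (card (circle_characters G)) else 0)"
  proof (rule sum.cong[OF refl])
    fix x assume x: "x \<in> carrier G"
    have "(\<Sum>\<psi>\<in>circle_characters G. \<psi> \<one>) = (\<Sum>\<psi>\<in>circle_characters G. 1)"
      using circle_character_one by (intro sum.cong) auto
    then show "(\<Sum>\<psi>\<in>circle_characters G. \<psi> x) =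
        (if x = \<one> then of_nat (card (circle_characters G)) else 0)"
      using sum_over_circle_characters[OF x] by simp
  qed
  also have "\<dots> = of_nat (card (circle_characters G))"
    using fin by simp
  finally show ?thesis
    using 1 sum.swap[of "\<lambda>\<psi> x. \<psi> x" "carrier G" "circle_characters G"]
    by (metis of_nat_eq_iff)
qed

definition fourier :: "('a \<Rightarrow> real) \<Rightarrow> ('a \<Rightarrow> complex) \<Rightarrow> complex" where
  "fourier f \<psi> = (\<Sum>z\<in>carrier G. of_real (f z) * cnj (\<psi> z))"

lemma fourier_times_cnj:
  assumes "\<psi> \<in> circle_characters G"
  shows "fourier f \<psi> * cnj (fourier f \<psi>) =
    (\<Sum>(z, w)\<in>carrier G \<times> carrier G. of_real (f z * f w) * \<psi> (inv z \<otimes> w))"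
proof -
  have "fourier f \<psi> * cnj (fourier f \<psi>) =
     (\<Sum>(z, w)\<in>carrier G \<times> carrier G. (of_real (f z) * cnj (\<psi> z)) * (of_real (f w) * \<psi> w))"
    by (simp add: fourier_def sum_product sum.cartesian_product)
  also have "\<dots> = (\<Sum>(z, w)\<in>carrier G \<times> carrier G. of_real (f z * f w) * \<psi> (inv z \<otimes> w))"
    by (rule sum.cong)
      (auto simp: circle_character_mult[OF assms] circle_character_inv[OF assms] algebra_simps)
  finally show ?thesis .
qed

lemma parseval:
  fixes f :: "'a \<Rightarrow> real"
  assumes fin: "finite (carrier G)"
  shows "(\<Sum>\<psi>\<in>circle_characters G. (norm (fourier f \<psi>))\<^sup>2) =
    card (carrier G) * (\<Sum>z\<in>carrier G. (f z)\<^sup>2)"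
proof -
  let ?C = "carrier G \<times> carrier G"
  have "complex_of_real (\<Sum>\<psi>\<in>circle_characters G. (norm (fourier f \<psi>))\<^sup>2) =
    (\<Sum>\<psi>\<in>circle_characters G. fourier f \<psi> * cnj (fourier f \<psi>))"
    by (simp add: complex_norm_square del: of_real_power)
  also have "\<dots> = (\<Sum>\<psi>\<in>circle_characters G. \<Sum>(z, w)\<in>?C. of_real (f z * f w) * \<psi> (inv z \<otimes> w))"
    by (intro sum.cong fourier_times_cnj) auto
  also have "\<dots> = (\<Sum>(z, w)\<in>?C. \<Sum>\<psi>\<in>circle_characters G. of_real (f z * f w) * \<psi> (inv z \<otimes> w))"
    by (subst sum.swap) (simp add: case_prod_unfold)
  also have "\<dots> = (\<Sum>(z, w)\<in>?C. if z = w then of_real (f z * f w) * of_nat (card (carrier G)) else 0)"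
  proof (rule sum.cong[OF refl], clarify)
    fix z w assume zw: "z \<in> carrier G" "w \<in> carrier G"
    have "(\<Sum>\<psi>\<in>circle_characters G. \<psi> (inv z \<otimes> w)) =
        (if z = w then of_nat (card (carrier G)) else 0)"
    proof (cases "z = w")
      case True
      have "(\<Sum>\<psi>\<in>circle_characters G. \<psi> \<one>) = (\<Sum>\<psi>\<in>circle_characters G. 1)"
        using circle_character_one by (intro sum.cong) auto
      then show ?thesis using zw True by (simp add: card_circle_characters[OF fin])
    next
      case False
      then have "inv z \<otimes> w \<noteq> \<one>" using zw by (metis inv_equality inv_inv inv_closed m_comm)
      then show ?thesis using zw False by (simp add: sum_over_circle_characters)
    qed
    then show "(\<Sum>\<psi>\<in>circle_characters G. of_real (f z * f w) * \<psi> (inv z \<otimes> w)) =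
      (if z = w then of_real (f z * f w) * of_nat (card (carrier G)) else 0)"
      by (simp add: sum_distrib_left[symmetric])
  qed
  also have "\<dots> = (\<Sum>z\<in>carrier G. of_real ((f z)\<^sup>2) * of_nat (card (carrier G)))"
    using fin by (simp add: sum.cartesian_product[symmetric] power2_eq_square)
  also have "\<dots> = complex_of_real (card (carrier G) * (\<Sum>z\<in>carrier G. (f z)\<^sup>2))"
    by (simp add: sum_distrib_left mult.commute)
  finally show ?thesis by (simp only: of_real_eq_iff)
qed

text \<open>
  Expanding the fourth powers and summing over all characters first leaves, by orthogonality, only
  the quadruples with \<open>t \<otimes> (z2 \<otimes> z4) = z1 \<otimes> z3\<close>, weighted by the product of the four values of \<open>f\<close>.
\<close>

lemma fourier_fourth_moment:
  fixes f :: "'a \<Rightarrow> real"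
  assumes t: "t \<in> carrier G"
    and ne: "(\<Sum>\<psi>\<in>circle_characters G. of_real ((norm (fourier f \<psi>)) ^ 4) * \<psi> t) \<noteq> 0"
  defines "A \<equiv> {z \<in> carrier G. f z \<noteq> 0}"
  shows "\<exists>z1\<in>A. \<exists>z2\<in>A. \<exists>z3\<in>A. \<exists>z4\<in>A. t \<otimes> (z2 \<otimes> z4) = z1 \<otimes> z3"
proof (rule ccontr)
  assume no: "\<not> ?thesis"
  let ?C = "carrier G \<times> carrier G"
  let ?g = "\<lambda>((z1, z2), (z3, z4)) \<psi>. complex_of_real (f z1 * f z2) * complex_of_real (f z3 * f z4) *
      \<psi> ((inv z1 \<otimes> z2) \<otimes> (inv z3 \<otimes> z4) \<otimes> t)"
  have "(\<Sum>\<psi>\<in>circle_characters G. of_real ((norm (fourier f \<psi>)) ^ 4) * \<psi> t) =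
        (\<Sum>\<psi>\<in>circle_characters G. \<Sum>q\<in>?C \<times> ?C. ?g q \<psi>)"
  proof (rule sum.cong[OF refl])
    fix \<psi> assume \<psi>: "\<psi> \<in> circle_characters G"
    have "complex_of_real ((norm (fourier f \<psi>)) ^ 4) =
       (fourier f \<psi> * cnj (fourier f \<psi>)) * (fourier f \<psi> * cnj (fourier f \<psi>))"
      unfolding complex_norm_square[symmetric] of_real_mult[symmetric]
      by (simp only: power_add[symmetric]) simp
    also have "\<dots> * \<psi> t = (\<Sum>((z1, z2), (z3, z4))\<in>?C \<times> ?C.
        (of_real (f z1 * f z2) * \<psi> (inv z1 \<otimes> z2)) * (of_real (f z3 * f z4) * \<psi> (inv z3 \<otimes> z4)) * \<psi> t)"
      unfolding fourier_times_cnj[OF \<psi>] sum_product sum.cartesian_product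
      unfolding sum_distrib_right by (simp add: case_prod_unfold)
    also have "\<dots> = (\<Sum>q\<in>?C \<times> ?C. ?g q \<psi>)"
      by (rule sum.cong) (auto simp: circle_character_mult[OF \<psi>] t algebra_simps)
    finally show "of_real ((norm (fourier f \<psi>)) ^ 4) * \<psi> t = (\<Sum>q\<in>?C \<times> ?C. ?g q \<psi>)" .
  qed
  also have "\<dots> = (\<Sum>q\<in>?C \<times> ?C. \<Sum>\<psi>\<in>circle_characters G. ?g q \<psi>)"
    by (rule sum.swap)
  also have "\<dots> = 0"
  proof (rule sum.neutral, rule ballI)
    fix q assume "q \<in> ?C \<times> ?C"
    then obtain z1 z2 z3 z4 where q: "q = ((z1, z2), (z3, z4))" and
      z: "z1 \<in> carrier G" "z2 \<in> carrier G" "z3 \<in> carrier G" "z4 \<in> carrier G" by auto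
    let ?u = "(inv z1 \<otimes> z2) \<otimes> (inv z3 \<otimes> z4) \<otimes> t"
    have u: "?u \<in> carrier G" using z t by simp
    have eq: "?u = inv (z1 \<otimes> z3) \<otimes> (t \<otimes> (z2 \<otimes> z4))" using z t by (simp add: inv_mult m_ac)
    have "f z1 * f z2 * (f z3 * f z4) = 0 \<or> ?u \<noteq> \<one>"
    proof (rule ccontr)
      assume "\<not> ?thesis"
      then have nz: "f z1 \<noteq> 0" "f z2 \<noteq> 0" "f z3 \<noteq> 0" "f z4 \<noteq> 0" and 1: "?u = \<one>" by auto
      have "z1 \<otimes> z3 = t \<otimes> (z2 \<otimes> z4)"
        using 1 z t unfolding eq by (metis inv_closed inv_equality inv_inv m_closed m_comm)
      moreover have "z1 \<in> A" "z2 \<in> A" "z3 \<in> A" "z4 \<in> A" using z nz by (simp_all add: A_def)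
      ultimately show False using no by metis
    qed
    then show "(\<Sum>\<psi>\<in>circle_characters G. ?g q \<psi>) = 0"
    proof
      assume "f z1 * f z2 * (f z3 * f z4) = 0"
      then show ?thesis by (auto simp: q intro!: sum.neutral)
    next
      assume "?u \<noteq> \<one>"
      then have "(\<Sum>\<psi>\<in>circle_characters G. \<psi> ?u) = 0"
        by (rule sum_over_circle_characters[OF u])
      then show ?thesis by (simp only: q prod.case sum_distrib_left[symmetric] mult_zero_right)
    qed
  qed
  finally show False using ne by simp
qed

text \<open>
  By Parseval's identity the number of large Fourier coefficients is bounded in terms of \<open>\<alpha>\<close> alone.
  Let \<open>N\<close> be the order of the group. If the characters with large coefficients have nonnegative real
  part at \<open>t\<close>, the fourth moment at \<open>t\<close> has positive real part: the trivial character contributes at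
  least \<open>(\<alpha> * N) ^ 4\<close>, and the small coefficients together at most a quarter of this in absolute
  value.
\<close>

theorem bogolyubov:
  fixes f :: "'a \<Rightarrow> real" and \<alpha> :: real
  assumes fin: "finite (carrier G)" and f: "\<And>z. z \<in> carrier G \<Longrightarrow> 0 \<le> f z \<and> f z \<le> 1"
    and \<alpha>: "0 < \<alpha>" and mass: "(\<Sum>z\<in>carrier G. f z) \<ge> \<alpha> * card (carrier G)"
  defines "A \<equiv> {z \<in> carrier G. f z \<noteq> 0}"
    and "\<Lambda> \<equiv> {\<psi> \<in> circle_characters G. norm (fourier f \<psi>) \<ge> \<alpha>\<^sup>2 / 2 * card (carrier G)}"
  shows "card \<Lambda> \<le> 4 / \<alpha> ^ 4"
    and "\<And>t. t \<in> carrier G \<Longrightarrow> (\<And>\<psi>. \<psi> \<in> \<Lambda> \<Longrightarrow> 0 \<le> Re (\<psi> t)) \<Longrightarrow>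
      \<exists>z1\<in>A. \<exists>z2\<in>A. \<exists>z3\<in>A. \<exists>z4\<in>A. t \<otimes> (z2 \<otimes> z4) = z1 \<otimes> z3"
proof -
  let ?N = "real (card (carrier G))" and ?X = "circle_characters G"
  let ?F = "\<lambda>\<psi>. norm (fourier f \<psi>)"
  \<comment> \<open>with this threshold the small coefficients contribute at most \<open>(\<eta> * ?N)\<^sup>2 * ?N\<^sup>2\<close>, which is
     \<open>(\<alpha> * ?N) ^ 4 / 4\<close>\<close>
  define \<eta> where "\<eta> = \<alpha>\<^sup>2 / 2"
  have \<eta>: "\<eta> > 0" using \<alpha> by (simp add: \<eta>_def)
  have N: "?N > 0" using fin one_closed by (auto simp: card_gt_0_iff)
  have finX: "finite ?X" by (rule finite_circle_characters[OF fin])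
  have \<Lambda>X: "\<Lambda> \<subseteq> ?X" by (auto simp: \<Lambda>_def)
  have "(\<Sum>z\<in>carrier G. f z) \<le> (\<Sum>z\<in>carrier G. 1)" using f by (intro sum_mono) auto
  then have "\<alpha> * ?N \<le> 1 * ?N" using mass by simp
  then have \<alpha>1: "\<alpha> \<le> 1" using N by simp
  have "(\<Sum>z\<in>carrier G. (f z)\<^sup>2) \<le> (\<Sum>z\<in>carrier G. 1)"
    using f by (intro sum_mono) (simp add: power_le_one)
  then have energy: "(\<Sum>\<psi>\<in>?X. (?F \<psi>)\<^sup>2) \<le> ?N\<^sup>2"
    using mult_left_mono[of _ _ ?N] N by (simp add: parseval[OF fin] power2_eq_square[of ?N])
  have "card \<Lambda> * (\<eta> * ?N)\<^sup>2 = (\<Sum>\<psi>\<in>\<Lambda>. (\<eta> * ?N)\<^sup>2)" by simp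
  also have "\<dots> \<le> (\<Sum>\<psi>\<in>\<Lambda>. (?F \<psi>)\<^sup>2)"
    using \<eta> N by (intro sum_mono power_mono) (auto simp: \<Lambda>_def \<eta>_def)
  also have "\<dots> \<le> (\<Sum>\<psi>\<in>?X. (?F \<psi>)\<^sup>2)" using finX \<Lambda>X by (intro sum_mono2) auto
  also have "\<dots> \<le> ?N\<^sup>2" by (rule energy)
  finally have "card \<Lambda> * \<eta>\<^sup>2 \<le> 1" using N by (simp add: power_mult_distrib mult.assoc[symmetric])
  then show "card \<Lambda> \<le> 4 / \<alpha> ^ 4"
    using \<alpha> by (simp add: \<eta>_def field_simps flip: power_mult)
  fix t assume t: "t \<in> carrier G" and pos: "\<And>\<psi>. \<psi> \<in> \<Lambda> \<Longrightarrow> 0 \<le> Re (\<psi> t)"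
  let ?T = trivial_character
  have "fourier f ?T = of_real (\<Sum>z\<in>carrier G. f z)" by (simp add: fourier_def)
  then have FT: "?F ?T \<ge> \<alpha> * ?N" using mass by (metis abs_ge_self norm_of_real order_trans)
  have "\<alpha>\<^sup>2 / 2 \<le> \<alpha>"
    using \<alpha> \<alpha>1 mult_left_le[of \<alpha> \<alpha>] by (simp add: power2_eq_square)
  then have "\<alpha>\<^sup>2 / 2 * ?N \<le> \<alpha> * ?N" using N by (intro mult_right_mono) auto
  then have T\<Lambda>: "?T \<in> \<Lambda>"
    using FT trivial_circle_character unfolding \<Lambda>_def by simp
  let ?R = "\<lambda>\<psi>. (?F \<psi>) ^ 4 * Re (\<psi> t)"
  have "\<bar>\<Sum>\<psi>\<in>?X - \<Lambda>. ?R \<psi>\<bar> \<le> (\<Sum>\<psi>\<in>?X - \<Lambda>. (\<eta> * ?N)\<^sup>2 * (?F \<psi>)\<^sup>2)"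
  proof (rule order_trans[OF sum_abs sum_mono])
    fix \<psi> assume \<psi>: "\<psi> \<in> ?X - \<Lambda>"
    then have "?F \<psi> \<le> \<eta> * ?N" by (auto simp: \<Lambda>_def \<eta>_def)
    then have "(?F \<psi>)\<^sup>2 \<le> (\<eta> * ?N)\<^sup>2" by (intro power_mono) auto
    moreover have "\<bar>Re (\<psi> t)\<bar> \<le> 1"
      using abs_Re_le_cmod[of "\<psi> t"] \<psi> t circle_character_norm by fastforce
    ultimately have "(?F \<psi>)\<^sup>2 * (?F \<psi>)\<^sup>2 * \<bar>Re (\<psi> t)\<bar> \<le> (\<eta> * ?N)\<^sup>2 * (?F \<psi>)\<^sup>2 * 1"
      by (intro mult_mono) auto
    then show "\<bar>?R \<psi>\<bar> \<le> (\<eta> * ?N)\<^sup>2 * (?F \<psi>)\<^sup>2"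
      by (simp add: abs_mult flip: power_add)
  qed
  also have "\<dots> = (\<eta> * ?N)\<^sup>2 * (\<Sum>\<psi>\<in>?X - \<Lambda>. (?F \<psi>)\<^sup>2)" by (simp add: sum_distrib_left)
  also have "\<dots> \<le> (\<eta> * ?N)\<^sup>2 * ?N\<^sup>2"
  proof (rule mult_left_mono)
    have "(\<Sum>\<psi>\<in>?X - \<Lambda>. (?F \<psi>)\<^sup>2) \<le> (\<Sum>\<psi>\<in>?X. (?F \<psi>)\<^sup>2)"
      using finX by (intro sum_mono2) auto
    then show "(\<Sum>\<psi>\<in>?X - \<Lambda>. (?F \<psi>)\<^sup>2) \<le> ?N\<^sup>2" using energy by linarith
  qed simp
  also have "\<dots> < (\<alpha> * ?N) ^ 4"
    using \<alpha> N by (simp add: \<eta>_def power_mult_distrib power_divide flip: power_mult power_add)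
  finally have small: "\<bar>\<Sum>\<psi>\<in>?X - \<Lambda>. ?R \<psi>\<bar> < (\<alpha> * ?N) ^ 4" .
  have "(\<alpha> * ?N) ^ 4 \<le> (?F ?T) ^ 4" using FT \<alpha> by (intro power_mono) auto
  also have "\<dots> = (\<Sum>\<psi>\<in>{?T}. ?R \<psi>)" using t by simp
  also have "\<dots> \<le> (\<Sum>\<psi>\<in>\<Lambda>. ?R \<psi>)"
    using finite_subset[OF \<Lambda>X finX] T\<Lambda> pos by (intro sum_mono2) auto
  finally have "0 < (\<Sum>\<psi>\<in>\<Lambda>. ?R \<psi>) + (\<Sum>\<psi>\<in>?X - \<Lambda>. ?R \<psi>)" using small by linarith
  also have "\<dots> = (\<Sum>\<psi>\<in>?X. ?R \<psi>)" using sum.subset_diff[OF \<Lambda>X finX, of ?R] by simp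
  also have "\<dots> = Re (\<Sum>\<psi>\<in>?X. of_real ((?F \<psi>) ^ 4) * \<psi> t)" by (simp del: of_real_power)
  finally have "(\<Sum>\<psi>\<in>?X. of_real ((?F \<psi>) ^ 4) * \<psi> t) \<noteq> 0"
    by (metis less_irrefl zero_complex.sel(1))
  from fourier_fourth_moment[OF t this]
  show "\<exists>z1\<in>A. \<exists>z2\<in>A. \<exists>z3\<in>A. \<exists>z4\<in>A. t \<otimes> (z2 \<otimes> z4) = z1 \<otimes> z3"
    unfolding A_def .
qed

end

text \<open>
  A shift of \<open>f\<close> by \<open>t\<close> multiplies its coefficient at \<open>\<psi>\<close> by \<open>\<psi> t\<close>. Hence a large coefficient forces
  \<open>\<psi> t\<close> to be near \<open>1\<close> whenever \<open>f\<close> changes little under the shift.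
\<close>

lemma (in comm_group) fourier_translate:
  fixes f :: "'a \<Rightarrow> real" and \<delta> :: real
  assumes \<psi>: "\<psi> \<in> circle_characters G" and t: "t \<in> carrier G"
    and \<delta>: "\<And>z. z \<in> carrier G \<Longrightarrow> \<bar>f (z \<otimes> t) - f z\<bar> \<le> \<delta>"
  shows "norm (\<psi> t - 1) * norm (fourier f \<psi>) \<le> card (carrier G) * \<delta>"
proof -
  have 1: "\<psi> t * cnj (\<psi> t) = 1"
    using circle_character_norm[OF \<psi> t] by (simp add: complex_norm_square [symmetric])
  have "fourier f \<psi> = (\<Sum>z\<in>carrier G. of_real (f (z \<otimes> t)) * cnj (\<psi> (z \<otimes> t)))"
    unfolding fourier_def
    by (rule sum.reindex_bij_betw[symmetric])
      (use t in \<open>auto intro!: bij_betwI[of _ _ _ "\<lambda>x. x \<otimes> inv t"] simp: m_assoc\<close>)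
  also have "\<psi> t * \<dots> = (\<Sum>z\<in>carrier G. of_real (f (z \<otimes> t)) * cnj (\<psi> z))"
    unfolding sum_distrib_left
  proof (rule sum.cong[OF refl])
    fix z assume "z \<in> carrier G"
    then have "\<psi> t * (of_real (f (z \<otimes> t)) * cnj (\<psi> (z \<otimes> t))) =
       (\<psi> t * cnj (\<psi> t)) * (of_real (f (z \<otimes> t)) * cnj (\<psi> z))"
      by (simp add: circle_character_mult[OF \<psi>] t)
    then show "\<psi> t * (of_real (f (z \<otimes> t)) * cnj (\<psi> (z \<otimes> t))) =
       of_real (f (z \<otimes> t)) * cnj (\<psi> z)" by (simp add: 1)
  qed
  finally have "(\<psi> t - 1) * fourier f \<psi> = (\<Sum>z\<in>carrier G. of_real (f (z \<otimes> t) - f z) * cnj (\<psi> z))"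
    by (simp add: fourier_def left_diff_distrib sum_subtractf)
  also have "norm \<dots> \<le> (\<Sum>z\<in>carrier G. \<delta>)"
  proof (rule sum_norm_le)
    fix z assume z: "z \<in> carrier G"
    then show "norm (of_real (f (z \<otimes> t) - f z) * cnj (\<psi> z)) \<le> \<delta>"
      using \<delta>[OF z] circle_character_norm[OF \<psi> z]
      by (simp add: norm_mult del: of_real_diff)
  qed
  finally show ?thesis by (simp add: norm_mult)
qed

section \<open>Characters of a totally bounded seminormed group\<close>

locale totally_bounded_seminorm = comm_group G for G (structure) +
  fixes \<rho> :: "'a \<Rightarrow> real"
  assumes seminorm_one: "\<rho> \<one> = 0"
    and seminorm_inv: "x \<in> carrier G \<Longrightarrow> \<rho> (inv x) = \<rho> x"
    and seminorm_mult: "x \<in> carrier G \<Longrightarrow> y \<in> carrier G \<Longrightarrow> \<rho> (x \<otimes> y) \<le> \<rho> x + \<rho> y"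
    and totally_bounded: "0 < \<epsilon> \<Longrightarrow>
      \<exists>F. finite F \<and> F \<subseteq> carrier G \<and> (\<forall>x\<in>carrier G. \<exists>a\<in>F. \<rho> (x \<otimes> inv a) < \<epsilon>)"
begin

lemma seminorm_nonneg: "x \<in> carrier G \<Longrightarrow> 0 \<le> \<rho> x"
  using seminorm_mult[of x "inv x"] by (simp add: seminorm_one seminorm_inv)

definition gdist :: "'a \<Rightarrow> 'a \<Rightarrow> real" where
  "gdist x y = \<rho> (x \<otimes> inv y)"

lemma gdist_one [simp]: "x \<in> carrier G \<Longrightarrow> gdist x \<one> = \<rho> x"
  by (simp add: gdist_def)

lemma gdist_commute: "x \<in> carrier G \<Longrightarrow> y \<in> carrier G \<Longrightarrow> gdist x y = gdist y x"
  using seminorm_inv[of "x \<otimes> inv y"] by (simp add: gdist_def inv_mult m_comm)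

lemma gdist_triangle:
  assumes "x \<in> carrier G" "y \<in> carrier G" "z \<in> carrier G"
  shows "gdist x z \<le> gdist x y + gdist y z"
proof -
  have "inv y \<otimes> (y \<otimes> inv z) = inv z"
    using assms by (simp add: m_assoc[symmetric])
  then have "x \<otimes> inv z = (x \<otimes> inv y) \<otimes> (y \<otimes> inv z)" using assms by (simp add: m_assoc)
  then show ?thesis
    using seminorm_mult[of "x \<otimes> inv y" "y \<otimes> inv z"] assms by (simp add: gdist_def)
qed

lemma gdist_mult:
  assumes "x \<in> carrier G" "y \<in> carrier G" "x' \<in> carrier G" "y' \<in> carrier G"
  shows "gdist (x \<otimes> x') (y \<otimes> y') \<le> gdist x y + gdist x' y'"
proof -
  have "(x \<otimes> x') \<otimes> inv (y \<otimes> y') = (x \<otimes> inv y) \<otimes> (x' \<otimes> inv y')"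
    using assms by (simp add: inv_mult m_ac)
  then show ?thesis
    using seminorm_mult[of "x \<otimes> inv y" "x' \<otimes> inv y'"] assms by (simp add: gdist_def)
qed

lemma gdist_cancel:
  assumes "x \<in> carrier G" "y \<in> carrier G" "z \<in> carrier G"
  shows "gdist (x \<otimes> z) (y \<otimes> z) = gdist x y"
proof -
  have "(x \<otimes> z) \<otimes> inv (y \<otimes> z) = (x \<otimes> inv y) \<otimes> (z \<otimes> inv z)"
    using assms by (simp add: inv_mult m_ac del: r_inv)
  then show ?thesis using assms by (simp add: gdist_def)
qed

lemma gdist_finprod:
  assumes "finite S" "f \<in> S \<rightarrow> carrier G"
  shows "\<rho> (finprod G f S) \<le> (\<Sum>s\<in>S. \<rho> (f s))"
  using assms
proof (induction S rule: finite_induct)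
  case empty
  then show ?case by (simp add: seminorm_one)
next
  case (insert s S)
  then show ?case using seminorm_mult[of "f s" "finprod G f S"] by (fastforce simp: Pi_iff)
qed

text \<open>
  Pigeonhole principle: for two exponents, the powers of each \<open>s \<in> S\<close> lie near the same point of a
  finite net. The bound \<open>2 \<le> M\<close> makes \<open>0\<close> and \<open>1\<close> distinct residues modulo \<open>M\<close>, so that \<open>S\<close> can be
  represented by unit vectors.
\<close>

lemma simultaneous_recurrence:
  assumes S: "finite S" "S \<subseteq> carrier G" and \<epsilon>: "0 < \<epsilon>"
  obtains M :: nat where "2 \<le> M" "\<And>s. s \<in> S \<Longrightarrow> \<rho> (s [^] M) < \<epsilon>"
proof -
  obtain F where F: "finite F" "F \<subseteq> carrier G"
    and cover: "\<forall>x\<in>carrier G. \<exists>a\<in>F. \<rho> (x \<otimes> inv a) < \<epsilon> / 2"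
    using totally_bounded[of "\<epsilon> / 2"] \<epsilon> by auto
  obtain q where q: "\<And>x. x \<in> carrier G \<Longrightarrow> q x \<in> F \<and> gdist x (q x) < \<epsilon> / 2"
    using cover unfolding gdist_def by metis
  define col where "col n = (\<lambda>s\<in>S. q (s [^] n))" for n :: nat
  have "range col \<subseteq> S \<rightarrow>\<^sub>E F" using q S by (auto simp: col_def)
  moreover have "finite (S \<rightarrow>\<^sub>E F)" using S F by (intro finite_PiE)
  ultimately have "finite (range col)" by (rule finite_subset)
  then obtain m where inf: "infinite {n. col n = col m}"
    using pigeonhole_infinite[of UNIV col] by auto
  then obtain n where n: "n \<ge> m + 2" "col n = col m"
    unfolding infinite_nat_iff_unbounded_le by auto
  have "\<rho> (s [^] (n - m)) < \<epsilon>" if s: "s \<in> S" for s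
  proof -
    have sc: "s \<in> carrier G" using s S by auto
    have "s [^] n = s [^] (n - m) \<otimes> s [^] m" using n sc by (simp add: nat_pow_mult)
    then have "s [^] (n - m) = s [^] n \<otimes> inv (s [^] m)" using sc by (simp add: m_assoc)
    then have "\<rho> (s [^] (n - m)) = gdist (s [^] n) (s [^] m)" by (simp add: gdist_def)
    also have "\<dots> \<le> gdist (s [^] n) (q (s [^] n)) + gdist (q (s [^] n)) (s [^] m)"
      using q[of "s [^] n"] sc F by (intro gdist_triangle) auto
    also have "q (s [^] n) = q (s [^] m)"
      using n(2) s unfolding col_def by (metis restrict_apply')
    also have "gdist (q (s [^] m)) (s [^] m) = gdist (s [^] m) (q (s [^] m))"
      using q[of "s [^] m"] sc F by (intro gdist_commute) auto
    finally show ?thesis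
      using q[of "s [^] n"] q[of "s [^] m"] sc \<open>q (s [^] n) = q (s [^] m)\<close> by auto
  qed
  then show thesis using n by (intro that[of "n - m"]) auto
qed

text \<open>
  Integer vectors indexed by \<open>S\<close> are mapped homomorphically to \<open>G\<close> by taking products of powers. If
  the exponents are reduced modulo an \<open>M\<close> for which all \<open>s [^] M\<close> are small, only carries disturb
  this, and they contribute factors \<open>s [^] M\<close>. So a finite group maps almost homomorphically to \<open>G\<close>,
  and its unit vectors hit the elements of \<open>S\<close> exactly.
\<close>

lemma finite_model:
  assumes S: "finite S" "S \<subseteq> carrier G" and \<epsilon>: "0 < \<epsilon>"
  obtains \<Gamma> :: "('a \<Rightarrow> int) monoid" and p e where
    "comm_group \<Gamma>" "finite (carrier \<Gamma>)" "p \<in> carrier \<Gamma> \<rightarrow> carrier G"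
    "\<And>z w. z \<in> carrier \<Gamma> \<Longrightarrow> w \<in> carrier \<Gamma> \<Longrightarrow> gdist (p (z \<otimes>\<^bsub>\<Gamma>\<^esub> w)) (p z \<otimes> p w) \<le> \<epsilon>"
    "\<And>s. s \<in> S \<Longrightarrow> e s \<in> carrier \<Gamma> \<and> p (e s) = s"
proof -
  define \<delta> where "\<delta> = \<epsilon> / (card S + 1)"
  have \<delta>: "0 < \<delta>" "card S * \<delta> \<le> \<epsilon>"
    using \<epsilon> by (auto simp: \<delta>_def field_simps)
  obtain M :: nat where M: "2 \<le> M" "\<And>s. s \<in> S \<Longrightarrow> \<rho> (s [^] M) < \<delta>"
    using simultaneous_recurrence[OF S \<delta>(1)] by blast
  define \<Gamma> where "\<Gamma> = product_group S (\<lambda>_. integer_mod_group M)"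
  define p where "p z = finprod G (\<lambda>s. s [^] (z s :: int)) S" for z
  define e where "e x = (\<lambda>s\<in>S. if s = x then 1 else 0 :: int)" for x
  have cI: "carrier (integer_mod_group M) = {0..<int M}"
    using M by (simp add: carrier_integer_mod_group)
  have c\<Gamma>: "carrier \<Gamma> = S \<rightarrow>\<^sub>E {0..<int M}" by (simp add: \<Gamma>_def cI)
  have "group \<Gamma>" by (simp add: \<Gamma>_def)
  then have "comm_group \<Gamma>"
    by (rule group.group_comm_groupI) (auto simp: \<Gamma>_def add.commute)
  moreover have "finite (carrier \<Gamma>)" unfolding c\<Gamma> using S by (intro finite_PiE) auto
  moreover have pc: "p \<in> carrier \<Gamma> \<rightarrow> carrier G" using S
    by (auto simp: p_def subset_iff intro!: finprod_closed)
  moreover have "gdist (p (z \<otimes>\<^bsub>\<Gamma>\<^esub> w)) (p z \<otimes> p w) \<le> \<epsilon>" if z: "z \<in> carrier \<Gamma>" and w: "w \<in> carrier \<Gamma>" for z w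
  proof -
    \<comment> \<open>the carry in coordinate \<open>s\<close>\<close>
    define b where "b s = (if z s + w s < int M then 0 else 1 :: int)" for s
    have carry: "(z s + w s) mod int M + int M * b s = z s + w s" if "s \<in> S" for s
    proof -
      have "0 \<le> z s" "z s < int M" "0 \<le> w s" "w s < int M"
        using z w that unfolding c\<Gamma> by (auto dest!: PiE_mem)
      then show ?thesis
        using mod_pos_pos_trivial[of "z s + w s - int M" "int M"]
        by (auto simp: b_def)
    qed
    let ?B = "finprod G (\<lambda>s. s [^] (int M * b s)) S"
    have "p (z \<otimes>\<^bsub>\<Gamma>\<^esub> w) \<otimes> ?B = finprod G (\<lambda>s. s [^] ((z s + w s) mod int M) \<otimes> s [^] (int M * b s)) S"
      unfolding p_def using S
      by (subst finprod_multf) (auto simp: \<Gamma>_def intro!: arg_cong2[of _ _ _ _ "(\<otimes>)"] finprod_cong')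
    also have "\<dots> = finprod G (\<lambda>s. s [^] z s \<otimes> s [^] w s) S"
    proof (rule finprod_cong')
      show "(\<lambda>s. s [^] z s \<otimes> s [^] w s) \<in> S \<rightarrow> carrier G" using S by auto
      fix s assume s: "s \<in> S"
      then have "s \<in> carrier G" using S by auto
      then show "s [^] ((z s + w s) mod int M) \<otimes> s [^] (int M * b s) = s [^] z s \<otimes> s [^] w s"
        using carry[OF s] by (metis int_pow_mult)
    qed simp
    also have "\<dots> = p z \<otimes> p w"
      unfolding p_def using S by (subst finprod_multf) auto
    finally have eq: "p z \<otimes> p w = ?B \<otimes> p (z \<otimes>\<^bsub>\<Gamma>\<^esub> w)"
      using S pc group.subgroup_self[OF \<open>group \<Gamma>\<close>] z w
      by (subst m_comm) (auto simp: p_def subset_iff intro!: finprod_closed)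
    have zw: "p (z \<otimes>\<^bsub>\<Gamma>\<^esub> w) \<in> carrier G" "?B \<in> carrier G"
      using S by (auto simp: p_def subset_iff intro!: finprod_closed)
    have "gdist (p (z \<otimes>\<^bsub>\<Gamma>\<^esub> w)) (p z \<otimes> p w) = gdist (\<one> \<otimes> p (z \<otimes>\<^bsub>\<Gamma>\<^esub> w)) (?B \<otimes> p (z \<otimes>\<^bsub>\<Gamma>\<^esub> w))"
      using zw by (simp add: eq)
    also have "\<dots> = \<rho> ?B"
      using zw by (subst gdist_cancel) (simp_all add: gdist_def seminorm_inv)
    also have "\<dots> \<le> (\<Sum>s\<in>S. \<rho> (s [^] (int M * b s)))"
      using S by (intro gdist_finprod) auto
    also have "\<dots> \<le> (\<Sum>s\<in>S. \<delta>)"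
    proof (rule sum_mono)
      fix s assume s: "s \<in> S"
      then have "s [^] (int M * b s) = \<one> \<or> s [^] (int M * b s) = s [^] M"
        using S by (auto simp: b_def int_pow_int)
      then show "\<rho> (s [^] (int M * b s)) \<le> \<delta>" using M(2)[OF s] \<delta> seminorm_one by auto
    qed
    also have "\<dots> \<le> \<epsilon>" using \<delta> by simp
    finally show ?thesis .
  qed
  moreover have "e s \<in> carrier \<Gamma> \<and> p (e s) = s" if s: "s \<in> S" for s
  proof
    show "e s \<in> carrier \<Gamma>" using M by (auto simp: c\<Gamma> e_def)
    have "p (e s) = finprod G (\<lambda>i. if s = i then i else \<one>) S"
      unfolding p_def using S by (intro finprod_cong') (auto simp: e_def)
    also have "\<dots> = s" using S s by (intro finprod_singleton) auto
    finally show "p (e s) = s" .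
  qed
  ultimately show thesis by (rule that)
qed

text \<open>
  Each clause is a closed condition on \<open>\<psi>\<close>, and together they become conditions on genuine characters
  in the limit where \<open>S\<close> grows and \<open>\<epsilon>\<close> tends to \<open>0\<close>, provided that \<open>K\<close> and \<open>c\<close> stay fixed.
\<close>

definition almost_characters ::
    "nat \<Rightarrow> real \<Rightarrow> 'a set \<Rightarrow> real \<Rightarrow> (nat \<Rightarrow> 'a \<Rightarrow> complex) \<Rightarrow> bool" where
  "almost_characters K c S \<epsilon> \<psi> \<longleftrightarrow>
     (\<forall>i. \<forall>x\<in>S. norm (\<psi> i x) = 1 \<and> c * norm (\<psi> i x - 1) \<le> \<rho> x + \<epsilon>) \<and>
     (\<forall>i. \<forall>x\<in>S. \<forall>y\<in>S. x \<otimes> y \<in> S \<longrightarrow> c * norm (\<psi> i (x \<otimes> y) - \<psi> i x * \<psi> i y) \<le> \<epsilon>) \<and>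
     (\<forall>x\<in>S. 5 \<le> \<rho> x \<longrightarrow> (\<exists>i<K. Re (\<psi> i x) \<le> 0))"

text \<open>
  Bogolyubov's theorem is applied in a finite model \<open>p\<close> to a bump function of radius \<open>1\<close> around a
  point \<open>a\<close>, composed with \<open>p\<close>. A finite net \<open>F\<close> at distance \<open>1 / 2\<close> provides a centre \<open>a \<in> F\<close> for
  which the mean of the bump is at least \<open>1 / (2 * card F)\<close>; this bound, and hence the number of
  characters and the size of their coefficients, is the same for all models. The bump is Lipschitz
  up to the error of the model, so the characters with large coefficients are Lipschitz, too, up to
  this error. Finally, a quadruple from the support of the bump bounds \<open>\<rho> x\<close> by the sum of two
  diameters, which are less than \<open>2\<close>, and three errors, which are at most \<open>1 / 3\<close>.
\<close>

lemma approximate_characters: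
  obtains K :: nat and c :: real where "0 < c"
    "\<And>S \<epsilon>. finite S \<Longrightarrow> S \<subseteq> carrier G \<Longrightarrow> 0 < \<epsilon> \<Longrightarrow> \<exists>\<psi>. almost_characters K c S \<epsilon> \<psi>"
proof -
  obtain F where F: "finite F" "F \<subseteq> carrier G"
    and cover: "\<And>x. x \<in> carrier G \<Longrightarrow> \<exists>a\<in>F. gdist x a < 1 / 2"
    using totally_bounded[of "1 / 2"] unfolding gdist_def by auto
  have F0: "card F > 0" using cover[OF one_closed] F(1) by (auto simp: card_gt_0_iff)
  define \<alpha> :: real where "\<alpha> = 1 / (2 * card F)"
  define c where "c = \<alpha>\<^sup>2 / 2"
  define K where "K = nat \<lceil>4 / \<alpha> ^ 4\<rceil>"
  have \<alpha>: "0 < \<alpha>" and c: "0 < c" using F0 by (auto simp: \<alpha>_def c_def)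
  have "\<exists>\<psi>. almost_characters K c S \<epsilon> \<psi>"
    if S: "finite S" "S \<subseteq> carrier G" and \<epsilon>: "0 < \<epsilon>" for S \<epsilon>
  proof -
    \<comment> \<open>each of the estimates below uses the quasi-homomorphism \<open>p\<close> at most three times\<close>
    define \<delta> where "\<delta> = min \<epsilon> 1 / 3"
    have \<delta>: "0 < \<delta>" "3 * \<delta> \<le> \<epsilon>" "3 * \<delta> \<le> 1" using \<epsilon> by (auto simp: \<delta>_def)
    obtain \<Gamma> :: "('a \<Rightarrow> int) monoid" and p e where \<Gamma>: "comm_group \<Gamma>" and fin: "finite (carrier \<Gamma>)"
      and p: "p \<in> carrier \<Gamma> \<rightarrow> carrier G"
      and quasi: "\<And>z w. z \<in> carrier \<Gamma> \<Longrightarrow> w \<in> carrier \<Gamma> \<Longrightarrow> gdist (p (z \<otimes>\<^bsub>\<Gamma>\<^esub> w)) (p z \<otimes> p w) \<le> \<delta>"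
      and e: "\<And>s. s \<in> S \<Longrightarrow> e s \<in> carrier \<Gamma> \<and> p (e s) = s"
      by (rule finite_model[OF S \<delta>(1)]) (rule that)
    interpret \<Gamma>: comm_group \<Gamma> by (rule \<Gamma>)
    have pc [simp]: "p z \<in> carrier G" if "z \<in> carrier \<Gamma>" for z using p that by auto
    define g where "g a z = max 0 (1 - gdist (p z) a)" for a z
    have g01: "0 \<le> g a z \<and> g a z \<le> 1" if "a \<in> carrier G" "z \<in> carrier \<Gamma>" for a z
      using seminorm_nonneg[of "p z \<otimes> inv a"] that by (simp add: g_def gdist_def)
    have "\<exists>a\<in>F. \<alpha> * card (carrier \<Gamma>) \<le> (\<Sum>z\<in>carrier \<Gamma>. g a z)"
    proof (rule ccontr)
      assume "\<not> ?thesis"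
      then have "(\<Sum>a\<in>F. \<Sum>z\<in>carrier \<Gamma>. g a z) < (\<Sum>a\<in>F. \<alpha> * card (carrier \<Gamma>))"
        using F F0 by (intro sum_strict_mono) auto
      also have "\<dots> = card (carrier \<Gamma>) / 2" using F0 by (simp add: \<alpha>_def)
      also have "\<dots> = (\<Sum>z\<in>carrier \<Gamma>. 1 / 2)" by simp
      also have "\<dots> \<le> (\<Sum>z\<in>carrier \<Gamma>. \<Sum>a\<in>F. g a z)"
      proof (rule sum_mono)
        fix z assume z: "z \<in> carrier \<Gamma>"
        obtain a where a: "a \<in> F" "gdist (p z) a < 1 / 2" using cover[OF pc[OF z]] by blast
        then have "1 / 2 \<le> g a z" by (simp add: g_def)
        also have "\<dots> \<le> (\<Sum>a\<in>F. g a z)"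
          using a F g01 z by (intro member_le_sum) auto
        finally show "1 / 2 \<le> (\<Sum>a\<in>F. g a z)" .
      qed
      also have "\<dots> = (\<Sum>a\<in>F. \<Sum>z\<in>carrier \<Gamma>. g a z)" by (rule sum.swap)
      finally show False by simp
    qed
    then obtain a where a: "a \<in> carrier G" and mass: "\<alpha> * card (carrier \<Gamma>) \<le> (\<Sum>z\<in>carrier \<Gamma>. g a z)"
      using F by auto
    define \<Lambda> where "\<Lambda> = {\<psi> \<in> circle_characters \<Gamma>. c * card (carrier \<Gamma>) \<le> norm (\<Gamma>.fourier (g a) \<psi>)}"
    have card: "real (card \<Lambda>) \<le> 4 / \<alpha> ^ 4"
      using \<Gamma>.bogolyubov(1)[OF fin g01[OF a] \<alpha> mass] by (simp add: \<Lambda>_def c_def)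
    define A where "A = {z \<in> carrier \<Gamma>. g a z \<noteq> 0}"
    have large: "\<exists>z1\<in>A. \<exists>z2\<in>A. \<exists>z3\<in>A. \<exists>z4\<in>A.
        t \<otimes>\<^bsub>\<Gamma>\<^esub> (z2 \<otimes>\<^bsub>\<Gamma>\<^esub> z4) = z1 \<otimes>\<^bsub>\<Gamma>\<^esub> z3"
      if "t \<in> carrier \<Gamma>" "\<And>\<psi>. \<psi> \<in> \<Lambda> \<Longrightarrow> 0 \<le> Re (\<psi> t)" for t
      using \<Gamma>.bogolyubov(2)[OF fin g01[OF a] \<alpha> mass] that by (simp add: \<Lambda>_def A_def c_def)
    have fin\<Lambda>: "finite \<Lambda>"
      using \<Gamma>.finite_circle_characters[OF fin] by (rule rev_finite_subset) (auto simp: \<Lambda>_def)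
    \<comment> \<open>a large coefficient turns the Lipschitz estimate for the bump into one for the character\<close>
    have near: "c * norm (\<psi> t - 1) \<le> \<rho> (p t) + \<delta>" if \<psi>: "\<psi> \<in> \<Lambda>" and t: "t \<in> carrier \<Gamma>" for \<psi> t
    proof -
      have "\<bar>g a (z \<otimes>\<^bsub>\<Gamma>\<^esub> t) - g a z\<bar> \<le> \<rho> (p t) + \<delta>" if z: "z \<in> carrier \<Gamma>" for z
      proof -
        have "gdist (p (z \<otimes>\<^bsub>\<Gamma>\<^esub> t)) (p z) \<le> gdist (p (z \<otimes>\<^bsub>\<Gamma>\<^esub> t)) (p z \<otimes> p t) + gdist (p z \<otimes> p t) (p z)"
          using z t by (intro gdist_triangle) auto
        also have "gdist (p z \<otimes> p t) (p z) = gdist (p t \<otimes> p z) (\<one> \<otimes> p z)"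
          using z t by (simp add: m_comm)
        also have "\<dots> = \<rho> (p t)" using z t by (subst gdist_cancel) auto
        finally have 1: "gdist (p (z \<otimes>\<^bsub>\<Gamma>\<^esub> t)) (p z) \<le> \<rho> (p t) + \<delta>"
          using quasi[OF z t] by simp
        have 2: "gdist (p (z \<otimes>\<^bsub>\<Gamma>\<^esub> t)) a \<le> gdist (p (z \<otimes>\<^bsub>\<Gamma>\<^esub> t)) (p z) + gdist (p z) a"
          using z t a by (intro gdist_triangle) auto
        have 3: "gdist (p z) a \<le> gdist (p z) (p (z \<otimes>\<^bsub>\<Gamma>\<^esub> t)) + gdist (p (z \<otimes>\<^bsub>\<Gamma>\<^esub> t)) a"
          using z t a by (intro gdist_triangle) auto
        have 4: "gdist (p z) (p (z \<otimes>\<^bsub>\<Gamma>\<^esub> t)) = gdist (p (z \<otimes>\<^bsub>\<Gamma>\<^esub> t)) (p z)"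
          using z t by (intro gdist_commute) auto
        show ?thesis using 1 2 3 4 unfolding g_def by linarith
      qed
      then have "norm (\<psi> t - 1) * norm (\<Gamma>.fourier (g a) \<psi>) \<le> card (carrier \<Gamma>) * (\<rho> (p t) + \<delta>)"
        using \<psi> t by (intro \<Gamma>.fourier_translate) (auto simp: \<Lambda>_def)
      moreover have "norm (\<psi> t - 1) * (c * card (carrier \<Gamma>)) \<le> norm (\<psi> t - 1) * norm (\<Gamma>.fourier (g a) \<psi>)"
        using \<psi> by (intro mult_left_mono) (auto simp: \<Lambda>_def)
      ultimately have "card (carrier \<Gamma>) * (c * norm (\<psi> t - 1)) \<le> card (carrier \<Gamma>) * (\<rho> (p t) + \<delta>)"
        by (simp add: algebra_simps)
      moreover have "0 < card (carrier \<Gamma>)" using fin \<Gamma>.one_closed by (auto simp: card_gt_0_iff)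
      ultimately show ?thesis by simp
    qed
    obtain h where h: "bij_betw h {0..<card \<Lambda>} \<Lambda>" using ex_bij_betw_nat_finite[OF fin\<Lambda>] by blast
    \<comment> \<open>the number of large coefficients varies with the model, so the list is padded with the trivial
       character\<close>
    define \<theta> where "\<theta> i = (if i < card \<Lambda> then h i else \<Gamma>.trivial_character)" for i
    have h\<Lambda>: "h i \<in> \<Lambda>" if "i < card \<Lambda>" for i using bij_betwE[OF h] that by auto
    have \<theta>c: "\<theta> i \<in> circle_characters \<Gamma>" for i
      using h\<Lambda>[of i] \<Gamma>.trivial_circle_character by (auto simp: \<theta>_def \<Lambda>_def)
    have \<theta>near: "c * norm (\<theta> i t - 1) \<le> \<rho> (p t) + \<delta>" if t: "t \<in> carrier \<Gamma>" for i t
      using near[OF h\<Lambda> t, of i] seminorm_nonneg[OF pc[OF t]] \<delta> t by (simp add: \<theta>_def)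
    define \<psi> where "\<psi> i x = \<theta> i (e x)" for i x
    show ?thesis
      unfolding almost_characters_def
    proof (intro exI[of _ \<psi>] conjI allI ballI impI)
      fix i x assume x: "x \<in> S"
      show "norm (\<psi> i x) = 1" using circle_character_norm[OF \<theta>c] e[OF x] by (simp add: \<psi>_def)
      show "c * norm (\<psi> i x - 1) \<le> \<rho> x + \<epsilon>" using \<theta>near[of "e x" i] e[OF x] \<delta> by (simp add: \<psi>_def)
    next
      fix i x y assume x: "x \<in> S" and y: "y \<in> S" and xy: "x \<otimes> y \<in> S"
      note ex = e[OF x] and ey = e[OF y] and exy = e[OF xy]
      define u where "u = e x \<otimes>\<^bsub>\<Gamma>\<^esub> e y"
      define t where "t = e (x \<otimes> y) \<otimes>\<^bsub>\<Gamma>\<^esub> inv\<^bsub>\<Gamma>\<^esub> u"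
      have u: "u \<in> carrier \<Gamma>" and t: "t \<in> carrier \<Gamma>" using ex ey exy by (auto simp: u_def t_def)
      have tu: "t \<otimes>\<^bsub>\<Gamma>\<^esub> u = e (x \<otimes> y)" using exy u by (simp add: t_def \<Gamma>.m_assoc)
      have xyc: "x \<otimes> y \<in> carrier G" "x \<in> carrier G" "y \<in> carrier G" using S x y xy by auto
      have q1: "gdist (x \<otimes> y) (p t \<otimes> p u) \<le> \<delta>" using quasi[OF t u] exy by (simp add: tu)
      have q2: "gdist (p u) (x \<otimes> y) \<le> \<delta>" using quasi[of "e x" "e y"] ex ey by (simp add: u_def)
      have "\<rho> (p t) = gdist (p t \<otimes> p u) (\<one> \<otimes> p u)" using t u by (subst gdist_cancel) auto
      also have "\<dots> \<le> gdist (p t \<otimes> p u) (x \<otimes> y) + gdist (x \<otimes> y) (p u)"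
        using gdist_triangle[of "p t \<otimes> p u" "x \<otimes> y" "p u"] t u xyc by simp
      also have "\<dots> \<le> 2 * \<delta>"
        using q1 q2 gdist_commute[of "p t \<otimes> p u" "x \<otimes> y"] gdist_commute[of "x \<otimes> y" "p u"] t u xyc by simp
      finally have "c * norm (\<theta> i t - 1) \<le> \<epsilon>" using \<theta>near[OF t, of i] \<delta> by simp
      moreover have "\<theta> i (e (x \<otimes> y)) - \<theta> i (e x) * \<theta> i (e y) = (\<theta> i t - 1) * \<theta> i u"
      proof -
        have "\<theta> i (e (x \<otimes> y)) = \<theta> i t * \<theta> i u" using circle_character_mult[OF \<theta>c t u] by (simp only: tu)
        moreover have "\<theta> i u = \<theta> i (e x) * \<theta> i (e y)"
          unfolding u_def using ex ey by (intro circle_character_mult[OF \<theta>c]) auto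
        ultimately show ?thesis by (simp add: algebra_simps)
      qed
      moreover have "norm (\<theta> i u) = 1" using circle_character_norm[OF \<theta>c u] .
      ultimately show "c * norm (\<psi> i (x \<otimes> y) - \<psi> i x * \<psi> i y) \<le> \<epsilon>"
        by (simp add: \<psi>_def norm_mult)
    next
      fix x assume x: "x \<in> S" and far: "5 \<le> \<rho> x"
      note ex = e[OF x]
      have xc: "x \<in> carrier G" using S x by auto
      show "\<exists>i<K. Re (\<psi> i x) \<le> 0"
      proof (rule ccontr)
        assume neg: "\<not> ?thesis"
        have "0 \<le> Re (\<phi> (e x))" if \<phi>: "\<phi> \<in> \<Lambda>" for \<phi>
        proof -
          obtain i where i: "i < card \<Lambda>" "h i = \<phi>"
            using bij_betw_imp_surj_on[OF h] \<phi> by force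
          have "real (card \<Lambda>) \<le> K" using card unfolding K_def by linarith
          then have "i < K" using i by linarith
          then show ?thesis using neg i by (auto simp: \<psi>_def \<theta>_def not_le intro: less_imp_le)
        qed
        with large[of "e x"] ex obtain z1 z2 z3 z4 where
          A: "z1 \<in> A" "z2 \<in> A" "z3 \<in> A" "z4 \<in> A" and
          eq: "e x \<otimes>\<^bsub>\<Gamma>\<^esub> (z2 \<otimes>\<^bsub>\<Gamma>\<^esub> z4) = z1 \<otimes>\<^bsub>\<Gamma>\<^esub> z3" by metis
        have z: "z1 \<in> carrier \<Gamma>" "z2 \<in> carrier \<Gamma>" "z3 \<in> carrier \<Gamma>" "z4 \<in> carrier \<Gamma>"
          using A by (auto simp: A_def)
        have close: "z \<in> carrier \<Gamma> \<and> gdist (p z) a < 1" if "z \<in> A" for z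
          using that by (auto simp: A_def g_def max_def split: if_splits)
        have close2: "gdist (p z) (p w) < 2" if "z \<in> A" "w \<in> A" for z w
          using close[OF that(1)] close[OF that(2)] gdist_triangle[of "p z" a "p w"]
            gdist_commute[of a "p w"] a by simp
        define P where "P = p z2 \<otimes> p z4"
        define Q where "Q = p (z2 \<otimes>\<^bsub>\<Gamma>\<^esub> z4)"
        define R where "R = p (z1 \<otimes>\<^bsub>\<Gamma>\<^esub> z3)"
        define T where "T = p z1 \<otimes> p z3"
        have c: "P \<in> carrier G" "Q \<in> carrier G" "R \<in> carrier G" "T \<in> carrier G"
          using z by (auto simp: P_def Q_def R_def T_def)
        have 1: "gdist R (x \<otimes> Q) \<le> \<delta>"
          using quasi[of "e x" "z2 \<otimes>\<^bsub>\<Gamma>\<^esub> z4"] ex z by (simp add: R_def Q_def eq)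
        have 2: "gdist R T \<le> \<delta>" using quasi[of z1 z3] z by (simp add: R_def T_def)
        have 3: "gdist Q P \<le> \<delta>" using quasi[of z2 z4] z by (simp add: Q_def P_def)
        have 4: "gdist T P < 4"
          using gdist_mult[of "p z1" "p z2" "p z3" "p z4"] close2[of z1 z2] close2[of z3 z4] z A
          by (simp add: T_def P_def)
        have "\<rho> x = gdist (x \<otimes> Q) (\<one> \<otimes> Q)" using xc c by (subst gdist_cancel) auto
        also have "\<dots> \<le> gdist (x \<otimes> Q) R + gdist R Q"
          using gdist_triangle[of "x \<otimes> Q" R Q] xc c by simp
        also have "gdist R Q \<le> gdist R T + gdist T Q" using gdist_triangle c by simp
        also have "gdist T Q \<le> gdist T P + gdist P Q" using gdist_triangle c by simp
        finally have "\<rho> x < 4 + 3 * \<delta>"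
          using 1 2 3 4 gdist_commute[of "x \<otimes> Q" R] gdist_commute[of P Q] xc c by simp
        then show False using far \<delta> by simp
      qed
    qed
  qed
  with c show thesis by (rule that)
qed

text \<open>
  By Tychonoff's theorem the families of functions with values in the circle form a compact space,
  and almost characters for all finite sets and all errors have a common limit there.
\<close>

theorem characters_of_seminorm:
  obtains \<Psi> C where "finite \<Psi>" "\<Psi> \<subseteq> circle_characters G"
    "\<And>\<psi> x. \<psi> \<in> \<Psi> \<Longrightarrow> x \<in> carrier G \<Longrightarrow> norm (\<psi> x - 1) \<le> C * \<rho> x"
    "{x \<in> carrier G. \<forall>\<psi>\<in>\<Psi>. 0 < Re (\<psi> x)} \<subseteq> {x. \<rho> x < 5}"
proof -
  obtain K :: nat and c :: real where c: "0 < c" and approx: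
    "\<And>S \<epsilon>. finite S \<Longrightarrow> S \<subseteq> carrier G \<Longrightarrow> 0 < \<epsilon> \<Longrightarrow> \<exists>\<psi>. almost_characters K c S \<epsilon> \<psi>"
    by (rule approximate_characters) (rule that)
  define U :: "(nat \<times> 'a \<Rightarrow> complex) set" where "U = UNIV \<rightarrow>\<^sub>E sphere 0 1"
  have "compactin (product_topology (\<lambda>_. euclidean) UNIV) U"
    unfolding U_def by (simp add: compactin_PiE)
  then have U: "compact U" by (simp add: euclidean_product_topology)
  define near where "near x n = (\<Inter>i. {\<psi> :: nat \<times> 'a \<Rightarrow> complex.
      c * norm (\<psi> (i, x) - 1) \<le> \<rho> x + inverse (real (Suc n))})" for x n
  define mult where "mult x y n = (\<Inter>i. {\<psi> :: nat \<times> 'a \<Rightarrow> complex.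
      c * norm (\<psi> (i, x \<otimes> y) - \<psi> (i, x) * \<psi> (i, y)) \<le> inverse (real (Suc n))})" for x y n
  define far where "far x = (if 5 \<le> \<rho> x then \<Union>i<K. {\<psi> :: nat \<times> 'a \<Rightarrow> complex. Re (\<psi> (i, x)) \<le> 0} else UNIV)" for x
  \<comment> \<open>the constraints for one triple of indices; a common point of all of them is a family of characters\<close>
  define con where "con = (\<lambda>(x, y, n). near x n \<inter> mult x y n \<inter> far x)"
  define I where "I = carrier G \<times> carrier G \<times> (UNIV :: nat set)"
  have coord: "continuous_on UNIV (\<lambda>\<psi> :: nat \<times> 'a \<Rightarrow> complex. \<psi> j)" for j
    by (rule continuous_on_product_coordinates)
  have "closed (near x n)" "closed (mult x y n)" for x y n
    unfolding near_def mult_def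
    by (intro closed_INT ballI closed_Collect_le continuous_intros coord)+
  moreover have "closed (far x)" for x
    unfolding far_def by (auto intro!: closed_UN closed_Collect_le continuous_intros coord)
  ultimately have closed: "closed (con j)" for j by (auto simp: con_def split: prod.split intro!: closed_Int)
  have fip: "U \<inter> \<Inter>B \<noteq> {}" if B: "finite B" "B \<subseteq> con ` I" for B
  proof -
    obtain J where J: "J \<subseteq> I" "finite J" "B = con ` J"
      using finite_subset_image[OF B] by blast
    define S where "S = (\<Union>(x, y, n)\<in>J. {x, y, x \<otimes> y})"
    obtain N where N: "\<And>j. j \<in> J \<Longrightarrow> snd (snd j) \<le> N"
      using finite_imageI[OF J(2), of "\<lambda>j. snd (snd j)"] unfolding finite_nat_set_iff_bounded_le by auto
    have S: "finite S" "S \<subseteq> carrier G" using J by (auto simp: S_def I_def)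
    define \<epsilon> where "\<epsilon> = inverse (real (Suc N))"
    have "0 < \<epsilon>" by (simp add: \<epsilon>_def)
    from approx[OF S this] obtain \<psi> :: "nat \<Rightarrow> 'a \<Rightarrow> complex" where
      \<psi>1: "\<forall>i. \<forall>x\<in>S. norm (\<psi> i x) = 1 \<and> c * norm (\<psi> i x - 1) \<le> \<rho> x + \<epsilon>" and
      \<psi>2: "\<forall>i. \<forall>x\<in>S. \<forall>y\<in>S. x \<otimes> y \<in> S \<longrightarrow>
         c * norm (\<psi> i (x \<otimes> y) - \<psi> i x * \<psi> i y) \<le> \<epsilon>" and
      \<psi>3: "\<forall>x\<in>S. 5 \<le> \<rho> x \<longrightarrow> (\<exists>i<K. Re (\<psi> i x) \<le> 0)"
      unfolding almost_characters_def by (elim exE conjE) (rule that)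
    define \<psi>' where "\<psi>' = (\<lambda>(i, x). if x \<in> S then \<psi> i x else 1)"
    have "\<psi>' \<in> U" using \<psi>1 by (auto simp: U_def \<psi>'_def)
    moreover have "\<psi>' \<in> con j" if j: "j \<in> J" for j
    proof -
      obtain x y n where [simp]: "j = (x, y, n)" by (cases j)
      have xy: "x \<in> S" "y \<in> S" "x \<otimes> y \<in> S" using j by (force simp: S_def)+
      have "n \<le> N" using N[OF j] by simp
      then have le: "\<epsilon> \<le> inverse (real (Suc n))" unfolding \<epsilon>_def by (intro le_imp_inverse_le) auto
      have "\<psi>' \<in> near x n" 
      proof -
        have "c * norm (\<psi> i x - 1) \<le> \<rho> x + inverse (real (Suc n))" for i
          using \<psi>1 xy(1) le by (meson add_left_mono order_trans)
        then show ?thesis using xy by (simp add: near_def \<psi>'_def)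
      qed
      moreover have "\<psi>' \<in> mult x y n" 
      proof -
        have "c * norm (\<psi> i (x \<otimes> y) - \<psi> i x * \<psi> i y) \<le> inverse (real (Suc n))" for i
          using \<psi>2 xy le by (meson order_trans)
        then show ?thesis using xy by (simp add: mult_def \<psi>'_def)
      qed
      moreover have "\<psi>' \<in> far x" using \<psi>3 xy by (auto simp: far_def \<psi>'_def)
      ultimately show ?thesis by (simp add: con_def)
    qed
    ultimately show ?thesis using J(3) by blast
  qed
  have "U \<inter> \<Inter>(con ` I) \<noteq> {}"
    using U closed fip unfolding compact_fip by blast
  then obtain \<psi> where \<psi>U: "\<psi> \<in> U" and \<psi>con: "\<And>j. j \<in> I \<Longrightarrow> \<psi> \<in> con j" by blast
  have lim: "a \<le> b" if "\<And>n. a \<le> b + inverse (real (Suc n))" for a b :: real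
  proof (rule field_le_epsilon)
    fix \<epsilon> :: real assume "0 < \<epsilon>"
    then obtain n where "inverse (real (Suc n)) < \<epsilon>" using reals_Archimedean by blast
    then show "a \<le> b + \<epsilon>" using that[of n] by linarith
  qed
  have norm: "norm (\<psi> (i, x)) = 1" for i x using \<psi>U by (auto simp: U_def)
  have near: "c * norm (\<psi> (i, x) - 1) \<le> \<rho> x" if "x \<in> carrier G" for i x
  proof (rule lim)
    fix n
    have "\<psi> \<in> near x n" using \<psi>con[of "(x, x, n)"] that by (simp add: I_def con_def)
    then show "c * norm (\<psi> (i, x) - 1) \<le> \<rho> x + inverse (real (Suc n))"
      unfolding near_def by blast
  qed
  have mult: "\<psi> (i, x \<otimes> y) = \<psi> (i, x) * \<psi> (i, y)" if "x \<in> carrier G" "y \<in> carrier G" for i x y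
  proof -
    have "c * norm (\<psi> (i, x \<otimes> y) - \<psi> (i, x) * \<psi> (i, y)) \<le> 0"
    proof (rule lim)
      fix n
      have "\<psi> \<in> mult x y n" using \<psi>con[of "(x, y, n)"] that by (simp add: I_def con_def)
      then show "c * norm (\<psi> (i, x \<otimes> y) - \<psi> (i, x) * \<psi> (i, y)) \<le> 0 + inverse (real (Suc n))"
        unfolding mult_def by (simp only: add_0_left) blast
    qed
    then show ?thesis using c by (simp add: mult_le_0_iff)
  qed
  have far: "\<exists>i<K. Re (\<psi> (i, x)) \<le> 0" if "x \<in> carrier G" "5 \<le> \<rho> x" for x
    using \<psi>con[of "(x, x, 0)"] that by (auto simp: I_def con_def far_def)
  define \<Psi> where "\<Psi> = (\<lambda>i. \<lambda>x\<in>carrier G. \<psi> (i, x)) ` {..<K}"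
  show thesis
  proof (rule that[of \<Psi> "1 / c"])
    show "finite \<Psi>" by (simp add: \<Psi>_def)
    show "\<Psi> \<subseteq> circle_characters G" using norm mult by (auto simp: \<Psi>_def circle_characters_def)
    show "norm (\<phi> x - 1) \<le> 1 / c * \<rho> x" if "\<phi> \<in> \<Psi>" "x \<in> carrier G" for \<phi> x
      using near[OF that(2)] that c by (auto simp: \<Psi>_def field_simps)
    show "{x \<in> carrier G. \<forall>\<phi>\<in>\<Psi>. 0 < Re (\<phi> x)} \<subseteq> {x. \<rho> x < 5}"
    proof clarify
      fix x assume x: "x \<in> carrier G" and pos: "\<forall>\<phi>\<in>\<Psi>. 0 < Re (\<phi> x)"
      show "\<rho> x < 5"
      proof (rule ccontr)
        assume "\<not> \<rho> x < 5"
        then obtain i where i: "i < K" "Re (\<psi> (i, x)) \<le> 0" using far[OF x] by auto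
        then have "(\<lambda>x\<in>carrier G. \<psi> (i, x)) \<in> \<Psi>" unfolding \<Psi>_def by blast
        then have "0 < Re ((\<lambda>x\<in>carrier G. \<psi> (i, x)) x)" using pos by blast
        then show False using i x by simp
      qed
    qed
  qed
qed

end

section \<open>Seminorms from sequences of neighbourhoods\<close>

text \<open>
  The construction of Birkhoff and Kakutani: a letter \<open>(n, x)\<close> stands for an element \<open>x\<close> of the \<open>n\<close>-th
  neighbourhood and costs \<open>(1 / 2) ^ n\<close>. The seminorm of an element is the infimum of the costs of
  all words with this product.
\<close>

definition word_product :: "('a, 'm) monoid_scheme \<Rightarrow> (nat \<times> 'a) list \<Rightarrow> 'a" where
  "word_product G ws = foldr (\<lambda>w y. snd w \<otimes>\<^bsub>G\<^esub> y) ws \<one>\<^bsub>G\<^esub>"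

definition word_weight :: "(nat \<times> 'a) list \<Rightarrow> real" where
  "word_weight ws = (\<Sum>w\<leftarrow>ws. (1 / 2) ^ fst w)"

lemma word_weight_simps [simp]:
  "word_weight [] = 0" "word_weight (w # ws) = (1 / 2) ^ fst w + word_weight ws"
  "word_weight (ws @ vs) = word_weight ws + word_weight vs"
  by (simp_all add: word_weight_def)

lemma word_weight_nonneg: "0 \<le> word_weight ws"
  by (induction ws) auto

lemma word_product_simps [simp]:
  "word_product G [] = \<one>\<^bsub>G\<^esub>" "word_product G (w # ws) = snd w \<otimes>\<^bsub>G\<^esub> word_product G ws"
  by (simp_all add: word_product_def)

context comm_group
begin

lemma word_product_closed: "snd ` set ws \<subseteq> carrier G \<Longrightarrow> word_product G ws \<in> carrier G"
  by (induction ws) auto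

lemma word_product_append:
  "snd ` set ws \<subseteq> carrier G \<Longrightarrow> snd ` set vs \<subseteq> carrier G \<Longrightarrow>
     word_product G (ws @ vs) = word_product G ws \<otimes> word_product G vs"
  by (induction ws) (auto simp: word_product_closed m_assoc)

lemma word_product_inv:
  "snd ` set ws \<subseteq> carrier G \<Longrightarrow>
     word_product G (map (\<lambda>w. (fst w, inv (snd w))) ws) = inv (word_product G ws)"
  by (induction ws) (auto simp: word_product_closed inv_mult)

lemma word_weight_inv: "word_weight (map (\<lambda>w. (fst w, inv (snd w))) ws) = word_weight ws"
  by (induction ws) auto

end

locale neighbourhood_sequence = comm_group G for G (structure) +
  fixes U :: "nat \<Rightarrow> 'a set"
  assumes sequence_carrier: "U n \<subseteq> carrier G"
    and sequence_one: "\<one> \<in> U n"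
    and sequence_inv: "x \<in> U n \<Longrightarrow> inv x \<in> U n"
    and sequence_triple: "x \<in> U (Suc n) \<Longrightarrow> y \<in> U (Suc n) \<Longrightarrow> z \<in> U (Suc n) \<Longrightarrow> x \<otimes> y \<otimes> z \<in> U n"
begin

lemma sequence_decreasing: "m \<le> n \<Longrightarrow> U n \<subseteq> U m"
proof (induction n rule: dec_induct)
  case (step n)
  have "x \<in> U n" if "x \<in> U (Suc n)" for x
  proof -
    have "x \<in> carrier G" using that sequence_carrier by blast
    then show ?thesis using sequence_triple[OF that sequence_one sequence_one] by simp
  qed
  then show ?case using step by auto
qed simp

text \<open>
  The word is cut at the letter at which the weight of the prefixes passes half of the total. The
  parts on both sides are shorter and weigh less than \<open>(1 / 2) ^ Suc n\<close>, so the induction hypothesis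
  puts them into \<open>U (Suc n)\<close>; the letter weighs less than \<open>(1 / 2) ^ n\<close>, so it lies in \<open>U (Suc n)\<close>
  as well. This is why the sequence is required to absorb products of three elements.
\<close>

lemma light_word_product:
  assumes "\<And>w. w \<in> set ws \<Longrightarrow> snd w \<in> U (fst w)" "word_weight ws < (1 / 2) ^ n"
  shows "word_product G ws \<in> U n"
  using assms
proof (induction "length ws" arbitrary: ws n rule: less_induct)
  case less
  show ?case
  proof (cases "ws = []")
    case True
    then show ?thesis by (simp add: sequence_one)
  next
    case False
    \<comment> \<open>the longest prefix that carries at most half of the weight\<close>
    define k where "k = (GREATEST k. k \<le> length ws \<and> word_weight (take k ws) \<le> word_weight ws / 2)"
    have k: "k \<le> length ws \<and> word_weight (take k ws) \<le> word_weight ws / 2"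
      unfolding k_def
      by (rule GreatestI_nat[of _ 0 "length ws"]) (auto simp: word_weight_nonneg)
    have kmax: "j \<le> k" if "j \<le> length ws" "word_weight (take j ws) \<le> word_weight ws / 2" for j
      unfolding k_def by (rule Greatest_le_nat[of _ _ "length ws"]) (use that in auto)
    have pos: "0 < word_weight ws"
      using False by (cases ws) (simp_all add: add_pos_nonneg word_weight_nonneg)
    have kl: "k < length ws"
    proof (rule ccontr)
      assume "\<not> k < length ws"
      then show False using k pos by simp
    qed
    let ?u = "take k ws" and ?w = "ws ! k" and ?v = "drop (Suc k) ws"
    have split: "ws = ?u @ ?w # ?v" using kl by (rule id_take_nth_drop)
    have wt: "word_weight ws = word_weight ?u + (1 / 2) ^ fst ?w + word_weight ?v"
      by (subst split) simp
    have "\<not> word_weight (take (Suc k) ws) \<le> word_weight ws / 2"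
      using kmax[of "Suc k"] kl by auto
    then have "word_weight ?u + (1 / 2) ^ fst ?w > word_weight ws / 2"
      using kl by (simp add: take_Suc_conv_app_nth)
    then have v: "word_weight ?v < (1 / 2) ^ Suc n" using wt less.prems(2) by simp
    have u: "word_weight ?u < (1 / 2) ^ Suc n" using k less.prems(2) by simp
    have mem: "snd w \<in> U (fst w)" if "w \<in> set ?u \<union> set ?v \<union> {?w}" for w
      using that less.prems(1) kl by (auto dest: in_set_takeD in_set_dropD)
    have "word_product G ?u \<in> U (Suc n)" using kl u mem by (intro less.hyps) auto
    moreover have "word_product G ?v \<in> U (Suc n)" using kl v mem by (intro less.hyps) auto
    moreover have "snd ?w \<in> U (Suc n)"
    proof -
      have "(1 / 2 :: real) ^ fst ?w < (1 / 2) ^ n"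
        using wt less.prems(2) word_weight_nonneg[of ?u] word_weight_nonneg[of ?v] by linarith
      then have "Suc n \<le> fst ?w"
        by (metis not_less_eq_eq power_decreasing not_less divide_le_eq_1_pos one_le_numeral
            zero_le_divide_1_iff zero_le_numeral zero_less_numeral less_Suc_eq_le)
      then show ?thesis using sequence_decreasing mem[of ?w] by blast
    qed
    ultimately have "word_product G ?u \<otimes> snd ?w \<otimes> word_product G ?v \<in> U n"
      by (intro sequence_triple)
    moreover have c: "snd ` set ?u \<subseteq> carrier G" "snd ` set ?v \<subseteq> carrier G" "snd ?w \<in> carrier G"
      using mem sequence_carrier by blast+
    have "word_product G ws = word_product G ?u \<otimes> (snd ?w \<otimes> word_product G ?v)"
      using c by (subst split, subst word_product_append) auto
    ultimately show ?thesis using c by (simp add: m_assoc word_product_closed)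
  qed
qed

theorem seminorm_of_sequence:
  assumes U0: "U 0 = carrier G"
  obtains \<rho> :: "'a \<Rightarrow> real" where
    "\<rho> \<one> = 0" "\<And>x. x \<in> carrier G \<Longrightarrow> \<rho> (inv x) = \<rho> x"
    "\<And>x y. x \<in> carrier G \<Longrightarrow> y \<in> carrier G \<Longrightarrow> \<rho> (x \<otimes> y) \<le> \<rho> x + \<rho> y"
    "\<And>n x. x \<in> U n \<Longrightarrow> \<rho> x \<le> (1 / 2) ^ n"
    "\<And>n x. x \<in> carrier G \<Longrightarrow> \<rho> x < (1 / 2) ^ n \<Longrightarrow> x \<in> U n"
proof -
  define W where "W x = {ws. (\<forall>w\<in>set ws. snd w \<in> U (fst w)) \<and> word_product G ws = x}" for x
  define \<rho> where "\<rho> x = Inf (word_weight ` W x)" for x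
  have bdd: "bdd_below (word_weight ` W x)" for x
    using word_weight_nonneg by (intro bdd_belowI[of _ 0]) auto
  have ne: "W x \<noteq> {}" if "x \<in> carrier G" for x
  proof -
    have "[(0, x)] \<in> W x" using that by (simp add: W_def U0)
    then show ?thesis by blast
  qed
  have Wc: "snd ` set ws \<subseteq> carrier G" if "ws \<in> W x" for ws x
    using that sequence_carrier by (auto simp: W_def)
  have le: "\<rho> x \<le> word_weight ws" if "ws \<in> W x" for x ws
    unfolding \<rho>_def by (rule cInf_lower[OF imageI[OF that] bdd])
  have approx: "\<exists>ws\<in>W x. word_weight ws < r" if "x \<in> carrier G" "\<rho> x < r" for x r
    using cInf_lessD[of "word_weight ` W x" r] ne[OF that(1)] that(2) by (auto simp: \<rho>_def)
  have inv_le: "\<rho> (inv x) \<le> \<rho> x" if x: "x \<in> carrier G" for x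
  proof (rule field_le_epsilon)
    fix \<epsilon> :: real assume "0 < \<epsilon>"
    then obtain ws where ws: "ws \<in> W x" "word_weight ws < \<rho> x + \<epsilon>"
      using approx[OF x, of "\<rho> x + \<epsilon>"] by auto
    have "map (\<lambda>w. (fst w, inv (snd w))) ws \<in> W (inv x)"
      using ws(1) Wc[OF ws(1)] by (auto simp: W_def word_product_inv sequence_inv)
    from le[OF this] show "\<rho> (inv x) \<le> \<rho> x + \<epsilon>" using ws by (simp add: word_weight_inv)
  qed
  show thesis
  proof (rule that[of \<rho>])
    have "[] \<in> W \<one>" by (simp add: W_def)
    from le[OF this] have "\<rho> \<one> \<le> 0" by simp
    moreover have "0 \<le> \<rho> \<one>" unfolding \<rho>_def
      using ne[OF one_closed] word_weight_nonneg by (intro cInf_greatest) auto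
    ultimately show "\<rho> \<one> = 0" by simp
    show "\<rho> (inv x) = \<rho> x" if "x \<in> carrier G" for x
      using inv_le[OF that] inv_le[of "inv x"] that by simp
    show "\<rho> (x \<otimes> y) \<le> \<rho> x + \<rho> y" if x: "x \<in> carrier G" and y: "y \<in> carrier G" for x y
    proof (rule field_le_epsilon)
      fix \<epsilon> :: real assume \<epsilon>: "0 < \<epsilon>"
      then obtain ws where ws: "ws \<in> W x" "word_weight ws < \<rho> x + \<epsilon> / 2"
        using approx[OF x, of "\<rho> x + \<epsilon> / 2"] by auto
      obtain vs where vs: "vs \<in> W y" "word_weight vs < \<rho> y + \<epsilon> / 2"
        using approx[OF y, of "\<rho> y + \<epsilon> / 2"] \<epsilon> by auto
      have "ws @ vs \<in> W (x \<otimes> y)"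
        using ws(1) vs(1) word_product_append[OF Wc[OF ws(1)] Wc[OF vs(1)]] by (auto simp: W_def)
      from le[OF this] show "\<rho> (x \<otimes> y) \<le> \<rho> x + \<rho> y + \<epsilon>" using ws vs by simp
    qed
    show "\<rho> x \<le> (1 / 2) ^ n" if "x \<in> U n" for n x
    proof -
      have "x \<in> carrier G" using that sequence_carrier by blast
      then have "[(n, x)] \<in> W x" using that by (simp add: W_def)
      from le[OF this] show ?thesis by simp
    qed
    show "x \<in> U n" if x: "x \<in> carrier G" "\<rho> x < (1 / 2) ^ n" for n x
    proof -
      obtain ws where "ws \<in> W x" "word_weight ws < (1 / 2) ^ n" using approx[OF x] by blast
      then show ?thesis using light_word_product[of ws n] by (auto simp: W_def)
    qed
  qed
qed

end

definition bohr_set :: "('a, 'm) monoid_scheme \<Rightarrow> ('a \<Rightarrow> complex) set \<Rightarrow> real \<Rightarrow> 'a set" where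
  "bohr_set G F \<epsilon> = {x \<in> carrier G. \<forall>\<psi>\<in>F. norm (\<psi> x - 1) < \<epsilon>}"

text \<open>
  The statement is about a sequence of sets, not about a topology, because it is needed twice: for
  neighbourhoods of the unit, and for their products with a subgroup, where it yields characters of
  the quotient group.
\<close>

theorem (in comm_group) characters_of_neighbourhood_sequence:
  assumes U: "neighbourhood_sequence G U"
    and syndetic: "\<And>n. \<exists>F. finite F \<and> F \<subseteq> carrier G \<and> F <#> U n = carrier G"
  obtains \<Psi> where "finite \<Psi>" "\<Psi> \<subseteq> circle_characters G"
    "\<And>\<psi> \<epsilon>. \<psi> \<in> \<Psi> \<Longrightarrow> 0 < \<epsilon> \<Longrightarrow> \<exists>n. \<forall>x\<in>U n. norm (\<psi> x - 1) < \<epsilon>"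
    "bohr_set G \<Psi> 1 \<subseteq> U 0"
proof -
  interpret U: neighbourhood_sequence G U by (rule U)
  \<comment> \<open>the whole group is put in front, so that every element is the product of a word\<close>
  define V where "V n = (if n = 0 then carrier G else U (n - 1))" for n
  interpret V: neighbourhood_sequence G V
  proof
    fix n x y z
    show "V n \<subseteq> carrier G" "\<one> \<in> V n" using U.sequence_carrier U.sequence_one by (auto simp: V_def)
    show "inv x \<in> V n" if "x \<in> V n" using that U.sequence_inv by (auto simp: V_def split: if_splits)
    show "x \<otimes> y \<otimes> z \<in> V n" if "x \<in> V (Suc n)" "y \<in> V (Suc n)" "z \<in> V (Suc n)"
      using that U.sequence_triple[of x "n - 1" y z] U.sequence_carrier[of 0]
      by (cases n) (auto simp: V_def subset_iff)
  qed
  have "V 0 = carrier G" by (simp add: V_def)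
  then obtain \<rho> :: "'a \<Rightarrow> real" where \<rho>:
    "\<rho> \<one> = 0" "\<And>x. x \<in> carrier G \<Longrightarrow> \<rho> (inv x) = \<rho> x"
    "\<And>x y. x \<in> carrier G \<Longrightarrow> y \<in> carrier G \<Longrightarrow> \<rho> (x \<otimes> y) \<le> \<rho> x + \<rho> y"
    and small: "\<And>n x. x \<in> V n \<Longrightarrow> \<rho> x \<le> (1 / 2) ^ n"
    and ball: "\<And>n x. x \<in> carrier G \<Longrightarrow> \<rho> x < (1 / 2) ^ n \<Longrightarrow> x \<in> V n"
    by (rule V.seminorm_of_sequence) (rule that)
  have small': "\<rho> x \<le> (1 / 2) ^ n" if "x \<in> U n" for n x
  proof -
    have "x \<in> V (Suc n)" using that by (simp add: V_def)
    from small[OF this] show ?thesis by (rule order_trans) simp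
  qed
  \<comment> \<open>the factor 10 turns the ball of radius \<open>5\<close> into the ball of radius \<open>1 / 2\<close> for \<open>\<rho>\<close>, which is
     contained in \<open>V 1 = U 0\<close>\<close>
  interpret S: totally_bounded_seminorm G "\<lambda>x. 10 * \<rho> x"
  proof
    show "10 * \<rho> \<one> = 0" "\<And>x. x \<in> carrier G \<Longrightarrow> 10 * \<rho> (inv x) = 10 * \<rho> x"
      by (simp_all add: \<rho>)
    show "10 * \<rho> (x \<otimes> y) \<le> 10 * \<rho> x + 10 * \<rho> y" if "x \<in> carrier G" "y \<in> carrier G" for x y
      using \<rho>(3)[OF that] by simp
    fix \<epsilon> :: real assume "0 < \<epsilon>"
    then obtain n where n: "(1 / 2 :: real) ^ n < \<epsilon> / 10"
      using real_arch_pow_inv[of "\<epsilon> / 10" "1 / 2"] by auto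
    obtain F where F: "finite F" "F \<subseteq> carrier G" "F <#> U n = carrier G" using syndetic by blast
    have "\<exists>a\<in>F. 10 * \<rho> (x \<otimes> inv a) < \<epsilon>" if x: "x \<in> carrier G" for x
    proof -
      obtain a u where au: "a \<in> F" "u \<in> U n" "x = a \<otimes> u"
        using x F(3) unfolding set_mult_def by blast
      have "a \<in> carrier G" "u \<in> carrier G" using au F U.sequence_carrier by auto
      then have "x \<otimes> inv a = u" using au(3) by (simp add: m_comm[of a u] m_assoc)
      moreover have "10 * \<rho> u < \<epsilon>" using small'[OF au(2)] n by simp
      ultimately show ?thesis using au(1) by metis
    qed
    then show "\<exists>F. finite F \<and> F \<subseteq> carrier G \<and> (\<forall>x\<in>carrier G. \<exists>a\<in>F. 10 * \<rho> (x \<otimes> inv a) < \<epsilon>)"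
      using F by blast
  qed
  obtain \<Psi> C where \<Psi>: "finite \<Psi>" "\<Psi> \<subseteq> circle_characters G"
    and lip: "\<And>\<psi> x. \<psi> \<in> \<Psi> \<Longrightarrow> x \<in> carrier G \<Longrightarrow> norm (\<psi> x - 1) \<le> C * (10 * \<rho> x)"
    and inside: "{x \<in> carrier G. \<forall>\<psi>\<in>\<Psi>. 0 < Re (\<psi> x)} \<subseteq> {x. 10 * \<rho> x < 5}"
    by (rule S.characters_of_seminorm) (rule that)
  show thesis
  proof (rule that[OF \<Psi>])
    show "bohr_set G \<Psi> 1 \<subseteq> U 0"
    proof
      fix x assume "x \<in> bohr_set G \<Psi> 1"
      then have x: "x \<in> carrier G" "\<forall>\<psi>\<in>\<Psi>. norm (\<psi> x - 1) < 1" by (simp_all add: bohr_set_def)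
      have "0 < Re (\<psi> x)" if "\<psi> \<in> \<Psi>" for \<psi>
        using abs_Re_le_cmod[of "\<psi> x - 1"] bspec[OF x(2) that] by simp
      with x(1) have "10 * \<rho> x < 5" using inside by blast
      then show "x \<in> U 0" using ball[OF x(1), of 1] by (simp add: V_def)
    qed
    fix \<psi> and \<epsilon> :: real assume \<psi>: "\<psi> \<in> \<Psi>" and \<epsilon>: "0 < \<epsilon>"
    define D where "D = \<bar>C\<bar> * 10 + 1"
    have D: "0 < D" by (simp add: D_def)
    obtain n where n: "(1 / 2 :: real) ^ n < \<epsilon> / D"
      using real_arch_pow_inv[of "\<epsilon> / D" "1 / 2"] \<epsilon> D by auto
    have "norm (\<psi> x - 1) < \<epsilon>" if x: "x \<in> U n" for x
    proof -
      have xc: "x \<in> carrier G" using x U.sequence_carrier by auto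
      have "0 \<le> \<rho> x" using S.seminorm_nonneg[OF xc] by simp
      then have "C * (10 * \<rho> x) \<le> D * \<rho> x"
        unfolding D_def mult.assoc[symmetric] by (intro mult_right_mono) auto
      also have "\<dots> \<le> D * (1 / 2) ^ n" using small'[OF x] D by simp
      also have "\<dots> < \<epsilon>" using n D by (simp add: field_simps)
      finally show ?thesis using lip[OF \<psi> xc] by simp
    qed
    then show "\<exists>n. \<forall>x\<in>U n. norm (\<psi> x - 1) < \<epsilon>" by blast
  qed
qed

section \<open>Group topologies and neighbourhoods of the unit\<close>

lemma neighbourhood_in_mono:
  "neighbourhood_in \<tau> x M \<Longrightarrow> M \<subseteq> N \<Longrightarrow> N \<subseteq> topspace \<tau> \<Longrightarrow> neighbourhood_in \<tau> x N"
  unfolding neighbourhood_in_def by blast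

lemma neighbourhood_in_Int:
  assumes "neighbourhood_in \<tau> x M" "neighbourhood_in \<tau> x N"
  shows "neighbourhood_in \<tau> x (M \<inter> N)"
proof -
  obtain U V where "openin \<tau> U" "x \<in> U" "U \<subseteq> M" "openin \<tau> V" "x \<in> V" "V \<subseteq> N" "M \<subseteq> topspace \<tau>"
    using assms unfolding neighbourhood_in_def by blast
  then have "openin \<tau> (U \<inter> V)" "x \<in> U \<inter> V" "U \<inter> V \<subseteq> M \<inter> N" "M \<inter> N \<subseteq> topspace \<tau>" by auto
  then show ?thesis unfolding neighbourhood_in_def by blast
qed

lemma neighbourhood_in_mem: "neighbourhood_in \<tau> x N \<Longrightarrow> x \<in> N"
  unfolding neighbourhood_in_def by blast

lemma neighbourhood_in_subset: "neighbourhood_in \<tau> x N \<Longrightarrow> N \<subseteq> topspace \<tau>"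
  unfolding neighbourhood_in_def by blast

lemma neighbourhood_in_openin: "openin \<tau> U \<Longrightarrow> x \<in> U \<Longrightarrow> neighbourhood_in \<tau> x U"
  unfolding neighbourhood_in_def using openin_subset by blast

lemma neighbourhood_in_subtopology:
  assumes "H \<subseteq> topspace \<tau>" "x \<in> H"
  shows "neighbourhood_in (subtopology \<tau> H) x N \<longleftrightarrow> N \<subseteq> H \<and> (\<exists>M. neighbourhood_in \<tau> x M \<and> M \<inter> H \<subseteq> N)"
proof
  assume "neighbourhood_in (subtopology \<tau> H) x N"
  then obtain V where "N \<subseteq> H" "openin \<tau> V" "x \<in> V" "V \<inter> H \<subseteq> N"
    using assms unfolding neighbourhood_in_def openin_subtopology by auto
  then show "N \<subseteq> H \<and> (\<exists>M. neighbourhood_in \<tau> x M \<and> M \<inter> H \<subseteq> N)"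
    using neighbourhood_in_openin by metis
next
  assume "N \<subseteq> H \<and> (\<exists>M. neighbourhood_in \<tau> x M \<and> M \<inter> H \<subseteq> N)"
  then obtain M V where "N \<subseteq> H" "M \<inter> H \<subseteq> N" "openin \<tau> V" "x \<in> V" "V \<subseteq> M"
    unfolding neighbourhood_in_def by blast
  then have "openin (subtopology \<tau> H) (V \<inter> H)" "x \<in> V \<inter> H" "V \<inter> H \<subseteq> N" "N \<subseteq> topspace (subtopology \<tau> H)"
    using assms by (auto simp: openin_subtopology)
  then show "neighbourhood_in (subtopology \<tau> H) x N" unfolding neighbourhood_in_def by blast
qed

context comm_group
begin

lemma group_topology_topspace: "group_topology G \<tau> \<Longrightarrow> topspace \<tau> = carrier G"
  by (simp add: group_topology_def)

lemma group_topology_translate: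
  assumes \<tau>: "group_topology G \<tau>" and a: "a \<in> carrier G" and U: "openin \<tau> U"
  shows "openin \<tau> {x \<in> carrier G. a \<otimes> x \<in> U}"
proof -
  have "continuous_map \<tau> (prod_topology \<tau> \<tau>) (\<lambda>x. (a, x))"
    using a \<tau> by (simp add: continuous_map_pairwise o_def group_topology_def)
  then have "continuous_map \<tau> \<tau> ((\<lambda>(x, y). x \<otimes> y) \<circ> (\<lambda>x. (a, x)))"
    using \<tau> by (intro continuous_map_compose) (auto simp: group_topology_def)
  from openin_continuous_map_preimage[OF this U] show ?thesis
    using \<tau> by (simp add: group_topology_topspace)
qed

lemma group_topology_neighbourhood_translate:
  assumes \<tau>: "group_topology G \<tau>" and a: "a \<in> carrier G" and U: "openin \<tau> U" "a \<in> U"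
  shows "neighbourhood_in \<tau> \<one> {x \<in> carrier G. a \<otimes> x \<in> U}"
  using group_topology_translate[OF \<tau> a U(1)] a U by (intro neighbourhood_in_openin) auto

lemma group_topology_openin_iff:
  assumes \<tau>: "group_topology G \<tau>"
  shows "openin \<tau> U \<longleftrightarrow> U \<subseteq> carrier G \<and> (\<forall>x\<in>U. neighbourhood_in \<tau> \<one> {y \<in> carrier G. x \<otimes> y \<in> U})"
    (is "_ \<longleftrightarrow> ?R")
proof
  assume U: "openin \<tau> U"
  have "U \<subseteq> carrier G" using openin_subset[OF U] \<tau> by (simp add: group_topology_def)
  then show ?R using group_topology_neighbourhood_translate[OF \<tau> _ U] by (simp add: subset_iff)
next
  assume R: ?R
  show "openin \<tau> U"
    unfolding openin_subopen[of \<tau> U]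
  proof
    fix x assume x: "x \<in> U"
    then have xc: "x \<in> carrier G" using R by auto
    have "neighbourhood_in \<tau> \<one> {y \<in> carrier G. x \<otimes> y \<in> U}" using R x by simp
    then obtain V where V: "openin \<tau> V" "\<one> \<in> V" "V \<subseteq> {y \<in> carrier G. x \<otimes> y \<in> U}"
      unfolding neighbourhood_in_def by blast
    have "openin \<tau> {z \<in> carrier G. inv x \<otimes> z \<in> V}"
      using xc by (intro group_topology_translate[OF \<tau> _ V(1)]) auto
    moreover have "x \<in> {z \<in> carrier G. inv x \<otimes> z \<in> V}" using xc V by simp
    moreover have "z \<in> U" if "z \<in> carrier G" "inv x \<otimes> z \<in> V" for z
    proof -
      have "x \<otimes> (inv x \<otimes> z) = z" using that xc by (simp add: m_assoc[symmetric])
      then show ?thesis using V(3) that(2) by auto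
    qed
    ultimately show "\<exists>T. openin \<tau> T \<and> x \<in> T \<and> T \<subseteq> U" by blast
  qed
qed

lemma group_topology_coarserI:
  assumes \<sigma>: "group_topology G \<sigma>" and \<tau>: "group_topology G \<tau>"
    and "\<And>N. neighbourhood_in \<sigma> \<one> N \<Longrightarrow> neighbourhood_in \<tau> \<one> N"
  shows "coarser \<sigma> \<tau>"
  using assms(3) unfolding coarser_def group_topology_openin_iff[OF \<sigma>] group_topology_openin_iff[OF \<tau>]
  by blast

lemma coarser_neighbourhood:
  assumes "coarser \<sigma> \<tau>" "topspace \<sigma> = topspace \<tau>" "neighbourhood_in \<sigma> x N"
  shows "neighbourhood_in \<tau> x N"
  using assms unfolding coarser_def neighbourhood_in_def by metis

lemma coarser_antisym: "coarser \<sigma> \<tau> \<Longrightarrow> coarser \<tau> \<sigma> \<Longrightarrow> \<sigma> = \<tau>"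
  unfolding coarser_def topology_eq by blast

lemma group_topology_eqI:
  assumes "group_topology G \<sigma>" "group_topology G \<tau>"
    and "\<And>N. neighbourhood_in \<sigma> \<one> N \<longleftrightarrow> neighbourhood_in \<tau> \<one> N"
  shows "\<sigma> = \<tau>"
  using group_topology_coarserI[of \<sigma> \<tau>] group_topology_coarserI[of \<tau> \<sigma>] assms coarser_antisym by blast

lemma group_topology_square:
  assumes \<tau>: "group_topology G \<tau>" and N: "neighbourhood_in \<tau> \<one> N"
  obtains V where "neighbourhood_in \<tau> \<one> V" "\<And>x y. x \<in> V \<Longrightarrow> y \<in> V \<Longrightarrow> x \<otimes> y \<in> N"
proof -
  obtain U where U: "openin \<tau> U" "\<one> \<in> U" "U \<subseteq> N" using N unfolding neighbourhood_in_def by blast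
  have "continuous_map (prod_topology \<tau> \<tau>) \<tau> (\<lambda>(x, y). x \<otimes> y)"
    using \<tau> by (simp add: group_topology_def)
  from openin_continuous_map_preimage[OF this U(1)]
  have "openin (prod_topology \<tau> \<tau>) {p \<in> carrier G \<times> carrier G. (case p of (x, y) \<Rightarrow> x \<otimes> y) \<in> U}"
    using \<tau> by (simp add: group_topology_topspace)
  moreover have "(\<one>, \<one>) \<in> {p \<in> carrier G \<times> carrier G. (case p of (x, y) \<Rightarrow> x \<otimes> y) \<in> U}"
    using U(2) by simp
  ultimately obtain A B where "openin \<tau> A" "openin \<tau> B" "\<one> \<in> A" "\<one> \<in> B"
    and AB: "A \<times> B \<subseteq> {p \<in> carrier G \<times> carrier G. (case p of (x, y) \<Rightarrow> x \<otimes> y) \<in> U}"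
    unfolding openin_prod_topology_alt by meson
  then have "neighbourhood_in \<tau> \<one> (A \<inter> B)" by (intro neighbourhood_in_openin) auto
  moreover have "x \<otimes> y \<in> N" if "x \<in> A \<inter> B" "y \<in> A \<inter> B" for x y
    using AB that U(3) by auto
  ultimately show thesis by (rule that)
qed

lemma group_topology_inverse:
  assumes \<tau>: "group_topology G \<tau>" and N: "neighbourhood_in \<tau> \<one> N"
  shows "neighbourhood_in \<tau> \<one> {x \<in> carrier G. inv x \<in> N}"
proof -
  obtain U where U: "openin \<tau> U" "\<one> \<in> U" "U \<subseteq> N" using N unfolding neighbourhood_in_def by blast
  have "openin \<tau> {x \<in> carrier G. inv x \<in> U}"
    using openin_continuous_map_preimage[OF _ U(1), of \<tau> "\<lambda>x. inv x"] \<tau>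
    by (simp add: group_topology_def)
  then have "neighbourhood_in \<tau> \<one> {x \<in> carrier G. inv x \<in> U}"
    using U by (intro neighbourhood_in_openin) auto
  then show ?thesis
    using U \<tau> by (rule_tac neighbourhood_in_mono) (auto simp: group_topology_topspace)
qed

text \<open>
  The symmetric neighbourhoods obtained here are the steps of a neighbourhood sequence.
\<close>

lemma group_topology_cube:
  assumes \<tau>: "group_topology G \<tau>" and N: "neighbourhood_in \<tau> \<one> N"
  obtains V where "neighbourhood_in \<tau> \<one> V" "\<And>x. x \<in> V \<Longrightarrow> inv x \<in> V"
    "\<And>x y z. x \<in> V \<Longrightarrow> y \<in> V \<Longrightarrow> z \<in> V \<Longrightarrow> x \<otimes> y \<otimes> z \<in> N"
proof -
  obtain V where V: "neighbourhood_in \<tau> \<one> V" "\<And>x y. x \<in> V \<Longrightarrow> y \<in> V \<Longrightarrow> x \<otimes> y \<in> N"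
    by (rule group_topology_square[OF \<tau> N]) (rule that)
  obtain W where W: "neighbourhood_in \<tau> \<one> W" "\<And>x y. x \<in> W \<Longrightarrow> y \<in> W \<Longrightarrow> x \<otimes> y \<in> V"
    by (rule group_topology_square[OF \<tau> V(1)]) (rule that)
  define T where "T = (V \<inter> W) \<inter> {x \<in> carrier G. inv x \<in> V \<inter> W}"
  have VW: "neighbourhood_in \<tau> \<one> (V \<inter> W)" using V W by (intro neighbourhood_in_Int)
  show thesis
  proof (rule that[of T])
    show "neighbourhood_in \<tau> \<one> T" unfolding T_def
      by (intro neighbourhood_in_Int[OF VW] group_topology_inverse[OF \<tau> VW])
    have "V \<subseteq> carrier G" using neighbourhood_in_subset[OF V(1)] \<tau> by (simp add: group_topology_def)
    then show "inv x \<in> T" if "x \<in> T" for x using that by (auto simp: T_def)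
    show "x \<otimes> y \<otimes> z \<in> N" if "x \<in> T" "y \<in> T" "z \<in> T" for x y z
      using that by (intro V(2) W(2)) (auto simp: T_def)
  qed
qed

lemma group_topology_sequence:
  assumes \<tau>: "group_topology G \<tau>" and N: "neighbourhood_in \<tau> \<one> N"
  obtains U where "neighbourhood_sequence G U" "U 0 \<subseteq> N" "\<And>n. neighbourhood_in \<tau> \<one> (U n)"
proof -
  define P where "P = (\<lambda>(n::nat) V. neighbourhood_in \<tau> \<one> V \<and> V \<subseteq> N \<and> (\<forall>x\<in>V. inv x \<in> V))"
  define Q where "Q = (\<lambda>(n::nat) M V. \<forall>x\<in>V. \<forall>y\<in>V. \<forall>z\<in>V. x \<otimes> y \<otimes> z \<in> (M :: 'a set))"
  have step: "\<exists>V. neighbourhood_in \<tau> \<one> V \<and> V \<subseteq> M \<and> (\<forall>x\<in>V. inv x \<in> V) \<and> Q n M V"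
    if M: "neighbourhood_in \<tau> \<one> M" for M n
  proof -
    obtain V where V: "neighbourhood_in \<tau> \<one> V" "\<And>x. x \<in> V \<Longrightarrow> inv x \<in> V"
      "\<And>x y z. x \<in> V \<Longrightarrow> y \<in> V \<Longrightarrow> z \<in> V \<Longrightarrow> x \<otimes> y \<otimes> z \<in> M"
      by (rule group_topology_cube[OF \<tau> M]) (rule that)
    have "x \<in> M" if "x \<in> V" for x
    proof -
      have "x \<in> carrier G" using that neighbourhood_in_subset[OF V(1)] \<tau> by (auto simp: group_topology_def)
      then show ?thesis
        using V(3)[OF that neighbourhood_in_mem[OF V(1)] neighbourhood_in_mem[OF V(1)]] by simp
    qed
    then show ?thesis using V unfolding Q_def by blast
  qed
  have "\<exists>f. \<forall>n. P n (f n) \<and> Q n (f n) (f (Suc n))"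
  proof (rule dependent_nat_choice)
    show "\<exists>V. P 0 V" using step[OF N] unfolding P_def by blast
    fix M n assume M: "P n M"
    then have "neighbourhood_in \<tau> \<one> M" "M \<subseteq> N" by (simp_all add: P_def)
    then obtain V where "neighbourhood_in \<tau> \<one> V" "V \<subseteq> N" "\<forall>x\<in>V. inv x \<in> V" "Q n M V"
      using step[of M n] by auto
    then show "\<exists>V. P (Suc n) V \<and> Q n M V" unfolding P_def by auto
  qed
  then obtain U where PQ: "\<forall>n. P n (U n) \<and> Q n (U n) (U (Suc n))" ..
  then have U: "P n (U n)" and Q: "Q n (U n) (U (Suc n))" for n by simp_all
  show thesis
  proof (rule that[of U])
    show "U 0 \<subseteq> N" "\<And>n. neighbourhood_in \<tau> \<one> (U n)" using U by (auto simp: P_def)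
    show "neighbourhood_sequence G U"
    proof
      fix n x y z
      show "U n \<subseteq> carrier G" "\<one> \<in> U n"
        using U[of n] neighbourhood_in_subset[of \<tau> \<one> "U n"] neighbourhood_in_mem[of \<tau> \<one> "U n"]
        by (simp_all add: P_def group_topology_topspace[OF \<tau>])
      show "inv x \<in> U n" if "x \<in> U n" using U[of n] that by (auto simp: P_def)
      show "x \<otimes> y \<otimes> z \<in> U n" if "x \<in> U (Suc n)" "y \<in> U (Suc n)" "z \<in> U (Suc n)"
        using Q[of n] that by (auto simp: Q_def)
    qed
  qed
qed

lemma group_topology_Hausdorff_iff:
  assumes \<tau>: "group_topology G \<tau>"
  shows "Hausdorff_space \<tau> \<longleftrightarrow> (\<forall>x\<in>carrier G. x \<noteq> \<one> \<longrightarrow> (\<exists>N. neighbourhood_in \<tau> \<one> N \<and> x \<notin> N))"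
    (is "_ \<longleftrightarrow> ?R")
proof
  assume H: "Hausdorff_space \<tau>"
  show ?R
  proof (intro ballI impI)
    fix x assume x: "x \<in> carrier G" "x \<noteq> \<one>"
    obtain U V where "openin \<tau> U" "openin \<tau> V" "x \<in> U" "\<one> \<in> V" "disjnt U V"
      using H x \<tau> unfolding Hausdorff_space_def by (metis group_topology_topspace one_closed)
    then show "\<exists>N. neighbourhood_in \<tau> \<one> N \<and> x \<notin> N"
      using neighbourhood_in_openin[of \<tau> V \<one>] unfolding disjnt_def by blast
  qed
next
  assume R: ?R
  show "Hausdorff_space \<tau>"
    unfolding Hausdorff_space_def
  proof (intro allI impI)
    fix x y assume "x \<in> topspace \<tau> \<and> y \<in> topspace \<tau> \<and> x \<noteq> y"
    then have xy: "x \<in> carrier G" "y \<in> carrier G" "x \<noteq> y" using \<tau> by (auto simp: group_topology_topspace)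
    have "inv x \<otimes> y \<noteq> \<one>" using xy by (metis inv_equality inv_inv inv_closed m_comm)
    then obtain N where N: "neighbourhood_in \<tau> \<one> N" "inv x \<otimes> y \<notin> N" using R xy by blast
    obtain V where V: "neighbourhood_in \<tau> \<one> V" "\<And>x. x \<in> V \<Longrightarrow> inv x \<in> V"
      "\<And>x y z. x \<in> V \<Longrightarrow> y \<in> V \<Longrightarrow> z \<in> V \<Longrightarrow> x \<otimes> y \<otimes> z \<in> N"
      by (rule group_topology_cube[OF \<tau> N(1)]) (rule that)
    obtain W where W: "openin \<tau> W" "\<one> \<in> W" "W \<subseteq> V" using V(1) unfolding neighbourhood_in_def by blast
    let ?A = "{z \<in> carrier G. inv x \<otimes> z \<in> W}" and ?B = "{z \<in> carrier G. inv y \<otimes> z \<in> W}"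
    have "openin \<tau> ?A" "openin \<tau> ?B" using group_topology_translate[OF \<tau> _ W(1)] xy by auto
    moreover have "x \<in> ?A" "y \<in> ?B" using xy W by auto
    moreover have "disjnt ?A ?B"
    proof -
      have False if z: "z \<in> carrier G" "inv x \<otimes> z \<in> W" "inv y \<otimes> z \<in> W" for z
      proof -
        have "(inv x \<otimes> z) \<otimes> inv (inv y \<otimes> z) \<otimes> \<one> \<in> N"
          using z W by (intro V(3) V(2)) auto
        moreover have "(inv x \<otimes> z) \<otimes> inv (inv y \<otimes> z) \<otimes> \<one> = inv x \<otimes> y"
        proof -
          have "inv (inv y \<otimes> z) = inv z \<otimes> y" using z(1) xy by (simp add: inv_mult m_comm)
          moreover have "z \<otimes> (inv z \<otimes> y) = y" using z(1) xy by (simp add: m_assoc[symmetric])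
          ultimately show ?thesis using z(1) xy by (simp add: m_assoc)
        qed
        ultimately show False using N(2) by simp
      qed
      then show ?thesis by (auto simp: disjnt_def)
    qed
    ultimately show "\<exists>U V. openin \<tau> U \<and> openin \<tau> V \<and> x \<in> U \<and> y \<in> V \<and> disjnt U V" by blast
  qed
qed

end

text \<open>
  The extension topology and the topologies generated by characters are both described by a base of
  neighbourhoods of the unit.
\<close>

locale unit_neighbourhood_base = comm_group G for G (structure) +
  fixes B :: "'a set set"
  assumes base_nonempty: "B \<noteq> {}"
    and base_carrier: "N \<in> B \<Longrightarrow> N \<subseteq> carrier G"
    and base_one: "N \<in> B \<Longrightarrow> \<one> \<in> N"
    and base_Int: "M \<in> B \<Longrightarrow> N \<in> B \<Longrightarrow> \<exists>V\<in>B. V \<subseteq> M \<inter> N"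
    and base_mult: "N \<in> B \<Longrightarrow> \<exists>V\<in>B. \<forall>x\<in>V. \<forall>y\<in>V. x \<otimes> y \<in> N"
    and base_inv: "N \<in> B \<Longrightarrow> \<exists>V\<in>B. \<forall>x\<in>V. inv x \<in> N"
begin

definition base_topology :: "'a topology" where
  "base_topology = topology (\<lambda>U. U \<subseteq> carrier G \<and> (\<forall>x\<in>U. \<exists>N\<in>B. \<forall>y\<in>N. x \<otimes> y \<in> U))"

lemma openin_base_topology:
  "openin base_topology U \<longleftrightarrow> U \<subseteq> carrier G \<and> (\<forall>x\<in>U. \<exists>N\<in>B. \<forall>y\<in>N. x \<otimes> y \<in> U)"
proof -
  let ?P = "\<lambda>U. U \<subseteq> carrier G \<and> (\<forall>x\<in>U. \<exists>N\<in>B. \<forall>y\<in>N. x \<otimes> y \<in> U)"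
  have "?P (S \<inter> T)" if S: "?P S" and T: "?P T" for S T
  proof (intro conjI ballI)
    show "S \<inter> T \<subseteq> carrier G" using S by blast
    fix x assume "x \<in> S \<inter> T"
    then obtain M N where "M \<in> B" "N \<in> B" and MN: "\<forall>y\<in>M. x \<otimes> y \<in> S" "\<forall>y\<in>N. x \<otimes> y \<in> T"
      using S T by blast
    then obtain V where "V \<in> B" "V \<subseteq> M \<inter> N" using base_Int by blast
    then show "\<exists>N\<in>B. \<forall>y\<in>N. x \<otimes> y \<in> S \<inter> T" using MN by blast
  qed
  moreover have "?P (\<Union>K)" if K: "\<forall>S\<in>K. ?P S" for K
  proof (intro conjI ballI)
    show "\<Union>K \<subseteq> carrier G" using K by blast
    fix x assume "x \<in> \<Union>K"
    then obtain S where "S \<in> K" "x \<in> S" by blast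
    then obtain N where "N \<in> B" "\<forall>y\<in>N. x \<otimes> y \<in> S" using K by blast
    then show "\<exists>N\<in>B. \<forall>y\<in>N. x \<otimes> y \<in> \<Union>K" using \<open>S \<in> K\<close> by blast
  qed
  ultimately have "istopology ?P" unfolding istopology_def by blast
  then show ?thesis by (simp add: base_topology_def topology_inverse')
qed

lemma topspace_base_topology: "topspace base_topology = carrier G"
proof -
  obtain N where "N \<in> B" using base_nonempty by blast
  then have "openin base_topology (carrier G)"
    unfolding openin_base_topology using base_carrier by blast
  then show ?thesis by (metis openin_base_topology openin_subset openin_topspace subset_antisym)
qed

lemma neighbourhood_in_base_topology:
  "neighbourhood_in base_topology \<one> N \<longleftrightarrow> N \<subseteq> carrier G \<and> (\<exists>M\<in>B. M \<subseteq> N)"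
proof
  assume "neighbourhood_in base_topology \<one> N"
  then obtain U where U: "N \<subseteq> carrier G" "openin base_topology U" "\<one> \<in> U" "U \<subseteq> N"
    unfolding neighbourhood_in_def topspace_base_topology by blast
  then obtain M where "M \<in> B" "\<forall>y\<in>M. \<one> \<otimes> y \<in> U" unfolding openin_base_topology by blast
  then have "M \<subseteq> N" using base_carrier U by fastforce
  then show "N \<subseteq> carrier G \<and> (\<exists>M\<in>B. M \<subseteq> N)" using U \<open>M \<in> B\<close> by blast
next
  assume "N \<subseteq> carrier G \<and> (\<exists>M\<in>B. M \<subseteq> N)"
  then obtain M where N: "N \<subseteq> carrier G" and M: "M \<in> B" "M \<subseteq> N" by blast
  define U where "U = {x \<in> carrier G. \<exists>V\<in>B. \<forall>y\<in>V. x \<otimes> y \<in> N}"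
  have "openin base_topology U"
    unfolding openin_base_topology
  proof (intro conjI ballI)
    show "U \<subseteq> carrier G" by (auto simp: U_def)
    fix x assume "x \<in> U"
    then obtain V where x: "x \<in> carrier G" and V: "V \<in> B" "\<forall>y\<in>V. x \<otimes> y \<in> N" by (auto simp: U_def)
    obtain W where W: "W \<in> B" "\<forall>x\<in>W. \<forall>y\<in>W. x \<otimes> y \<in> V" using base_mult[OF V(1)] by blast
    have "x \<otimes> y \<in> U" if y: "y \<in> W" for y
    proof -
      have "(x \<otimes> y) \<otimes> z \<in> N" if "z \<in> W" for z
        using W V y that x base_carrier[OF W(1)] by (auto simp: m_assoc subset_iff)
      then show ?thesis using W(1) y x base_carrier[OF W(1)] by (auto simp: U_def)
    qed
    then show "\<exists>N\<in>B. \<forall>y\<in>N. x \<otimes> y \<in> U" using W(1) by blast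
  qed
  moreover have "\<one> \<in> U" using M base_carrier[OF M(1)]
    by (auto simp: U_def subset_iff intro!: bexI[of _ M])
  moreover have "U \<subseteq> N"
    using base_one by (fastforce simp: U_def)
  ultimately show "neighbourhood_in base_topology \<one> N"
    using N unfolding neighbourhood_in_def topspace_base_topology by blast
qed

lemma base_topology_translate:
  assumes a: "a \<in> carrier G" and M: "M \<in> B"
  obtains A where "openin base_topology A" "a \<in> A" "A \<subseteq> {a \<otimes> y | y. y \<in> M}"
proof -
  have "neighbourhood_in base_topology \<one> M"
    using M base_carrier by (auto simp: neighbourhood_in_base_topology)
  then obtain V where V: "openin base_topology V" "\<one> \<in> V" "V \<subseteq> M" unfolding neighbourhood_in_def by blast
  define A where "A = {x \<in> carrier G. inv a \<otimes> x \<in> V}"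
  have "openin base_topology A"
    unfolding openin_base_topology
  proof (intro conjI ballI)
    show "A \<subseteq> carrier G" by (auto simp: A_def)
    fix x assume "x \<in> A"
    then have x: "x \<in> carrier G" "inv a \<otimes> x \<in> V" by (auto simp: A_def)
    then obtain N where N: "N \<in> B" "\<forall>y\<in>N. (inv a \<otimes> x) \<otimes> y \<in> V"
      using V(1) unfolding openin_base_topology by blast
    then have "\<forall>y\<in>N. x \<otimes> y \<in> A" using base_carrier[OF N(1)] x a by (auto simp: A_def m_assoc subset_iff)
    then show "\<exists>N\<in>B. \<forall>y\<in>N. x \<otimes> y \<in> A" using N(1) by blast
  qed
  moreover have "a \<in> A" using a V by (simp add: A_def)
  moreover have "A \<subseteq> {a \<otimes> y | y. y \<in> M}"
  proof
    fix x assume "x \<in> A"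
    then have x: "x \<in> carrier G" "inv a \<otimes> x \<in> M" using V by (auto simp: A_def)
    then have "x = a \<otimes> (inv a \<otimes> x)" using a by (simp add: m_assoc[symmetric])
    then show "x \<in> {a \<otimes> y | y. y \<in> M}" using x by blast
  qed
  ultimately show thesis by (rule that)
qed

lemma group_topology_base_topology: "group_topology G base_topology"
  unfolding group_topology_def
proof (intro conjI)
  show "topspace base_topology = carrier G" by (rule topspace_base_topology)
  show "continuous_map (prod_topology base_topology base_topology) base_topology (\<lambda>(x, y). x \<otimes> y)"
    unfolding continuous_map_def
  proof (intro conjI allI impI)
    show "(\<lambda>(x, y). x \<otimes> y) \<in> topspace (prod_topology base_topology base_topology) \<rightarrow> topspace base_topology"
      by (auto simp: topspace_base_topology)
    fix U assume U: "openin base_topology U"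
    show "openin (prod_topology base_topology base_topology)
       {p \<in> topspace (prod_topology base_topology base_topology). (case p of (x, y) \<Rightarrow> x \<otimes> y) \<in> U}"
      unfolding openin_prod_topology_alt
    proof (intro allI impI)
      fix a b assume "(a, b) \<in> {p \<in> topspace (prod_topology base_topology base_topology).
         (case p of (x, y) \<Rightarrow> x \<otimes> y) \<in> U}"
      then have ab: "a \<in> carrier G" "b \<in> carrier G" "a \<otimes> b \<in> U" by (auto simp: topspace_base_topology)
      obtain N where N: "N \<in> B" "\<forall>y\<in>N. (a \<otimes> b) \<otimes> y \<in> U"
        using U ab(3) unfolding openin_base_topology by blast
      obtain M where M: "M \<in> B" "\<forall>x\<in>M. \<forall>y\<in>M. x \<otimes> y \<in> N" using base_mult[OF N(1)] by blast
      obtain A where A: "openin base_topology A" "a \<in> A" "A \<subseteq> {a \<otimes> y | y. y \<in> M}"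
        by (rule base_topology_translate[OF ab(1) M(1)])
      obtain A' where A': "openin base_topology A'" "b \<in> A'" "A' \<subseteq> {b \<otimes> y | y. y \<in> M}"
        by (rule base_topology_translate[OF ab(2) M(1)])
      have "x \<otimes> y \<in> U" if x: "x \<in> A" and y: "y \<in> A'" for x y
      proof -
        obtain u v where uv: "u \<in> M" "v \<in> M" "x = a \<otimes> u" "y = b \<otimes> v"
          using x y A(3) A'(3) by blast
        have "u \<in> carrier G" "v \<in> carrier G" using uv base_carrier[OF M(1)] by auto
        then have "x \<otimes> y = (a \<otimes> b) \<otimes> (u \<otimes> v)" using uv ab by (simp add: m_ac)
        then show ?thesis using N(2) M(2) uv by auto
      qed
      moreover have "A \<subseteq> carrier G" "A' \<subseteq> carrier G" using A A' openin_subset topspace_base_topology by blast+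
      ultimately have "A \<times> A' \<subseteq> {p \<in> topspace (prod_topology base_topology base_topology).
         (case p of (x, y) \<Rightarrow> x \<otimes> y) \<in> U}"
        by (auto simp: topspace_base_topology)
      then show "\<exists>U' V. openin base_topology U' \<and> openin base_topology V \<and> a \<in> U' \<and> b \<in> V \<and>
         U' \<times> V \<subseteq> {p \<in> topspace (prod_topology base_topology base_topology).
           (case p of (x, y) \<Rightarrow> x \<otimes> y) \<in> U}"
        using A A' by blast
    qed
  qed
  show "continuous_map base_topology base_topology (\<lambda>x. inv x)"
    unfolding continuous_map_def
  proof (intro conjI allI impI)
    show "(\<lambda>x. inv x) \<in> topspace base_topology \<rightarrow> topspace base_topology"
      by (auto simp: topspace_base_topology)
    fix U assume U: "openin base_topology U"
    show "openin base_topology {x \<in> topspace base_topology. inv x \<in> U}"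
      unfolding openin_base_topology topspace_base_topology
    proof (intro conjI ballI)
      fix x assume "x \<in> {x \<in> carrier G. inv x \<in> U}"
      then have x: "x \<in> carrier G" "inv x \<in> U" by auto
      obtain N where N: "N \<in> B" "\<forall>y\<in>N. inv x \<otimes> y \<in> U"
        using U x(2) unfolding openin_base_topology by blast
      obtain M where M: "M \<in> B" "\<forall>x\<in>M. inv x \<in> N" using base_inv[OF N(1)] by blast
      have "\<forall>y\<in>M. x \<otimes> y \<in> {x \<in> carrier G. inv x \<in> U}"
        using N(2) M(2) x base_carrier[OF M(1)] by (auto simp: inv_mult subset_iff)
      then show "\<exists>N\<in>B. \<forall>y\<in>N. x \<otimes> y \<in> {x \<in> carrier G. inv x \<in> U}" using M(1) by blast
    qed auto
  qed
qed

end

section \<open>The torus as the unit circle\<close>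

text \<open>
  Representatives of a coset differ by an integer, which the factor \<open>2 * pi\<close> turns into a full
  period.
\<close>

definition circle_value :: "real set \<Rightarrow> complex" where
  "circle_value A = cis (2 * pi * (SOME x. x \<in> A))"

lemma comm_group_real_add_group: "comm_group real_add_group"
proof (rule comm_groupI)
  show "\<exists>y\<in>carrier real_add_group. y \<otimes>\<^bsub>real_add_group\<^esub> x = \<one>\<^bsub>real_add_group\<^esub>"
    if "x \<in> carrier real_add_group" for x
    by (rule bexI[of _ "-x"]) (simp_all add: real_add_group_def)
qed (simp_all add: real_add_group_def)

lemma normal_Ints: "\<int> \<lhd> real_add_group"
proof -
  interpret R: comm_group real_add_group by (rule comm_group_real_add_group)
  have "inv\<^bsub>real_add_group\<^esub> x = -x" for x
    by (rule R.inv_equality) (simp_all add: real_add_group_def)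
  then have "subgroup \<int> real_add_group"
    by (intro R.subgroupI) (auto simp: real_add_group_def)
  then show ?thesis by (rule R.subgroup_imp_normal)
qed

lemma comm_group_torus: "comm_group torus"
  unfolding torus_def
  using comm_group.abelian_FactGroup[OF comm_group_real_add_group] normal_Ints
  by (simp add: normal_def)

abbreviation integer_coset :: "real \<Rightarrow> real set" where
  "integer_coset x \<equiv> \<int> #>\<^bsub>real_add_group\<^esub> x"

lemma integer_coset_eq: "integer_coset x = {n + x | n. n \<in> \<int>}"
  by (auto simp: r_coset_def real_add_group_def)

lemma carrier_torus: "carrier torus = range integer_coset"
  by (simp add: torus_def carrier_FactGroup real_add_group_def)

lemma torus_mult: "integer_coset x \<otimes>\<^bsub>torus\<^esub> integer_coset y = integer_coset (x + y)"
  using normal.rcos_sum[OF normal_Ints, of x y]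
  by (simp add: torus_def real_add_group_def)

lemma circle_value_coset [simp]: "circle_value (integer_coset x) = cis (2 * pi * x)"
proof -
  have "x \<in> integer_coset x" unfolding integer_coset_eq by force
  then have "(SOME y. y \<in> integer_coset x) \<in> integer_coset x" by (rule someI)
  then obtain n :: int where n: "(SOME y. y \<in> integer_coset x) = of_int n + x"
    unfolding integer_coset_eq by (auto elim: Ints_cases)
  have "2 * pi * (of_int n + x) = 2 * pi * x + 2 * pi * of_int n" by (simp add: algebra_simps)
  then show ?thesis
    unfolding circle_value_def n by (simp add: cis.ctr sin_add cos_add)
qed

lemma inj_on_circle_value: "inj_on circle_value (carrier torus)"
proof (rule inj_onI)
  fix A B assume "A \<in> carrier torus" "B \<in> carrier torus" and eq: "circle_value A = circle_value B"
  then obtain x y where xy: "A = integer_coset x" "B = integer_coset y" by (auto simp: carrier_torus)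
  have "sin (2 * pi * x) = sin (2 * pi * y) \<and> cos (2 * pi * x) = cos (2 * pi * y)"
    using eq by (simp add: xy complex_eq_iff)
  then obtain n :: int where "2 * pi * x = 2 * pi * y + 2 * pi * n"
    unfolding sin_cos_eq_iff by blast
  then have "2 * pi * x = 2 * pi * (y + n)" by (simp add: algebra_simps)
  then have x: "x = y + n" by simp
  have "{m + x | m. m \<in> \<int>} = {m + y | m. m \<in> \<int>}"
  proof (intro equalityI subsetI)
    fix z assume "z \<in> {m + x | m. m \<in> \<int>}"
    then obtain m :: real where "m \<in> \<int>" "z = (m + n) + y" by (auto simp: x)
    moreover from this have "m + of_int n \<in> \<int>" by simp
    ultimately show "z \<in> {m + y | m. m \<in> \<int>}" by blast
  next
    fix z assume "z \<in> {m + y | m. m \<in> \<int>}"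
    then obtain m :: real where "m \<in> \<int>" "z = (m - n) + x" by (auto simp: x)
    moreover from this have "m - of_int n \<in> \<int>" by simp
    ultimately show "z \<in> {m + x | m. m \<in> \<int>}" by blast
  qed
  then show "A = B" by (simp add: xy integer_coset_eq)
qed

lemma circle_value_surj:
  assumes "norm z = 1"
  obtains A where "A \<in> carrier torus" "circle_value A = z"
proof (rule that[of "integer_coset (Arg z / (2 * pi))"])
  show "integer_coset (Arg z / (2 * pi)) \<in> carrier torus" by (simp add: carrier_torus)
  have "z \<noteq> 0" using assms by auto
  then show "circle_value (integer_coset (Arg z / (2 * pi))) = z"
    using assms by (simp add: cis_Arg sgn_eq)
qed

lemma circle_value_mult:
  assumes "A \<in> carrier torus" "B \<in> carrier torus"
  shows "circle_value (A \<otimes>\<^bsub>torus\<^esub> B) = circle_value A * circle_value B"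
  using assms by (auto simp: carrier_torus torus_mult cis_mult algebra_simps)

lemma norm_circle_value: "A \<in> carrier torus \<Longrightarrow> norm (circle_value A) = 1"
  by (auto simp: carrier_torus)

lemma topspace_torus: "topspace torus_topology = carrier torus"
  unfolding torus_topology_def torus_def
  by (rule topspace_quotient_group_topology) (simp add: real_add_group_def)

lemma quotient_map_integer_coset: "quotient_map euclidean torus_topology integer_coset"
  unfolding torus_topology_def
  by (rule quotient_map_quotient_group_topology) (simp add: real_add_group_def)

lemma continuous_circle_value: "continuous_map torus_topology euclidean circle_value"
proof (rule continuous_compose_quotient_map[OF quotient_map_integer_coset])
  have "continuous_on UNIV (\<lambda>x. cis (2 * pi * x))" by (intro continuous_intros)
  then show "continuous_map euclidean euclidean (circle_value \<circ> integer_coset)"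
    by (simp add: o_def)
qed

lemma compact_torus: "compact_space torus_topology"
proof -
  have "continuous_map euclidean torus_topology integer_coset"
    by (rule quotient_imp_continuous_map[OF quotient_map_integer_coset])
  then have "compactin torus_topology (integer_coset ` {0..1})"
    by (rule image_compactin[rotated]) simp
  moreover have "integer_coset ` {0..1} = carrier torus"
  proof
    show "carrier torus \<subseteq> integer_coset ` {0..1}"
    proof
      fix A assume A: "A \<in> carrier torus"
      then obtain x where x: "A = integer_coset x" by (auto simp: carrier_torus)
      have "2 * pi * x = 2 * pi * frac x + 2 * pi * of_int \<lfloor>x\<rfloor>" by (simp add: frac_def algebra_simps)
      then have "circle_value A = circle_value (integer_coset (frac x))"
        by (simp add: x cis.ctr sin_add cos_add)
      then have "A = integer_coset (frac x)"
        by (rule inj_onD[OF inj_on_circle_value _ A]) (simp add: carrier_torus)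
      then show "A \<in> integer_coset ` {0..1}" 
        using frac_ge_0[of x] less_imp_le[OF frac_lt_1[of x]] by (intro image_eqI[of _ _ "frac x"]) simp_all
    qed
  qed (auto simp: carrier_torus)
  ultimately show ?thesis by (simp add: compact_space_def topspace_torus)
qed

text \<open>
  A continuous injection of the compact torus into the plane is a closed map, so \<open>circle_value\<close> is a
  homeomorphism onto its image, and continuity may be tested after composing with it.
\<close>

lemma continuous_map_torus_iff:
  assumes f: "f \<in> topspace X \<rightarrow> carrier torus"
  shows "continuous_map X torus_topology f \<longleftrightarrow> continuous_map X euclidean (\<lambda>x. circle_value (f x))"
proof
  assume "continuous_map X torus_topology f"
  from continuous_map_compose[OF this continuous_circle_value]
  show "continuous_map X euclidean (\<lambda>x. circle_value (f x))" by (simp add: o_def)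
next
  assume g: "continuous_map X euclidean (\<lambda>x. circle_value (f x))"
  have closed: "closed_map torus_topology euclidean circle_value"
    by (rule continuous_imp_closed_map[OF continuous_circle_value compact_torus]) simp
  show "continuous_map X torus_topology f"
    unfolding continuous_map_closedin
  proof (intro conjI allI impI ballI)
    show "f \<in> topspace X \<rightarrow> topspace torus_topology"
      using f by (simp add: topspace_torus)
    fix C assume C: "closedin torus_topology C"
    then have "closedin euclidean (circle_value ` C)" using closed by (auto simp: closed_map_def)
    then have "closedin X {x \<in> topspace X. circle_value (f x) \<in> circle_value ` C}"
      using g by (rule closedin_continuous_map_preimage[rotated])
    also have "{x \<in> topspace X. circle_value (f x) \<in> circle_value ` C} = {x \<in> topspace X. f x \<in> C}"
    proof -
      have "C \<subseteq> carrier torus" using closedin_subset[OF C] by (simp add: topspace_torus)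
      then show ?thesis using f inj_on_circle_value unfolding inj_on_def by blast
    qed
    finally show "closedin X {x \<in> topspace X. f x \<in> C}" .
  qed
qed

definition circle_lift :: "('a, 'm) monoid_scheme \<Rightarrow> ('a \<Rightarrow> real set) \<Rightarrow> 'a \<Rightarrow> complex" where
  "circle_lift G \<phi> = (\<lambda>x\<in>carrier G. circle_value (\<phi> x))"

lemma (in group) circle_lift_character:
  assumes "\<phi> \<in> hom G torus"
  shows "circle_lift G \<phi> \<in> circle_characters G"
  using assms
  by (auto simp: circle_lift_def circle_characters_def hom_def norm_circle_value circle_value_mult Pi_iff)

lemma (in group) circle_lift_surj:
  assumes \<psi>: "\<psi> \<in> circle_characters G"
  obtains \<phi> where "\<phi> \<in> hom G torus \<inter> extensional (carrier G)" "circle_lift G \<phi> = \<psi>"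
proof -
  interpret T: comm_group torus by (rule comm_group_torus)
  define \<phi> where "\<phi> = (\<lambda>x\<in>carrier G. SOME A. A \<in> carrier torus \<and> circle_value A = \<psi> x)"
  have \<phi>: "\<phi> x \<in> carrier torus \<and> circle_value (\<phi> x) = \<psi> x" if x: "x \<in> carrier G" for x
  proof -
    obtain A where "A \<in> carrier torus" "circle_value A = \<psi> x"
      by (rule circle_value_surj[OF circle_character_norm[OF \<psi> x]])
    then have "\<exists>A. A \<in> carrier torus \<and> circle_value A = \<psi> x" by blast
    from someI_ex[OF this] show ?thesis using x by (simp add: \<phi>_def)
  qed
  have "\<phi> (x \<otimes> y) = \<phi> x \<otimes>\<^bsub>torus\<^esub> \<phi> y" if "x \<in> carrier G" "y \<in> carrier G" for x y
  proof (rule inj_onD[OF inj_on_circle_value])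
    show "circle_value (\<phi> (x \<otimes> y)) = circle_value (\<phi> x \<otimes>\<^bsub>torus\<^esub> \<phi> y)"
      using that \<phi> by (simp add: circle_value_mult circle_character_mult[OF \<psi>])
  qed (use that \<phi> in auto)
  then have "\<phi> \<in> hom G torus \<inter> extensional (carrier G)" using \<phi> by (auto simp: hom_def \<phi>_def)
  moreover have "circle_lift G \<phi> = \<psi>"
  proof (rule extensionalityI[of _ "carrier G"])
    show "circle_lift G \<phi> \<in> extensional (carrier G)" by (simp add: circle_lift_def)
    show "\<psi> \<in> extensional (carrier G)" using \<psi> by (simp add: circle_characters_def)
    show "circle_lift G \<phi> x = \<psi> x" if "x \<in> carrier G" for x using \<phi> that by (simp add: circle_lift_def)
  qed
  ultimately show thesis by (rule that)
qed

text \<open>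
  For homomorphisms, continuity at the unit is continuity.
\<close>

definition continuous_circle_characters :: "('a, 'm) monoid_scheme \<Rightarrow> 'a topology \<Rightarrow> ('a \<Rightarrow> complex) set" where
  "continuous_circle_characters G \<tau> = {\<psi> \<in> circle_characters G.
     \<forall>\<epsilon>>0. neighbourhood_in \<tau> \<one>\<^bsub>G\<^esub> {x \<in> carrier G. norm (\<psi> x - 1) < \<epsilon>}}"

lemma (in comm_group) circle_character_norm_diff:
  assumes \<psi>: "\<psi> \<in> circle_characters G" and x: "x \<in> carrier G" and y: "y \<in> carrier G"
  shows "norm (\<psi> (x \<otimes> y) - \<psi> x) = norm (\<psi> y - 1)"
proof -
  have "\<psi> (x \<otimes> y) - \<psi> x = \<psi> x * (\<psi> y - 1)"
    by (simp add: circle_character_mult[OF assms] algebra_simps)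
  then show ?thesis by (simp add: norm_mult circle_character_norm[OF \<psi> x])
qed

lemma (in comm_group) continuous_map_circle_lift_iff:
  assumes \<tau>: "group_topology G \<tau>" and \<phi>: "\<phi> \<in> hom G torus"
  shows "continuous_map \<tau> torus_topology \<phi> \<longleftrightarrow> circle_lift G \<phi> \<in> continuous_circle_characters G \<tau>"
proof -
  let ?\<psi> = "circle_lift G \<phi>"
  have \<psi>: "?\<psi> \<in> circle_characters G" using \<phi> by (rule circle_lift_character)
  have top: "topspace \<tau> = carrier G" using \<tau> by (rule group_topology_topspace)
  have "continuous_map \<tau> torus_topology \<phi> \<longleftrightarrow> continuous_map \<tau> euclidean (\<lambda>x. circle_value (\<phi> x))"
    using \<phi> by (intro continuous_map_torus_iff) (auto simp: top hom_def)
  also have "\<dots> \<longleftrightarrow> continuous_map \<tau> euclidean ?\<psi>"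
    by (intro iffI; erule continuous_map_eq) (simp_all add: top circle_lift_def)
  also have "\<dots> \<longleftrightarrow> ?\<psi> \<in> continuous_circle_characters G \<tau>"
  proof
    assume c: "continuous_map \<tau> euclidean ?\<psi>"
    have "neighbourhood_in \<tau> \<one> {x \<in> carrier G. norm (?\<psi> x - 1) < \<epsilon>}" if "0 < \<epsilon>" for \<epsilon>
    proof (rule neighbourhood_in_openin)
      have "openin \<tau> {x \<in> topspace \<tau>. ?\<psi> x \<in> ball 1 \<epsilon>}"
        by (rule openin_continuous_map_preimage[OF c]) simp
      then show "openin \<tau> {x \<in> carrier G. norm (?\<psi> x - 1) < \<epsilon>}"
        by (simp add: top ball_def dist_norm norm_minus_commute)
      show "\<one> \<in> {x \<in> carrier G. norm (?\<psi> x - 1) < \<epsilon>}"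
        using that by (simp add: circle_character_one[OF \<psi>])
    qed
    then show "?\<psi> \<in> continuous_circle_characters G \<tau>"
      using \<psi> by (simp add: continuous_circle_characters_def)
  next
    assume c: "?\<psi> \<in> continuous_circle_characters G \<tau>"
    show "continuous_map \<tau> euclidean ?\<psi>"
      unfolding continuous_map_def
    proof (intro conjI allI impI)
      fix V :: "complex set" assume "openin euclidean V"
      then have V: "open V" by simp
      show "openin \<tau> {x \<in> topspace \<tau>. ?\<psi> x \<in> V}"
        unfolding group_topology_openin_iff[OF \<tau>] top
      proof (intro conjI ballI)
        fix x assume "x \<in> {x \<in> carrier G. ?\<psi> x \<in> V}"
        then have x: "x \<in> carrier G" "?\<psi> x \<in> V" by auto
        obtain \<epsilon> where \<epsilon>: "0 < \<epsilon>" "ball (?\<psi> x) \<epsilon> \<subseteq> V" using V x(2) open_contains_ball by blast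
        have "neighbourhood_in \<tau> \<one> {y \<in> carrier G. norm (?\<psi> y - 1) < \<epsilon>}"
          using c \<epsilon>(1) by (simp add: continuous_circle_characters_def)
        then show "neighbourhood_in \<tau> \<one> {y \<in> carrier G. x \<otimes> y \<in> {x \<in> carrier G. ?\<psi> x \<in> V}}"
        proof (rule neighbourhood_in_mono)
          show "{y \<in> carrier G. norm (?\<psi> y - 1) < \<epsilon>} \<subseteq> {y \<in> carrier G. x \<otimes> y \<in> {x \<in> carrier G. ?\<psi> x \<in> V}}"
          proof clarify
            fix y assume y: "y \<in> carrier G" "norm (?\<psi> y - 1) < \<epsilon>"
            then have "norm (?\<psi> (x \<otimes> y) - ?\<psi> x) < \<epsilon>"
              using circle_character_norm_diff[OF \<psi> x(1) y(1)] by simp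
            then have "?\<psi> (x \<otimes> y) \<in> V" using \<epsilon>(2) by (auto simp: ball_def dist_norm norm_minus_commute)
            then show "x \<otimes> y \<in> carrier G \<and> ?\<psi> (x \<otimes> y) \<in> V" using x y by simp
          qed
        qed (simp add: top Collect_subset subset_iff)
      qed auto
    qed simp
  qed
  finally show ?thesis .
qed

section \<open>Topologies generated by characters\<close>

definition bohr_base :: "('a, 'm) monoid_scheme \<Rightarrow> ('a \<Rightarrow> complex) set \<Rightarrow> 'a set set" where
  "bohr_base G X = {bohr_set G F \<epsilon> | F \<epsilon>. finite F \<and> F \<subseteq> X \<and> 0 < \<epsilon>}"

lemma bohr_baseI: "finite F \<Longrightarrow> F \<subseteq> X \<Longrightarrow> 0 < \<epsilon> \<Longrightarrow> bohr_set G F \<epsilon> \<in> bohr_base G X"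
  unfolding bohr_base_def by blast

definition bohr_topology :: "('a, 'm) monoid_scheme \<Rightarrow> ('a \<Rightarrow> complex) set \<Rightarrow> 'a topology" where
  "bohr_topology G X = unit_neighbourhood_base.base_topology G (bohr_base G X)"

context comm_group
begin

lemma bohr_set_mult:
  assumes F: "F \<subseteq> circle_characters G" and x: "x \<in> bohr_set G F \<delta>" and y: "y \<in> bohr_set G F \<epsilon>"
  shows "x \<otimes> y \<in> bohr_set G F (\<delta> + \<epsilon>)"
proof -
  have xy: "x \<in> carrier G" "y \<in> carrier G" using x y by (auto simp: bohr_set_def)
  have "norm (\<psi> (x \<otimes> y) - 1) < \<delta> + \<epsilon>" if \<psi>: "\<psi> \<in> F" for \<psi>
  proof -
    have "norm (\<psi> (x \<otimes> y) - 1) \<le> norm (\<psi> (x \<otimes> y) - \<psi> x) + norm (\<psi> x - 1)"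
      using norm_triangle_ineq[of "\<psi> (x \<otimes> y) - \<psi> x" "\<psi> x - 1"] by simp
    also have "norm (\<psi> (x \<otimes> y) - \<psi> x) = norm (\<psi> y - 1)"
      using F \<psi> xy by (intro circle_character_norm_diff) auto
    finally have "norm (\<psi> (x \<otimes> y) - 1) \<le> norm (\<psi> y - 1) + norm (\<psi> x - 1)" .
    moreover have "norm (\<psi> x - 1) < \<delta>" "norm (\<psi> y - 1) < \<epsilon>" using x y \<psi> by (auto simp: bohr_set_def)
    ultimately show ?thesis by linarith
  qed
  then show ?thesis using xy by (simp add: bohr_set_def)
qed

lemma bohr_set_inv:
  assumes F: "F \<subseteq> circle_characters G" and x: "x \<in> bohr_set G F \<epsilon>"
  shows "inv x \<in> bohr_set G F \<epsilon>"
proof -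
  have xc: "x \<in> carrier G" using x by (simp add: bohr_set_def)
  have "norm (\<psi> (inv x) - 1) < \<epsilon>" if "\<psi> \<in> F" for \<psi>
  proof -
    have "\<psi> (inv x) - 1 = cnj (\<psi> x - 1)" using F that xc by (simp add: circle_character_inv subset_iff)
    then show ?thesis using x that by (simp only: complex_mod_cnj) (simp add: bohr_set_def)
  qed
  then show ?thesis using xc by (simp add: bohr_set_def)
qed

lemma one_in_bohr_set: "F \<subseteq> circle_characters G \<Longrightarrow> 0 < \<epsilon> \<Longrightarrow> \<one> \<in> bohr_set G F \<epsilon>"
  by (auto simp: bohr_set_def circle_character_one subset_iff)

lemma unit_neighbourhood_base_bohr:
  assumes X: "X \<subseteq> circle_characters G"
  shows "unit_neighbourhood_base G (bohr_base G X)"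
proof
  have "bohr_set G {} 1 \<in> bohr_base G X" by (rule bohr_baseI) auto
  then show "bohr_base G X \<noteq> {}" by blast
  fix N assume "N \<in> bohr_base G X"
  then obtain F \<epsilon> where N: "N = bohr_set G F \<epsilon>" "finite F" "F \<subseteq> X" "0 < \<epsilon>"
    unfolding bohr_base_def by blast
  have FX: "F \<subseteq> circle_characters G" using N X by blast
  show "N \<subseteq> carrier G" by (auto simp: N bohr_set_def)
  show "\<one> \<in> N" unfolding N by (rule one_in_bohr_set[OF FX N(4)])
  show "\<exists>V\<in>bohr_base G X. \<forall>x\<in>V. \<forall>y\<in>V. x \<otimes> y \<in> N"
  proof (rule bexI)
    show "bohr_set G F (\<epsilon> / 2) \<in> bohr_base G X" using N by (intro bohr_baseI) auto
    show "\<forall>x\<in>bohr_set G F (\<epsilon> / 2). \<forall>y\<in>bohr_set G F (\<epsilon> / 2). x \<otimes> y \<in> N"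
      using bohr_set_mult[OF FX, of _ "\<epsilon> / 2" _ "\<epsilon> / 2"] by (simp add: N)
  qed
  show "\<exists>V\<in>bohr_base G X. \<forall>x\<in>V. inv x \<in> N"
    using bohr_set_inv[OF FX] \<open>N \<in> bohr_base G X\<close> N(1) by blast
  fix M assume "M \<in> bohr_base G X"
  then obtain F' \<epsilon>' where M: "M = bohr_set G F' \<epsilon>'" "finite F'" "F' \<subseteq> X" "0 < \<epsilon>'"
    unfolding bohr_base_def by blast
  show "\<exists>V\<in>bohr_base G X. V \<subseteq> M \<inter> N"
  proof (rule bexI)
    show "bohr_set G (F' \<union> F) (min \<epsilon>' \<epsilon>) \<in> bohr_base G X"
      using N M by (intro bohr_baseI) auto
    show "bohr_set G (F' \<union> F) (min \<epsilon>' \<epsilon>) \<subseteq> M \<inter> N" by (auto simp: N M bohr_set_def)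
  qed
qed

lemma group_topology_bohr:
  "X \<subseteq> circle_characters G \<Longrightarrow> group_topology G (bohr_topology G X)"
  unfolding bohr_topology_def
  by (rule unit_neighbourhood_base.group_topology_base_topology[OF unit_neighbourhood_base_bohr])

lemma neighbourhood_in_bohr_topology:
  assumes "X \<subseteq> circle_characters G"
  shows "neighbourhood_in (bohr_topology G X) \<one> N \<longleftrightarrow>
    N \<subseteq> carrier G \<and> (\<exists>F \<epsilon>. finite F \<and> F \<subseteq> X \<and> 0 < \<epsilon> \<and> bohr_set G F \<epsilon> \<subseteq> N)"
  unfolding bohr_topology_def
    unit_neighbourhood_base.neighbourhood_in_base_topology[OF unit_neighbourhood_base_bohr[OF assms]]
  by (auto simp: bohr_base_def)

lemma bohr_set_neighbourhood:
  assumes \<tau>: "group_topology G \<tau>" and F: "finite F" "F \<subseteq> continuous_circle_characters G \<tau>" and \<epsilon>: "0 < \<epsilon>"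
  shows "neighbourhood_in \<tau> \<one> (bohr_set G F \<epsilon>)"
  using F
proof (induction F rule: finite_induct)
  case empty
  have "openin \<tau> (carrier G)" using \<tau> openin_topspace[of \<tau>] by (simp add: group_topology_topspace)
  then show ?case by (simp add: bohr_set_def neighbourhood_in_openin)
next
  case (insert \<psi> F)
  have "bohr_set G (insert \<psi> F) \<epsilon> = {x \<in> carrier G. norm (\<psi> x - 1) < \<epsilon>} \<inter> bohr_set G F \<epsilon>"
    by (auto simp: bohr_set_def)
  moreover have "neighbourhood_in \<tau> \<one> {x \<in> carrier G. norm (\<psi> x - 1) < \<epsilon>}"
    using insert.prems \<epsilon> by (simp add: continuous_circle_characters_def)
  ultimately show ?case using insert by (simp add: neighbourhood_in_Int)
qed

lemma bohr_topology_coarser: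
  assumes \<tau>: "group_topology G \<tau>" and X: "X \<subseteq> continuous_circle_characters G \<tau>"
  shows "coarser (bohr_topology G X) \<tau>"
proof -
  have Xc: "X \<subseteq> circle_characters G" using X by (auto simp: continuous_circle_characters_def)
  show ?thesis
  proof (rule group_topology_coarserI[OF group_topology_bohr[OF Xc] \<tau>])
    fix N assume "neighbourhood_in (bohr_topology G X) \<one> N"
    then obtain F \<epsilon> where N: "N \<subseteq> carrier G" and F: "finite F" "F \<subseteq> X" "0 < \<epsilon>" "bohr_set G F \<epsilon> \<subseteq> N"
      unfolding neighbourhood_in_bohr_topology[OF Xc] by blast
    have "neighbourhood_in \<tau> \<one> (bohr_set G F \<epsilon>)"
      using F X by (intro bohr_set_neighbourhood[OF \<tau>]) auto
    then show "neighbourhood_in \<tau> \<one> N"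
      using F(4) N \<tau> by (rule_tac neighbourhood_in_mono) (auto simp: group_topology_topspace)
  qed
qed

lemma bohr_topology_continuous:
  assumes X: "X \<subseteq> circle_characters G"
  shows "X \<subseteq> continuous_circle_characters G (bohr_topology G X)"
proof
  fix \<psi> assume \<psi>: "\<psi> \<in> X"
  have "neighbourhood_in (bohr_topology G X) \<one> {x \<in> carrier G. norm (\<psi> x - 1) < \<epsilon>}" if "0 < \<epsilon>" for \<epsilon>
    unfolding neighbourhood_in_bohr_topology[OF X]
    using \<psi> that by (auto intro!: exI[of _ "{\<psi>}"] exI[of _ \<epsilon>] simp: bohr_set_def)
  then show "\<psi> \<in> continuous_circle_characters G (bohr_topology G X)"
    using \<psi> X by (auto simp: continuous_circle_characters_def)
qed

text \<open>
  Elements are coloured by the points of a finite net of the circle near their values under the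
  characters in \<open>F\<close>. There are finitely many colours, and elements of the same colour differ by an
  element of the Bohr set.
\<close>

lemma bohr_set_syndetic:
  assumes F: "finite F" "F \<subseteq> circle_characters G" and \<epsilon>: "0 < \<epsilon>"
  shows "\<exists>E. finite E \<and> E \<subseteq> carrier G \<and> E <#> bohr_set G F \<epsilon> = carrier G"
proof -
  have "compact (sphere (0::complex) 1)" by simp
  then obtain T where T: "finite T" "sphere (0::complex) 1 \<subseteq> (\<Union>t\<in>T. ball t (\<epsilon> / 2))"
    unfolding compact_eq_totally_bounded using \<epsilon> by (meson half_gt_zero)
  then have "\<forall>z\<in>sphere (0::complex) 1. \<exists>t\<in>T. dist t z < \<epsilon> / 2" by (auto simp: subset_iff)
  then obtain q where q: "\<And>z. z \<in> sphere (0::complex) 1 \<Longrightarrow> q z \<in> T \<and> dist (q z) z < \<epsilon> / 2" by metis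
  define col where "col x = (\<lambda>\<psi>\<in>F. q (\<psi> x))" for x
  have sph: "\<psi> x \<in> sphere 0 1" if "\<psi> \<in> F" "x \<in> carrier G" for \<psi> x
    using F that circle_character_norm[of \<psi> G x] by auto
  have "col ` carrier G \<subseteq> F \<rightarrow>\<^sub>E T" using q sph by (auto simp: col_def)
  moreover have "finite (F \<rightarrow>\<^sub>E T)" using F T by (intro finite_PiE) auto
  ultimately have fin: "finite (col ` carrier G)" by (rule finite_subset)
  \<comment> \<open>one representative for each colour that occurs\<close>
  define r where "r c = (SOME x. x \<in> carrier G \<and> col x = c)" for c
  have r: "r (col x) \<in> carrier G \<and> col (r (col x)) = col x" if "x \<in> carrier G" for x
    unfolding r_def by (rule someI[of _ x]) (use that in simp)
  define E where "E = r ` col ` carrier G"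
  have "x \<in> E <#> bohr_set G F \<epsilon>" if x: "x \<in> carrier G" for x
  proof -
    let ?a = "r (col x)"
    have a: "?a \<in> carrier G" "col ?a = col x" using r[OF x] by auto
    have ax: "?a \<otimes> (inv ?a \<otimes> x) = x" using a x by (simp add: m_assoc[symmetric])
    have "inv ?a \<otimes> x \<in> bohr_set G F \<epsilon>"
      unfolding bohr_set_def
    proof (intro CollectI conjI ballI)
      show "inv ?a \<otimes> x \<in> carrier G" using a x by simp
      fix \<psi> assume \<psi>: "\<psi> \<in> F"
      have "norm (\<psi> (inv ?a \<otimes> x) - 1) = norm (\<psi> (?a \<otimes> (inv ?a \<otimes> x)) - \<psi> ?a)"
        using F \<psi> a x by (intro circle_character_norm_diff[symmetric]) auto
      also have "\<dots> = dist (\<psi> x) (\<psi> ?a)" by (simp add: ax dist_norm)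
      also have "\<dots> \<le> dist (q (\<psi> x)) (\<psi> x) + dist (q (\<psi> x)) (\<psi> ?a)" by (rule dist_triangle3)
      also have "q (\<psi> x) = q (\<psi> ?a)"
        using fun_cong[OF a(2), of \<psi>] \<psi> by (simp add: col_def)
      finally show "norm (\<psi> (inv ?a \<otimes> x) - 1) < \<epsilon>"
        using q[OF sph[OF \<psi> x]] q[OF sph[OF \<psi> a(1)]] \<open>q (\<psi> x) = q (\<psi> ?a)\<close> by simp
    qed
    moreover have "?a \<in> E" using x by (auto simp: E_def)
    ultimately have "?a \<otimes> (inv ?a \<otimes> x) \<in> E <#> bohr_set G F \<epsilon>" unfolding set_mult_def by blast
    then show ?thesis by (simp only: ax)
  qed
  moreover have Ec: "E \<subseteq> carrier G" using r by (auto simp: E_def)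
  moreover have "E <#> bohr_set G F \<epsilon> \<subseteq> carrier G"
    using Ec by (intro set_mult_closed) (auto simp: bohr_set_def)
  ultimately show ?thesis using fin by (intro exI[of _ E]) (auto simp: E_def)
qed

lemma precompact_bohr_topology:
  assumes X: "X \<subseteq> circle_characters G"
    and sep: "\<And>x. x \<in> carrier G \<Longrightarrow> x \<noteq> \<one> \<Longrightarrow> \<exists>\<psi>\<in>X. \<psi> x \<noteq> 1"
  shows "precompact_topology G (bohr_topology G X)"
  unfolding precompact_topology_def
proof (intro conjI allI impI)
  show gt: "group_topology G (bohr_topology G X)" by (rule group_topology_bohr[OF X])
  show "Hausdorff_space (bohr_topology G X)"
    unfolding group_topology_Hausdorff_iff[OF gt]
  proof (intro ballI impI)
    fix x assume x: "x \<in> carrier G" "x \<noteq> \<one>"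
    then obtain \<psi> where \<psi>: "\<psi> \<in> X" "\<psi> x \<noteq> 1" using sep by blast
    let ?N = "bohr_set G {\<psi>} (norm (\<psi> x - 1))"
    have "neighbourhood_in (bohr_topology G X) \<one> ?N"
      unfolding neighbourhood_in_bohr_topology[OF X]
      using \<psi> by (intro conjI exI[of _ "{\<psi>}"] exI[of _ "norm (\<psi> x - 1)"]) (auto simp: bohr_set_def)
    moreover have "x \<notin> ?N" by (simp add: bohr_set_def)
    ultimately show "\<exists>N. neighbourhood_in (bohr_topology G X) \<one> N \<and> x \<notin> N" by blast
  qed
  fix U assume "neighbourhood_in (bohr_topology G X) \<one> U"
  then obtain F \<epsilon> where U: "U \<subseteq> carrier G" and F: "finite F" "F \<subseteq> X" "0 < \<epsilon>" "bohr_set G F \<epsilon> \<subseteq> U"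
    unfolding neighbourhood_in_bohr_topology[OF X] by blast
  obtain E where E: "finite E" "E \<subseteq> carrier G" "E <#> bohr_set G F \<epsilon> = carrier G"
    using bohr_set_syndetic[of F \<epsilon>] F X by blast
  have "E <#> bohr_set G F \<epsilon> \<subseteq> E <#> U" using F(4) unfolding set_mult_def by blast
  moreover have "E <#> U \<subseteq> carrier G" using E U by (intro set_mult_closed)
  ultimately have "E <#> U = carrier G" using E(3) by blast
  then show "\<exists>F. finite F \<and> F \<subseteq> carrier G \<and> F <#> U = carrier G" using E by blast
qed

theorem precompact_neighbourhood_contains_bohr_set:
  assumes \<tau>: "precompact_topology G \<tau>" and N: "neighbourhood_in \<tau> \<one> N"
  obtains F where "finite F" "F \<subseteq> continuous_circle_characters G \<tau>" "bohr_set G F 1 \<subseteq> N"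
proof -
  have gt: "group_topology G \<tau>" using \<tau> by (simp add: precompact_topology_def)
  obtain U where U: "neighbourhood_sequence G U" "U 0 \<subseteq> N" and nb: "\<And>n. neighbourhood_in \<tau> \<one> (U n)"
    by (rule group_topology_sequence[OF gt N]) (rule that)
  have synd: "\<exists>F. finite F \<and> F \<subseteq> carrier G \<and> F <#> U n = carrier G" for n
    using \<tau> nb by (simp add: precompact_topology_def)
  obtain \<Psi> where \<Psi>: "finite \<Psi>" "\<Psi> \<subseteq> circle_characters G"
    and cont: "\<And>\<psi> \<epsilon>. \<psi> \<in> \<Psi> \<Longrightarrow> 0 < \<epsilon> \<Longrightarrow> \<exists>n. \<forall>x\<in>U n. norm (\<psi> x - 1) < \<epsilon>"
    and inside: "bohr_set G \<Psi> 1 \<subseteq> U 0"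
    by (rule characters_of_neighbourhood_sequence[OF U(1) synd]) (rule that)
  have "\<Psi> \<subseteq> continuous_circle_characters G \<tau>"
  proof
    fix \<psi> assume \<psi>: "\<psi> \<in> \<Psi>"
    have "neighbourhood_in \<tau> \<one> {x \<in> carrier G. norm (\<psi> x - 1) < \<epsilon>}" if \<epsilon>: "0 < \<epsilon>" for \<epsilon>
    proof -
      obtain n where n: "\<forall>x\<in>U n. norm (\<psi> x - 1) < \<epsilon>" using cont[OF \<psi> \<epsilon>] by blast
      show ?thesis
        using n neighbourhood_in_subset[OF nb[of n]]
        by (intro neighbourhood_in_mono[OF nb[of n]]) (auto simp: group_topology_topspace[OF gt])
    qed
    then show "\<psi> \<in> continuous_circle_characters G \<tau>"
      using \<psi> \<Psi> by (auto simp: continuous_circle_characters_def)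
  qed
  moreover have "bohr_set G \<Psi> 1 \<subseteq> N" using inside U(2) by blast
  ultimately show thesis using \<Psi>(1) that by blast
qed

text \<open>
  Bohr sets of continuous characters are neighbourhoods of the unit for every group topology;
  precompactness puts one of them inside every neighbourhood.
\<close>

corollary precompact_eq_bohr_topology:
  assumes \<tau>: "precompact_topology G \<tau>"
  shows "\<tau> = bohr_topology G (continuous_circle_characters G \<tau>)"
proof (rule coarser_antisym)
  let ?X = "continuous_circle_characters G \<tau>"
  have gt: "group_topology G \<tau>" using \<tau> by (simp add: precompact_topology_def)
  have X: "?X \<subseteq> circle_characters G" by (auto simp: continuous_circle_characters_def)
  show "coarser (bohr_topology G ?X) \<tau>" by (rule bohr_topology_coarser[OF gt order_refl])
  show "coarser \<tau> (bohr_topology G ?X)"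
  proof (rule group_topology_coarserI[OF gt group_topology_bohr[OF X]])
    fix N assume N: "neighbourhood_in \<tau> \<one> N"
    obtain F where "finite F" "F \<subseteq> ?X" "bohr_set G F 1 \<subseteq> N"
      by (rule precompact_neighbourhood_contains_bohr_set[OF \<tau> N])
    then show "neighbourhood_in (bohr_topology G ?X) \<one> N"
      unfolding neighbourhood_in_bohr_topology[OF X]
      using neighbourhood_in_subset[OF N]
      by (intro conjI exI[of _ F] exI[of _ "1::real"]) (simp_all add: group_topology_topspace[OF gt])
  qed
qed

text \<open>
  Among the group topologies that make the given characters continuous, the one generated by Bohr sets
  is coarser than all others, so the definite description denotes it.
\<close>

theorem bohr_modification_eq:
  assumes \<tau>: "group_topology G \<tau>"
  shows "bohr_modification G \<tau> = bohr_topology G (continuous_circle_characters G \<tau>)"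
proof -
  let ?X = "continuous_circle_characters G \<tau>"
  have X: "?X \<subseteq> circle_characters G" by (auto simp: continuous_circle_characters_def)
  have iff: "(\<forall>\<phi>\<in>continuous_characters G \<tau>. continuous_map \<sigma> torus_topology \<phi>) \<longleftrightarrow>
      ?X \<subseteq> continuous_circle_characters G \<sigma>" if \<sigma>: "group_topology G \<sigma>" for \<sigma>
  proof
    assume L: "\<forall>\<phi>\<in>continuous_characters G \<tau>. continuous_map \<sigma> torus_topology \<phi>"
    show "?X \<subseteq> continuous_circle_characters G \<sigma>"
    proof
      fix \<psi> assume \<psi>: "\<psi> \<in> ?X"
      then obtain \<phi> where \<phi>: "\<phi> \<in> hom G torus \<inter> extensional (carrier G)" "circle_lift G \<phi> = \<psi>"
        using circle_lift_surj X by blast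
      have "continuous_map \<tau> torus_topology \<phi>"
        using \<phi> \<psi> continuous_map_circle_lift_iff[OF \<tau>, of \<phi>] by simp
      then have "continuous_map \<sigma> torus_topology \<phi>"
        using L \<phi>(1) by (simp add: continuous_characters_def)
      then show "\<psi> \<in> continuous_circle_characters G \<sigma>"
        using \<phi> continuous_map_circle_lift_iff[OF \<sigma>, of \<phi>] by simp
    qed
  next
    assume R: "?X \<subseteq> continuous_circle_characters G \<sigma>"
    show "\<forall>\<phi>\<in>continuous_characters G \<tau>. continuous_map \<sigma> torus_topology \<phi>"
    proof
      fix \<phi> assume "\<phi> \<in> continuous_characters G \<tau>"
      then have \<phi>: "\<phi> \<in> hom G torus" "continuous_map \<tau> torus_topology \<phi>"
        by (auto simp: continuous_characters_def)
      then show "continuous_map \<sigma> torus_topology \<phi>"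
        using R continuous_map_circle_lift_iff[OF \<tau>] continuous_map_circle_lift_iff[OF \<sigma>] by blast
    qed
  qed
  let ?P = "\<lambda>\<sigma>. group_topology G \<sigma> \<and>
        (\<forall>\<phi>\<in>continuous_characters G \<tau>. continuous_map \<sigma> torus_topology \<phi>)"
  have P: "?P (bohr_topology G ?X)"
    using iff group_topology_bohr[OF X] bohr_topology_continuous[OF X] by simp
  have least: "coarser (bohr_topology G ?X) \<sigma>" if "?P \<sigma>" for \<sigma>
  proof (rule bohr_topology_coarser)
    show \<sigma>: "group_topology G \<sigma>" using that by (rule conjunct1)
    show "?X \<subseteq> continuous_circle_characters G \<sigma>" by (rule iffD1[OF iff[OF \<sigma>] conjunct2[OF that]])
  qed
  have "(THE \<sigma>. ?P \<sigma> \<and> (\<forall>\<sigma>'. ?P \<sigma>' \<longrightarrow> coarser \<sigma> \<sigma>')) = bohr_topology G ?X"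
  proof (rule the_equality)
    show "?P (bohr_topology G ?X) \<and> (\<forall>\<sigma>'. ?P \<sigma>' \<longrightarrow> coarser (bohr_topology G ?X) \<sigma>')"
      using P least by blast
    show "\<sigma> = bohr_topology G ?X" if "?P \<sigma> \<and> (\<forall>\<sigma>'. ?P \<sigma>' \<longrightarrow> coarser \<sigma> \<sigma>')" for \<sigma>
      using that P least[of \<sigma>] coarser_antisym by blast
  qed
  then show ?thesis by (simp add: bohr_modification_def conj_assoc)
qed

end

section \<open>Precompact extensions from a subgroup\<close>

context comm_group
begin

lemma unit_neighbourhood_base_subgroup:
  assumes H: "subgroup H G" and \<zeta>: "group_topology (G\<lparr>carrier := H\<rparr>) \<zeta>"
  shows "unit_neighbourhood_base G {N. neighbourhood_in \<zeta> \<one> N}"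
proof -
  interpret K: comm_group "G\<lparr>carrier := H\<rparr>" by (rule subgroup_is_comm_group[OF H])
  have top: "topspace \<zeta> = H" using K.group_topology_topspace[OF \<zeta>] by simp
  have HG: "H \<subseteq> carrier G" by (rule subgroup.subset[OF H])
  show ?thesis
  proof
    have "openin \<zeta> H" using openin_topspace[of \<zeta>] top by simp
    then show "{N. neighbourhood_in \<zeta> \<one> N} \<noteq> {}"
      using neighbourhood_in_openin[of \<zeta> H \<one>] subgroup.one_closed[OF H] by blast
    fix N assume "N \<in> {N. neighbourhood_in \<zeta> \<one> N}"
    then have N: "neighbourhood_in \<zeta> \<one> N" by simp
    show "N \<subseteq> carrier G" using neighbourhood_in_subset[OF N] top HG by simp
    show "\<one> \<in> N" by (rule neighbourhood_in_mem[OF N])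
    show "\<exists>V\<in>{N. neighbourhood_in \<zeta> \<one> N}. V \<subseteq> M \<inter> N" if "M \<in> {N. neighbourhood_in \<zeta> \<one> N}" for M
      using neighbourhood_in_Int[of \<zeta> \<one> M N] that N by blast
    obtain V where "neighbourhood_in \<zeta> \<one> V" "\<And>x y. x \<in> V \<Longrightarrow> y \<in> V \<Longrightarrow> x \<otimes> y \<in> N"
      using K.group_topology_square[OF \<zeta>, of N] N by auto
    then show "\<exists>V\<in>{N. neighbourhood_in \<zeta> \<one> N}. \<forall>x\<in>V. \<forall>y\<in>V. x \<otimes> y \<in> N" by blast
    have "neighbourhood_in \<zeta> \<one> {x \<in> H. inv\<^bsub>G\<lparr>carrier := H\<rparr>\<^esub> x \<in> N}"
      using K.group_topology_inverse[OF \<zeta>, of N] N by simp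
    moreover have "\<forall>x\<in>{x \<in> H. inv\<^bsub>G\<lparr>carrier := H\<rparr>\<^esub> x \<in> N}. inv x \<in> N"
      using m_inv_consistent[OF H] by auto
    ultimately show "\<exists>V\<in>{N. neighbourhood_in \<zeta> \<one> N}. \<forall>x\<in>V. inv x \<in> N" by blast
  qed
qed

text \<open>
  The neighbourhoods of the unit in \<open>H\<close> form a base of neighbourhoods of the unit in \<open>G\<close>. A group
  topology is determined by its neighbourhoods of the unit, so the definite description denotes the
  topology with this base.
\<close>

lemma extension_topology_properties:
  assumes H: "subgroup H G" and \<zeta>: "group_topology (G\<lparr>carrier := H\<rparr>) \<zeta>" "Hausdorff_space \<zeta>"
  shows "group_topology G (extension_topology G \<zeta>)"
    and "neighbourhood_in (extension_topology G \<zeta>) \<one> M \<longleftrightarrow>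
      M \<subseteq> carrier G \<and> (\<exists>N. neighbourhood_in \<zeta> \<one> N \<and> N \<subseteq> M)"
proof -
  interpret K: comm_group "G\<lparr>carrier := H\<rparr>" by (rule subgroup_is_comm_group[OF H])
  interpret B: unit_neighbourhood_base G "{N. neighbourhood_in \<zeta> \<one> N}"
    by (rule unit_neighbourhood_base_subgroup[OF H \<zeta>(1)])
  have top: "topspace \<zeta> = H" using K.group_topology_topspace[OF \<zeta>(1)] by simp
  have HG: "H \<subseteq> carrier G" by (rule subgroup.subset[OF H])
  let ?P = "\<lambda>\<sigma>. group_topology G \<sigma> \<and> Hausdorff_space \<sigma> \<and>
        (\<forall>N. neighbourhood_in \<zeta> \<one> N \<longrightarrow> neighbourhood_in \<sigma> \<one> N) \<and>
        (\<forall>M. neighbourhood_in \<sigma> \<one> M \<longrightarrow> (\<exists>N. neighbourhood_in \<zeta> \<one> N \<and> N \<subseteq> M))"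
  have nb: "neighbourhood_in B.base_topology \<one> M \<longleftrightarrow>
      M \<subseteq> carrier G \<and> (\<exists>N. neighbourhood_in \<zeta> \<one> N \<and> N \<subseteq> M)" for M
    by (simp add: B.neighbourhood_in_base_topology)
  have sub: "neighbourhood_in B.base_topology \<one> N" if "neighbourhood_in \<zeta> \<one> N" for N
  proof -
    have "N \<subseteq> carrier G" using neighbourhood_in_subset[OF that] top HG by simp
    then show ?thesis unfolding nb using that by blast
  qed
  have gt: "group_topology G B.base_topology" by (rule B.group_topology_base_topology)
  have "Hausdorff_space B.base_topology"
    unfolding group_topology_Hausdorff_iff[OF gt]
  proof (intro ballI impI)
    fix x assume x: "x \<in> carrier G" "x \<noteq> \<one>"
    have "\<exists>N. neighbourhood_in \<zeta> \<one> N \<and> x \<notin> N"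
    proof (cases "x \<in> H")
      case True
      then show ?thesis using K.group_topology_Hausdorff_iff[OF \<zeta>(1)] \<zeta>(2) x by simp
    next
      case False
      have "neighbourhood_in \<zeta> \<one> H"
        using openin_topspace[of \<zeta>] top subgroup.one_closed[OF H] by (intro neighbourhood_in_openin) auto
      then show ?thesis using False by blast
    qed
    then show "\<exists>N. neighbourhood_in B.base_topology \<one> N \<and> x \<notin> N"
      using sub by blast
  qed
  then have P: "?P B.base_topology" using gt nb sub by simp
  have "\<sigma> = B.base_topology" if \<sigma>: "?P \<sigma>" for \<sigma>
  proof (rule group_topology_eqI)
    show "group_topology G \<sigma>" "group_topology G B.base_topology" using \<sigma> gt by auto
    then have top\<sigma>: "topspace \<sigma> = carrier G" by (simp add: group_topology_topspace)
    show "neighbourhood_in \<sigma> \<one> N \<longleftrightarrow> neighbourhood_in B.base_topology \<one> N" for N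
    proof
      assume N: "neighbourhood_in \<sigma> \<one> N"
      have "N \<subseteq> carrier G" using neighbourhood_in_subset[OF N] top\<sigma> by simp
      moreover have "\<exists>M. neighbourhood_in \<zeta> \<one> M \<and> M \<subseteq> N" using \<sigma> N by blast
      ultimately show "neighbourhood_in B.base_topology \<one> N" using nb by blast
    next
      assume "neighbourhood_in B.base_topology \<one> N"
      then obtain M where M: "N \<subseteq> carrier G" "neighbourhood_in \<zeta> \<one> M" "M \<subseteq> N" using nb by blast
      have "neighbourhood_in \<sigma> \<one> M" using \<sigma> M(2) by simp
      then show "neighbourhood_in \<sigma> \<one> N"
        by (rule neighbourhood_in_mono[OF _ M(3)]) (simp add: M(1) top\<sigma>)
    qed
  qed
  then have "extension_topology G \<zeta> = B.base_topology"
    unfolding extension_topology_def using P by (intro the_equality) blast+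
  then show "group_topology G (extension_topology G \<zeta>)"
    "neighbourhood_in (extension_topology G \<zeta>) \<one> M \<longleftrightarrow>
      M \<subseteq> carrier G \<and> (\<exists>N. neighbourhood_in \<zeta> \<one> N \<and> N \<subseteq> M)"
    using gt nb by simp_all
qed

end

text \<open>
  The preimage of the dual of \<open>(H, \<zeta>)\<close> under the restriction of characters from \<open>G\<close> to \<open>H\<close>.
\<close>

definition characters_continuous_on ::
    "('a, 'm) monoid_scheme \<Rightarrow> 'a set \<Rightarrow> 'a topology \<Rightarrow> ('a \<Rightarrow> complex) set" where
  "characters_continuous_on G H \<zeta> = {\<psi> \<in> circle_characters G.
     restrict \<psi> H \<in> continuous_circle_characters (G\<lparr>carrier := H\<rparr>) \<zeta>}"

context comm_group
begin

lemma characters_continuous_on_subset: "characters_continuous_on G H \<zeta> \<subseteq> circle_characters G"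
  by (auto simp: characters_continuous_on_def)

lemma restrict_circle_character:
  assumes H: "subgroup H G" and \<psi>: "\<psi> \<in> circle_characters G"
  shows "restrict \<psi> H \<in> circle_characters (G\<lparr>carrier := H\<rparr>)"
  using \<psi> subgroup.mem_carrier[OF H] subgroup.m_closed[OF H] by (auto simp: circle_characters_def)

lemma characters_continuous_on_iff:
  assumes H: "subgroup H G"
  shows "\<psi> \<in> characters_continuous_on G H \<zeta> \<longleftrightarrow> \<psi> \<in> circle_characters G \<and>
    (\<forall>\<epsilon>>0. neighbourhood_in \<zeta> \<one> {x \<in> H. norm (\<psi> x - 1) < \<epsilon>})"
proof -
  have "{x \<in> H. norm (restrict \<psi> H x - 1) < \<epsilon>} = {x \<in> H. norm (\<psi> x - 1) < \<epsilon>}" for \<epsilon> by auto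
  then show ?thesis
    using restrict_circle_character[OF H]
    by (auto simp: characters_continuous_on_def continuous_circle_characters_def)
qed

text \<open>
  Neighbourhoods of the unit in \<open>H\<close> are neighbourhoods in \<open>G\<close>, so continuity is decided on \<open>H\<close>.
\<close>

lemma characters_of_extension_topology:
  assumes H: "subgroup H G" and \<zeta>: "group_topology (G\<lparr>carrier := H\<rparr>) \<zeta>" "Hausdorff_space \<zeta>"
  shows "continuous_circle_characters G (extension_topology G \<zeta>) = characters_continuous_on G H \<zeta>"
proof -
  interpret K: comm_group "G\<lparr>carrier := H\<rparr>" by (rule subgroup_is_comm_group[OF H])
  have top: "topspace \<zeta> = H" using K.group_topology_topspace[OF \<zeta>(1)] by simp
  have HG: "H \<subseteq> carrier G" by (rule subgroup.subset[OF H])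
  have "neighbourhood_in (extension_topology G \<zeta>) \<one> {x \<in> carrier G. P x} \<longleftrightarrow>
      neighbourhood_in \<zeta> \<one> {x \<in> H. P x}" for P
  proof
    assume "neighbourhood_in (extension_topology G \<zeta>) \<one> {x \<in> carrier G. P x}"
    then obtain N where N: "neighbourhood_in \<zeta> \<one> N" "N \<subseteq> {x \<in> carrier G. P x}"
      unfolding extension_topology_properties(2)[OF H \<zeta>] by blast
    have "N \<subseteq> H" using neighbourhood_in_subset[OF N(1)] top by simp
    then show "neighbourhood_in \<zeta> \<one> {x \<in> H. P x}"
      using N top by (intro neighbourhood_in_mono[OF N(1)]) auto
  next
    assume "neighbourhood_in \<zeta> \<one> {x \<in> H. P x}"
    then show "neighbourhood_in (extension_topology G \<zeta>) \<one> {x \<in> carrier G. P x}"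
      unfolding extension_topology_properties(2)[OF H \<zeta>] using HG by blast
  qed
  then show ?thesis
    by (auto simp: continuous_circle_characters_def characters_continuous_on_iff[OF H])
qed

lemma group_topology_subtopology:
  assumes H: "subgroup H G" and \<tau>: "group_topology G \<tau>"
  shows "group_topology (G\<lparr>carrier := H\<rparr>) (subtopology \<tau> H)"
proof -
  have HG: "H \<subseteq> carrier G" by (rule subgroup.subset[OF H])
  have top: "topspace (subtopology \<tau> H) = H"
    using HG by (auto simp: group_topology_topspace[OF \<tau>])
  have m: "continuous_map (prod_topology \<tau> \<tau>) \<tau> (\<lambda>(x, y). x \<otimes> y)" and i: "continuous_map \<tau> \<tau> (\<lambda>x. inv x)"
    using \<tau> by (auto simp: group_topology_def)
  have "continuous_map (prod_topology (subtopology \<tau> H) (subtopology \<tau> H)) (subtopology \<tau> H) (\<lambda>(x, y). x \<otimes> y)"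
  proof (rule continuous_map_into_subtopology)
    show "continuous_map (prod_topology (subtopology \<tau> H) (subtopology \<tau> H)) \<tau> (\<lambda>(x, y). x \<otimes> y)"
      unfolding prod_topology_subtopology by (intro continuous_map_from_subtopology m)
  qed (auto simp: top subgroup.m_closed[OF H])
  moreover have "continuous_map (subtopology \<tau> H) (subtopology \<tau> H) (\<lambda>x. inv x)"
    using subgroup.m_inv_closed[OF H]
    by (intro continuous_map_into_subtopology continuous_map_from_subtopology i) (auto simp: top)
  then have "continuous_map (subtopology \<tau> H) (subtopology \<tau> H) (\<lambda>x. inv\<^bsub>G\<lparr>carrier := H\<rparr>\<^esub> x)"
    by (rule continuous_map_eq) (simp add: top m_inv_consistent[OF H])
  ultimately show ?thesis by (simp add: group_topology_def top del: topspace_subtopology)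
qed

lemma restrict_continuous_character:
  assumes H: "subgroup H G" and \<tau>: "group_topology G \<tau>" and \<psi>: "\<psi> \<in> continuous_circle_characters G \<tau>"
  shows "\<psi> \<in> characters_continuous_on G H (subtopology \<tau> H)"
  unfolding characters_continuous_on_iff[OF H]
proof (intro conjI allI impI)
  show "\<psi> \<in> circle_characters G" using \<psi> by (simp add: continuous_circle_characters_def)
  fix \<epsilon> :: real assume "0 < \<epsilon>"
  then have "neighbourhood_in \<tau> \<one> {x \<in> carrier G. norm (\<psi> x - 1) < \<epsilon>}"
    using \<psi> by (simp add: continuous_circle_characters_def)
  then show "neighbourhood_in (subtopology \<tau> H) \<one> {x \<in> H. norm (\<psi> x - 1) < \<epsilon>}"
    using subgroup.subset[OF H] subgroup.one_closed[OF H]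
    by (subst neighbourhood_in_subtopology) (auto simp: group_topology_topspace[OF \<tau>])
qed

lemma bohr_set_subgroup:
  assumes H: "subgroup H G"
  shows "bohr_set G F \<epsilon> \<inter> H = bohr_set (G\<lparr>carrier := H\<rparr>) ((\<lambda>\<psi>. restrict \<psi> H) ` F) \<epsilon>"
  using subgroup.subset[OF H] by (auto simp: bohr_set_def)

text \<open>
  A finite set whose translates of a neighbourhood cover \<open>G\<close> need not lie in \<open>H\<close>. Bohr sets of \<open>G\<close>,
  however, meet \<open>H\<close> in Bohr sets of \<open>H\<close>, for which the translations can be chosen in \<open>H\<close>.
\<close>

lemma precompact_subtopology:
  assumes H: "subgroup H G" and \<tau>: "precompact_topology G \<tau>"
  shows "precompact_topology (G\<lparr>carrier := H\<rparr>) (subtopology \<tau> H)"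
  unfolding precompact_topology_def
proof (intro conjI allI impI)
  interpret K: comm_group "G\<lparr>carrier := H\<rparr>" by (rule subgroup_is_comm_group[OF H])
  have gt: "group_topology G \<tau>" and haus: "Hausdorff_space \<tau>" using \<tau> by (auto simp: precompact_topology_def)
  have HG: "H \<subseteq> topspace \<tau>" using subgroup.subset[OF H] by (simp add: group_topology_topspace[OF gt])
  show "group_topology (G\<lparr>carrier := H\<rparr>) (subtopology \<tau> H)" by (rule group_topology_subtopology[OF H gt])
  show "Hausdorff_space (subtopology \<tau> H)" using haus by (rule Hausdorff_space_subtopology)
  fix U assume "neighbourhood_in (subtopology \<tau> H) \<one>\<^bsub>G\<lparr>carrier := H\<rparr>\<^esub> U"
  then obtain M where U: "U \<subseteq> H" and M: "neighbourhood_in \<tau> \<one> M" "M \<inter> H \<subseteq> U"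
    using neighbourhood_in_subtopology[OF HG subgroup.one_closed[OF H]] by auto
  obtain F where F: "finite F" "F \<subseteq> continuous_circle_characters G \<tau>" "bohr_set G F 1 \<subseteq> M"
    by (rule precompact_neighbourhood_contains_bohr_set[OF \<tau> M(1)])
  let ?F = "(\<lambda>\<psi>. restrict \<psi> H) ` F"
  have "?F \<subseteq> circle_characters (G\<lparr>carrier := H\<rparr>)"
    using F(2) restrict_circle_character[OF H] by (auto simp: continuous_circle_characters_def)
  then obtain E where E: "finite E" "E \<subseteq> H"
    "E <#>\<^bsub>G\<lparr>carrier := H\<rparr>\<^esub> bohr_set (G\<lparr>carrier := H\<rparr>) ?F 1 = H"
    using K.bohr_set_syndetic[of ?F 1] F(1) by auto
  have "bohr_set (G\<lparr>carrier := H\<rparr>) ?F 1 \<subseteq> U" using F(3) M(2) bohr_set_subgroup[OF H, of F 1] by blast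
  then have "H \<subseteq> E <#>\<^bsub>G\<lparr>carrier := H\<rparr>\<^esub> U" using E(3) unfolding set_mult_def by blast
  moreover have "E <#>\<^bsub>G\<lparr>carrier := H\<rparr>\<^esub> U \<subseteq> H" using K.set_mult_closed[of E U] E(2) U by simp
  ultimately show "\<exists>E. finite E \<and> E \<subseteq> carrier (G\<lparr>carrier := H\<rparr>) \<and>
      E <#>\<^bsub>G\<lparr>carrier := H\<rparr>\<^esub> U = carrier (G\<lparr>carrier := H\<rparr>)"
    using E by auto
qed

text \<open>
  The characters of \<open>G\<close> that are continuous on \<open>H\<close> separate points: those outside \<open>H\<close> because
  characters that are trivial on \<open>H\<close> are among them, those of \<open>H\<close> because all continuous characters of \<open>H\<close>
  extend to \<open>G\<close>. The extensions also show that the topology restricts to \<open>\<zeta>\<close>. A precompact extension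
  of \<open>\<zeta>\<close> is generated by its continuous characters, which are all continuous on \<open>H\<close>, so it is
  coarser.
\<close>

theorem finest_precompact_extension_bohr:
  assumes H: "subgroup H G" and \<zeta>: "precompact_topology (G\<lparr>carrier := H\<rparr>) \<zeta>"
  shows "finest_precompact_extension G H \<zeta> (bohr_topology G (characters_continuous_on G H \<zeta>))"
  unfolding finest_precompact_extension_def
proof (intro conjI allI impI)
  interpret K: comm_group "G\<lparr>carrier := H\<rparr>" by (rule subgroup_is_comm_group[OF H])
  let ?X = "characters_continuous_on G H \<zeta>" and ?C = "continuous_circle_characters (G\<lparr>carrier := H\<rparr>) \<zeta>"
  let ?\<sigma> = "bohr_topology G ?X"
  have X: "?X \<subseteq> circle_characters G" by (rule characters_continuous_on_subset)
  have \<zeta>gt: "group_topology (G\<lparr>carrier := H\<rparr>) \<zeta>" and haus: "Hausdorff_space \<zeta>"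
    using \<zeta> by (auto simp: precompact_topology_def)
  have top: "topspace \<zeta> = H" using K.group_topology_topspace[OF \<zeta>gt] by simp
  have HG: "H \<subseteq> carrier G" by (rule subgroup.subset[OF H])
  have extend: "\<exists>\<psi>\<in>?X. restrict \<psi> H = \<theta>" if \<theta>: "\<theta> \<in> ?C" for \<theta>
  proof -
    have \<theta>c: "\<theta> \<in> circle_characters (G\<lparr>carrier := H\<rparr>)" using \<theta> by (simp add: continuous_circle_characters_def)
    obtain \<psi> where \<psi>: "\<psi> \<in> circle_characters G" "\<And>h. h \<in> H \<Longrightarrow> \<psi> h = \<theta> h"
      by (rule circle_character_extension[OF H \<theta>c]) (rule that)
    have "restrict \<psi> H = \<theta>"
      by (rule extensionalityI[of _ H]) (use \<psi>(2) \<theta>c in \<open>auto simp: circle_characters_def\<close>)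
    then show ?thesis using \<psi>(1) \<theta> by (auto simp: characters_continuous_on_def)
  qed
  have sep: "\<exists>\<psi>\<in>?X. \<psi> x \<noteq> 1" if x: "x \<in> carrier G" "x \<noteq> \<one>" for x
  proof (cases "x \<in> H")
    case True
    then obtain N where N: "neighbourhood_in \<zeta> \<one> N" "x \<notin> N"
      using K.group_topology_Hausdorff_iff[OF \<zeta>gt] haus x by auto
    obtain F where F: "finite F" "F \<subseteq> ?C" "bohr_set (G\<lparr>carrier := H\<rparr>) F 1 \<subseteq> N"
      using K.precompact_neighbourhood_contains_bohr_set[OF \<zeta>, of N] N(1) by auto
    have "x \<notin> bohr_set (G\<lparr>carrier := H\<rparr>) F 1" using F(3) N(2) by blast
    then obtain \<theta> where "\<theta> \<in> F" "\<not> norm (\<theta> x - 1) < 1" using True by (auto simp: bohr_set_def)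
    then have \<theta>: "\<theta> \<in> F" "\<theta> x \<noteq> 1" by auto
    then obtain \<psi> where "\<psi> \<in> ?X" "restrict \<psi> H = \<theta>" using extend F(2) by blast
    then show ?thesis using \<theta> True by (auto intro!: bexI[of _ \<psi>])
  next
    case False
    obtain \<psi> where \<psi>: "\<psi> \<in> circle_characters G" "\<And>h. h \<in> H \<Longrightarrow> \<psi> h = 1" "\<psi> x \<noteq> 1"
      by (rule circle_character_separates[OF H x(1) False]) (rule that)
    have "neighbourhood_in \<zeta> \<one> {y \<in> H. norm (\<psi> y - 1) < \<epsilon>}" if "0 < \<epsilon>" for \<epsilon>
    proof -
      have "{y \<in> H. norm (\<psi> y - 1) < \<epsilon>} = H" using \<psi>(2) that by auto
      moreover have "neighbourhood_in \<zeta> \<one> H"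
        using openin_topspace[of \<zeta>] top subgroup.one_closed[OF H] by (intro neighbourhood_in_openin) auto
      ultimately show ?thesis by simp
    qed
    then show ?thesis using \<psi>(1,3) characters_continuous_on_iff[OF H] by blast
  qed
  show \<sigma>: "precompact_topology G ?\<sigma>" using sep by (rule precompact_bohr_topology[OF X])
  then have \<sigma>gt: "group_topology G ?\<sigma>" by (simp add: precompact_topology_def)
  have nb\<sigma>: "neighbourhood_in (subtopology ?\<sigma> H) \<one> N \<longleftrightarrow>
      N \<subseteq> H \<and> (\<exists>M. neighbourhood_in ?\<sigma> \<one> M \<and> M \<inter> H \<subseteq> N)" for N
    using HG subgroup.one_closed[OF H]
    by (intro neighbourhood_in_subtopology) (auto simp: group_topology_topspace[OF \<sigma>gt])
  show "subtopology ?\<sigma> H = \<zeta>"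
  proof (rule K.group_topology_eqI[OF group_topology_subtopology[OF H \<sigma>gt] \<zeta>gt])
    fix N
    have "neighbourhood_in (subtopology ?\<sigma> H) \<one> N \<longleftrightarrow> neighbourhood_in \<zeta> \<one> N"
    proof
      assume "neighbourhood_in (subtopology ?\<sigma> H) \<one> N"
      then obtain M where N: "N \<subseteq> H" and M: "neighbourhood_in ?\<sigma> \<one> M" "M \<inter> H \<subseteq> N" using nb\<sigma> by blast
      obtain F \<epsilon> where F: "finite F" "F \<subseteq> ?X" "0 < \<epsilon>" "bohr_set G F \<epsilon> \<subseteq> M"
        using M(1) unfolding neighbourhood_in_bohr_topology[OF X] by blast
      have "neighbourhood_in \<zeta> \<one>\<^bsub>G\<lparr>carrier := H\<rparr>\<^esub>
          (bohr_set (G\<lparr>carrier := H\<rparr>) ((\<lambda>\<psi>. restrict \<psi> H) ` F) \<epsilon>)"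
        using F by (intro K.bohr_set_neighbourhood[OF \<zeta>gt]) (auto simp: characters_continuous_on_def)
      then have "neighbourhood_in \<zeta> \<one> (bohr_set G F \<epsilon> \<inter> H)" by (simp add: bohr_set_subgroup[OF H])
      then show "neighbourhood_in \<zeta> \<one> N"
        by (rule neighbourhood_in_mono) (use F(4) M(2) N top in auto)
    next
      assume N: "neighbourhood_in \<zeta> \<one> N"
      then obtain F where F: "finite F" "F \<subseteq> ?C" "bohr_set (G\<lparr>carrier := H\<rparr>) F 1 \<subseteq> N"
        using K.precompact_neighbourhood_contains_bohr_set[OF \<zeta>, of N] by auto
      obtain e where e: "\<And>\<theta>. \<theta> \<in> ?C \<Longrightarrow> e \<theta> \<in> ?X \<and> restrict (e \<theta>) H = \<theta>" using extend by metis
      have "(\<lambda>\<theta>. restrict (e \<theta>) H) ` F = (\<lambda>\<theta>. \<theta>) ` F"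
        by (rule image_cong[OF refl]) (use e F(2) in blast)
      then have "(\<lambda>\<psi>. restrict \<psi> H) ` (e ` F) = F" by (simp add: image_image)
      then have "bohr_set G (e ` F) 1 \<inter> H \<subseteq> N" using bohr_set_subgroup[OF H, of "e ` F" 1] F(3) by simp
      moreover have "neighbourhood_in ?\<sigma> \<one> (bohr_set G (e ` F) 1)"
      proof (rule bohr_set_neighbourhood[OF \<sigma>gt])
        show "e ` F \<subseteq> continuous_circle_characters G ?\<sigma>"
          using e F(2) bohr_topology_continuous[OF X] by blast
      qed (use F(1) in auto)
      moreover have "N \<subseteq> H" using neighbourhood_in_subset[OF N] top by simp
      ultimately show "neighbourhood_in (subtopology ?\<sigma> H) \<one> N" using nb\<sigma> by blast
    qed
    then show "neighbourhood_in (subtopology ?\<sigma> H) \<one>\<^bsub>G\<lparr>carrier := H\<rparr>\<^esub> N \<longleftrightarrow>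
        neighbourhood_in \<zeta> \<one>\<^bsub>G\<lparr>carrier := H\<rparr>\<^esub> N" by simp
  qed
  fix \<tau>' assume \<tau>': "precompact_topology G \<tau>' \<and> subtopology \<tau>' H = \<zeta>"
  then have gt': "group_topology G \<tau>'" by (simp add: precompact_topology_def)
  have "continuous_circle_characters G \<tau>' \<subseteq> ?X"
    using restrict_continuous_character[OF H gt'] \<tau>' by blast
  then have "coarser (bohr_topology G (continuous_circle_characters G \<tau>')) ?\<sigma>"
    using bohr_topology_continuous[OF X] by (intro bohr_topology_coarser[OF \<sigma>gt]) blast
  then show "coarser \<tau>' ?\<sigma>" using precompact_eq_bohr_topology[of \<tau>'] \<tau>' by simp
qed

lemma finest_precompact_extension_unique:
  assumes "finest_precompact_extension G H \<zeta> \<sigma>" "finest_precompact_extension G H \<zeta> \<tau>"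
  shows "\<sigma> = \<tau>"
  using assms unfolding finest_precompact_extension_def by (intro coarser_antisym) auto

lemma neighbourhood_sequence_saturate:
  assumes H: "subgroup H G" and U: "neighbourhood_sequence G U"
  shows "neighbourhood_sequence G (\<lambda>n. U n <#> H)"
proof -
  interpret U: neighbourhood_sequence G U by (rule U)
  have HG: "H \<subseteq> carrier G" by (rule subgroup.subset[OF H])
  show ?thesis
  proof
    fix n x y z
    show "U n <#> H \<subseteq> carrier G" by (intro set_mult_closed U.sequence_carrier HG)
    have "\<one> \<otimes> \<one> \<in> U n <#> H"
      using U.sequence_one subgroup.one_closed[OF H] unfolding set_mult_def by blast
    then show "\<one> \<in> U n <#> H" by simp
    show "inv x \<in> U n <#> H" if "x \<in> U n <#> H"
    proof -
      obtain u h where uh: "u \<in> U n" "h \<in> H" "x = u \<otimes> h" using \<open>x \<in> U n <#> H\<close> unfolding set_mult_def by blast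
      then have "inv x = inv u \<otimes> inv h"
        using U.sequence_carrier[of n] HG by (auto simp: inv_mult subset_iff)
      moreover have "inv u \<in> U n" "inv h \<in> H" using uh U.sequence_inv subgroup.m_inv_closed[OF H] by auto
      ultimately show ?thesis unfolding set_mult_def by blast
    qed
    show "x \<otimes> y \<otimes> z \<in> U n <#> H"
      if xyz: "x \<in> U (Suc n) <#> H" "y \<in> U (Suc n) <#> H" "z \<in> U (Suc n) <#> H"
    proof -
      obtain u v w a b c where uvw: "u \<in> U (Suc n)" "v \<in> U (Suc n)" "w \<in> U (Suc n)"
        and abc: "a \<in> H" "b \<in> H" "c \<in> H" and eq: "x = u \<otimes> a" "y = v \<otimes> b" "z = w \<otimes> c"
        using xyz unfolding set_mult_def by blast
      have "x \<otimes> y \<otimes> z = (u \<otimes> v \<otimes> w) \<otimes> (a \<otimes> b \<otimes> c)"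
        using U.sequence_carrier[of "Suc n"] HG uvw abc unfolding eq by (simp add: m_ac subset_iff)
      moreover have "a \<otimes> b \<otimes> c \<in> H" using abc subgroup.m_closed[OF H] by simp
      moreover have "u \<otimes> v \<otimes> w \<in> U n" using uvw by (rule U.sequence_triple)
      ultimately show ?thesis unfolding set_mult_def by blast
    qed
  qed
qed

text \<open>
  The set \<open>N <#> H\<close> is the preimage of a neighbourhood of the unit in the totally bounded quotient of
  \<open>(G, \<sigma>)\<close>. Characters that describe it come within every \<open>\<epsilon>\<close> of \<open>1\<close> on \<open>H\<close>, so they are trivial on
  \<open>H\<close> and by assumption continuous for \<open>\<tau>\<close>.
\<close>

theorem precompact_saturation_neighbourhood:
  assumes H: "subgroup H G" and \<tau>: "group_topology G \<tau>" and \<sigma>: "precompact_topology G \<sigma>"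
    and triv: "\<And>\<psi>. \<psi> \<in> circle_characters G \<Longrightarrow> (\<forall>h\<in>H. \<psi> h = 1) \<Longrightarrow> \<psi> \<in> continuous_circle_characters G \<tau>"
    and N: "neighbourhood_in \<sigma> \<one> N"
  shows "neighbourhood_in \<tau> \<one> (N <#> H)"
proof -
  have \<sigma>gt: "group_topology G \<sigma>" using \<sigma> by (simp add: precompact_topology_def)
  have HG: "H \<subseteq> carrier G" by (rule subgroup.subset[OF H])
  have NG: "N \<subseteq> carrier G" using neighbourhood_in_subset[OF N] by (simp add: group_topology_topspace[OF \<sigma>gt])
  obtain U where U: "neighbourhood_sequence G U" "U 0 \<subseteq> N" and nb: "\<And>n. neighbourhood_in \<sigma> \<one> (U n)"
    by (rule group_topology_sequence[OF \<sigma>gt N]) (rule that)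
  interpret U: neighbourhood_sequence G U by (rule U(1))
  have UH: "U n \<subseteq> U n <#> H" for n
  proof
    fix x assume x: "x \<in> U n"
    then have "x \<otimes> \<one> \<in> U n <#> H" using subgroup.one_closed[OF H] unfolding set_mult_def by blast
    then show "x \<in> U n <#> H" using x U.sequence_carrier[of n] by (auto simp: subset_iff)
  qed
  have synd: "\<exists>F. finite F \<and> F \<subseteq> carrier G \<and> F <#> (U n <#> H) = carrier G" for n
  proof -
    obtain F where F: "finite F" "F \<subseteq> carrier G" "F <#> U n = carrier G"
      using \<sigma> nb[of n] unfolding precompact_topology_def by metis
    have "F <#> U n \<subseteq> F <#> V" if "U n \<subseteq> V" for V using that unfolding set_mult_def by blast
    from this[OF UH] have "F <#> U n \<subseteq> F <#> (U n <#> H)" .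
    moreover have "F <#> (U n <#> H) \<subseteq> carrier G"
      by (intro set_mult_closed F(2) U.sequence_carrier HG)
    ultimately have "F <#> (U n <#> H) = carrier G" using F(3) by simp
    then show ?thesis using F(1,2) by blast
  qed
  obtain \<Psi> where \<Psi>: "finite \<Psi>" "\<Psi> \<subseteq> circle_characters G"
    and cont: "\<And>\<psi> \<epsilon>. \<psi> \<in> \<Psi> \<Longrightarrow> 0 < \<epsilon> \<Longrightarrow> \<exists>n. \<forall>x\<in>U n <#> H. norm (\<psi> x - 1) < \<epsilon>"
    and inside: "bohr_set G \<Psi> 1 \<subseteq> U 0 <#> H"
    by (rule characters_of_neighbourhood_sequence[OF neighbourhood_sequence_saturate[OF H U(1)] synd]) (rule that)
  have "\<psi> h = 1" if \<psi>: "\<psi> \<in> \<Psi>" and h: "h \<in> H" for \<psi> h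
  proof -
    have "norm (\<psi> h - 1) \<le> 0 + \<epsilon>" if \<epsilon>: "0 < \<epsilon>" for \<epsilon>
    proof -
      obtain n where n: "\<forall>x\<in>U n <#> H. norm (\<psi> x - 1) < \<epsilon>" using cont[OF \<psi> \<epsilon>] by blast
      have "\<one> \<otimes> h \<in> U n <#> H" using U.sequence_one h unfolding set_mult_def by blast
      then have "h \<in> U n <#> H" using h HG by (auto simp: subset_iff)
      then show ?thesis using n by (simp add: less_imp_le)
    qed
    then have "norm (\<psi> h - 1) \<le> 0" by (rule field_le_epsilon)
    then show ?thesis by simp
  qed
  then have "\<Psi> \<subseteq> continuous_circle_characters G \<tau>" using triv \<Psi>(2) by blast
  then have "neighbourhood_in \<tau> \<one> (bohr_set G \<Psi> 1)"
    using \<Psi>(1) by (intro bohr_set_neighbourhood[OF \<tau>]) auto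
  then show ?thesis
  proof (rule neighbourhood_in_mono)
    have "U 0 <#> H \<subseteq> N <#> H" using U(2) unfolding set_mult_def by blast
    then show "bohr_set G \<Psi> 1 \<subseteq> N <#> H" using inside by blast
    show "N <#> H \<subseteq> topspace \<tau>"
      unfolding group_topology_topspace[OF \<tau>] by (intro set_mult_closed NG HG)
  qed
qed

text \<open>
  Two comparable group topologies coincide if they agree on \<open>H\<close> and on \<open>G/H\<close>; the latter is expressed
  by saturated neighbourhoods. An element \<open>x\<close> that is close to the unit for \<open>\<tau>\<close> is a product \<open>v \<otimes> h\<close>
  with \<open>v\<close> close to the unit for \<open>\<sigma>\<close> and \<open>h \<in> H\<close>. Then \<open>h\<close> is close to the unit for \<open>\<tau>\<close>, hence also for
  \<open>\<sigma>\<close>, because the topologies agree on \<open>H\<close>.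
\<close>

theorem merzon_lemma:
  assumes H: "subgroup H G" and \<tau>: "group_topology G \<tau>" and \<sigma>: "group_topology G \<sigma>"
    and le: "coarser \<tau> \<sigma>" and eq: "subtopology \<tau> H = subtopology \<sigma> H"
    and sat: "\<And>N. neighbourhood_in \<sigma> \<one> N \<Longrightarrow> neighbourhood_in \<tau> \<one> (N <#> H)"
  shows "\<tau> = \<sigma>"
proof (rule coarser_antisym[OF le group_topology_coarserI[OF \<sigma> \<tau>]])
  have HG: "H \<subseteq> carrier G" by (rule subgroup.subset[OF H])
  have top: "topspace \<tau> = carrier G" "topspace \<sigma> = carrier G"
    using \<sigma> \<tau> by (auto simp: group_topology_topspace)
  have oneH: "\<one> \<in> H" by (rule subgroup.one_closed[OF H])
  fix N assume N: "neighbourhood_in \<sigma> \<one> N"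
  obtain V where V: "neighbourhood_in \<sigma> \<one> V" "\<And>x y. x \<in> V \<Longrightarrow> y \<in> V \<Longrightarrow> x \<otimes> y \<in> N"
    by (rule group_topology_square[OF \<sigma> N]) (rule that)
  have "neighbourhood_in (subtopology \<sigma> H) \<one> (V \<inter> H)"
    using V(1) by (subst neighbourhood_in_subtopology) (use HG top oneH in auto)
  then obtain W where W: "neighbourhood_in \<tau> \<one> W" "W \<inter> H \<subseteq> V \<inter> H"
    unfolding eq[symmetric] using neighbourhood_in_subtopology[of H \<tau> \<one>] HG top oneH by auto
  obtain W1 where W1: "neighbourhood_in \<tau> \<one> W1" "\<And>x. x \<in> W1 \<Longrightarrow> inv x \<in> W1"
    "\<And>x y z. x \<in> W1 \<Longrightarrow> y \<in> W1 \<Longrightarrow> z \<in> W1 \<Longrightarrow> x \<otimes> y \<otimes> z \<in> W"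
    by (rule group_topology_cube[OF \<tau> W(1)]) (rule that)
  have "neighbourhood_in \<sigma> \<one> (V \<inter> W1)"
    using coarser_neighbourhood[OF le _ W1(1)] top by (intro neighbourhood_in_Int V(1)) simp
  from neighbourhood_in_Int[OF sat[OF this] W1(1)]
  have "neighbourhood_in \<tau> \<one> (((V \<inter> W1) <#> H) \<inter> W1)" .
  then show "neighbourhood_in \<tau> \<one> N"
  proof (rule neighbourhood_in_mono)
    show "N \<subseteq> topspace \<tau>" using neighbourhood_in_subset[OF N] top by simp
    show "((V \<inter> W1) <#> H) \<inter> W1 \<subseteq> N"
    proof
      fix x assume "x \<in> ((V \<inter> W1) <#> H) \<inter> W1"
      then obtain v h where vh: "v \<in> V" "v \<in> W1" "h \<in> H" "x = v \<otimes> h" "x \<in> W1"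
        unfolding set_mult_def by blast
      have c: "v \<in> carrier G" "h \<in> carrier G"
        using vh HG neighbourhood_in_subset[OF W1(1)] top by auto
      have "inv v \<otimes> x \<otimes> \<one> \<in> W" using vh W1 neighbourhood_in_mem[OF W1(1)] by blast
      moreover have "inv v \<otimes> x \<otimes> \<one> = h" using c by (simp add: vh(4) m_assoc[symmetric])
      ultimately have "h \<in> V" using W(2) vh(3) by auto
      then show "x \<in> N" using V(2) vh(1,4) by simp
    qed
  qed
qed

section \<open>Characters of the quotient and of the subgroup\<close>

text \<open>
  Characters of \<open>G/H\<close> are the characters of \<open>G\<close> that are trivial on \<open>H\<close>, and the quotient map
  identifies the two notions of continuity.
\<close>

lemma B_embedded_iff:
  assumes H: "subgroup H G" and \<tau>: "group_topology G \<tau>"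
  shows "B_embedded G \<tau> H \<longleftrightarrow>
    (\<forall>\<psi>\<in>circle_characters G. (\<forall>h\<in>H. \<psi> h = 1) \<longrightarrow> \<psi> \<in> continuous_circle_characters G \<tau>)"
proof -
  interpret T: comm_group torus by (rule comm_group_torus)
  have nH: "H \<lhd> G" using H by (rule subgroup_imp_normal)
  interpret N: normal H G by (rule nH)
  interpret Q: group "G Mod H" by (rule N.factorgroup_is_group)
  have HG: "H \<subseteq> carrier G" by (rule subgroup.subset[OF H])
  have top: "topspace \<tau> = carrier G" by (rule group_topology_topspace[OF \<tau>])
  have one: "\<one>\<^bsub>torus\<^esub> = integer_coset 0"
  proof -
    have "integer_coset 0 \<otimes>\<^bsub>torus\<^esub> integer_coset 0 = integer_coset 0" by (simp add: torus_mult)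
    moreover have "integer_coset 0 \<in> carrier torus" by (simp add: carrier_torus)
    ultimately show ?thesis using T.l_cancel_one by metis
  qed
  have quot: "quotient_map \<tau> (quotient_group_topology G H \<tau>) (\<lambda>x. H #> x)"
    by (rule quotient_map_quotient_group_topology[OF top])
  show ?thesis
  proof
    assume B: "B_embedded G \<tau> H"
    show "\<forall>\<psi>\<in>circle_characters G. (\<forall>h\<in>H. \<psi> h = 1) \<longrightarrow> \<psi> \<in> continuous_circle_characters G \<tau>"
    proof (intro ballI impI)
      fix \<psi> assume \<psi>: "\<psi> \<in> circle_characters G" and triv: "\<forall>h\<in>H. \<psi> h = 1"
      obtain \<phi> where \<phi>: "\<phi> \<in> hom G torus \<inter> extensional (carrier G)" "circle_lift G \<phi> = \<psi>"
        by (rule circle_lift_surj[OF \<psi>])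
      have "\<phi> x = \<phi> y" if xy: "x \<in> carrier G" "y \<in> carrier G" "H #> x = H #> y" for x y
      proof -
        obtain h where h: "h \<in> H" "x = h \<otimes> y"
          using rcos_self[OF xy(1) H] xy(3) unfolding r_coset_def by auto
        have "\<psi> x = \<psi> h * \<psi> y"
          unfolding h(2) using h(1) HG xy by (intro circle_character_mult[OF \<psi>]) auto
        then have "\<psi> x = \<psi> y" using triv h(1) by simp
        then have "circle_value (\<phi> x) = circle_value (\<phi> y)"
          using \<phi>(2) xy by (auto simp: circle_lift_def)
        then show ?thesis
          using \<phi>(1) xy by (intro inj_onD[OF inj_on_circle_value]) (auto simp: hom_def)
      qed
      then obtain g where g: "g \<in> hom (G Mod H) torus" "\<And>x. x \<in> carrier G \<Longrightarrow> g (H #> x) = \<phi> x"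
        using FactGroup_universal[of \<phi> G torus H] \<phi>(1) nH by blast
      have "continuous_map (quotient_group_topology G H \<tau>) torus_topology g"
        using B g(1) by (simp add: B_embedded_def)
      from continuous_map_compose[OF quotient_imp_continuous_map[OF quot] this]
      have "continuous_map \<tau> torus_topology \<phi>"
        by (rule continuous_map_eq) (simp add: top g(2))
      then show "\<psi> \<in> continuous_circle_characters G \<tau>"
        using continuous_map_circle_lift_iff[OF \<tau>, of \<phi>] \<phi> by simp
    qed
  next
    assume R: "\<forall>\<psi>\<in>circle_characters G. (\<forall>h\<in>H. \<psi> h = 1) \<longrightarrow> \<psi> \<in> continuous_circle_characters G \<tau>"
    show "B_embedded G \<tau> H"
      unfolding B_embedded_def
    proof
      fix g assume g: "g \<in> hom (G Mod H) torus"
      let ?\<phi> = "\<lambda>x. g (H #> x)"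
      have \<phi>: "?\<phi> \<in> hom G torus"
      proof (rule homI)
        show "?\<phi> x \<in> carrier torus" if "x \<in> carrier G" for x
          using hom_in_carrier[OF g] that by (simp add: carrier_FactGroup)
        show "?\<phi> (x \<otimes> y) = ?\<phi> x \<otimes>\<^bsub>torus\<^esub> ?\<phi> y" if "x \<in> carrier G" "y \<in> carrier G" for x y
          using hom_mult[OF g, of "H #> x" "H #> y"] that by (simp add: carrier_FactGroup N.rcos_sum)
      qed
      have "circle_lift G ?\<phi> h = 1" if h: "h \<in> H" for h
      proof -
        have "H #> h = \<one>\<^bsub>G Mod H\<^esub>" using coset_join2[OF _ H h] h HG by auto
        moreover have "g \<one>\<^bsub>G Mod H\<^esub> = \<one>\<^bsub>torus\<^esub>" by (rule hom_one[OF g Q.is_group T.is_group])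
        ultimately have "g (H #> h) = integer_coset 0" using one by simp
        then show ?thesis using h HG by (auto simp: circle_lift_def)
      qed
      then have "circle_lift G ?\<phi> \<in> continuous_circle_characters G \<tau>"
        using R circle_lift_character[OF \<phi>] by blast
      then have "continuous_map \<tau> torus_topology ?\<phi>"
        using continuous_map_circle_lift_iff[OF \<tau> \<phi>] by simp
      then show "continuous_map (quotient_group_topology G H \<tau>) torus_topology g"
        by (intro continuous_compose_quotient_map[OF quot]) (simp add: o_def)
    qed
  qed
qed

lemma continuous_characters_eq_preimage_iff:
  assumes H: "subgroup H G" and \<tau>: "group_topology G \<tau>" and \<zeta>: "group_topology (G\<lparr>carrier := H\<rparr>) \<zeta>"
  shows "continuous_characters G \<tau> =
      {\<phi> \<in> discrete_dual G. dual_map (G\<lparr>carrier := H\<rparr>) (\<lambda>x. x) \<phi>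
          \<in> continuous_characters (G\<lparr>carrier := H\<rparr>) \<zeta>} \<longleftrightarrow>
    continuous_circle_characters G \<tau> = characters_continuous_on G H \<zeta>"
    (is "?A = ?B \<longleftrightarrow> ?C = ?D")
proof -
  interpret K: comm_group "G\<lparr>carrier := H\<rparr>" by (rule subgroup_is_comm_group[OF H])
  have HG: "H \<subseteq> carrier G" by (rule subgroup.subset[OF H])
  let ?E = "hom G torus \<inter> extensional (carrier G)"
  have A: "\<phi> \<in> ?A \<longleftrightarrow> \<phi> \<in> ?E \<and> circle_lift G \<phi> \<in> ?C" for \<phi>
    using continuous_map_circle_lift_iff[OF \<tau>] by (auto simp: continuous_characters_def)
  have B: "\<phi> \<in> ?B \<longleftrightarrow> \<phi> \<in> ?E \<and> circle_lift G \<phi> \<in> ?D" for \<phi>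
  proof (cases "\<phi> \<in> ?E")
    case True
    have dm: "dual_map (G\<lparr>carrier := H\<rparr>) (\<lambda>x. x) \<phi> = restrict \<phi> H"
      by (auto simp: dual_map_def compose_def)
    have hom: "restrict \<phi> H \<in> hom (G\<lparr>carrier := H\<rparr>) torus"
      using True HG subgroup.m_closed[OF H] by (auto simp: hom_def subset_iff)
    have lift: "circle_lift (G\<lparr>carrier := H\<rparr>) (restrict \<phi> H) = restrict (circle_lift G \<phi>) H"
      using HG by (auto simp: circle_lift_def fun_eq_iff)
    have "restrict \<phi> H \<in> continuous_characters (G\<lparr>carrier := H\<rparr>) \<zeta> \<longleftrightarrow>
        continuous_map \<zeta> torus_topology (restrict \<phi> H)"
      using hom by (simp add: continuous_characters_def)
    also have "\<dots> \<longleftrightarrow> circle_lift G \<phi> \<in> ?D"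
      using K.continuous_map_circle_lift_iff[OF \<zeta> hom] circle_lift_character[of \<phi>] True
      by (simp add: lift characters_continuous_on_def)
    finally show ?thesis using True by (simp add: discrete_dual_eq dm)
  qed (auto simp: discrete_dual_eq)
  show ?thesis
  proof
    assume "?C = ?D"
    then show "?A = ?B" using A B by blast
  next
    assume AB: "?A = ?B"
    have CD: "?C \<subseteq> circle_characters G" "?D \<subseteq> circle_characters G"
      by (auto simp: continuous_circle_characters_def characters_continuous_on_def)
    have "\<psi> \<in> ?C \<longleftrightarrow> \<psi> \<in> ?D" if \<psi>: "\<psi> \<in> circle_characters G" for \<psi>
    proof -
      obtain \<phi> where "\<phi> \<in> ?E" "circle_lift G \<phi> = \<psi>" by (rule circle_lift_surj[OF \<psi>])
      then show ?thesis using A[of \<phi>] B[of \<phi>] AB by simp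
    qed
    then show "?C = ?D" using CD by blast
  qed
qed

end

theorem theoremB:
  fixes G :: "('a, 'm) monoid_scheme" and H :: "'a set"
  assumes "comm_group G" and "subgroup H G"
  shows
    "(\<forall>\<zeta>. precompact_topology (G\<lparr>carrier := H\<rparr>) \<zeta> \<longrightarrow>
        finest_precompact_extension G H \<zeta> (bohr_modification G (extension_topology G \<zeta>))) \<and>
     (\<forall>\<tau> \<zeta>. precompact_topology G \<tau> \<and> \<zeta> = subtopology \<tau> H \<longrightarrow>
        (finest_precompact_extension G H \<zeta> \<tau> \<longleftrightarrow> B_embedded G \<tau> H) \<and>
        (B_embedded G \<tau> H \<longleftrightarrow>
           continuous_characters G \<tau> =
             {\<phi> \<in> discrete_dual G.
                dual_map (G\<lparr>carrier := H\<rparr>) (\<lambda>x. x) \<phi>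
                  \<in> continuous_characters (G\<lparr>carrier := H\<rparr>) \<zeta>}) \<and>
        (continuous_characters G \<tau> =
             {\<phi> \<in> discrete_dual G.
                dual_map (G\<lparr>carrier := H\<rparr>) (\<lambda>x. x) \<phi>
                  \<in> continuous_characters (G\<lparr>carrier := H\<rparr>) \<zeta>} \<longleftrightarrow>
           \<tau> = bohr_modification G (extension_topology G \<zeta>)))"
proof -
  interpret comm_group G by (rule assms(1))
  note H = assms(2)
  have modification: "bohr_modification G (extension_topology G \<zeta>) = bohr_topology G (characters_continuous_on G H \<zeta>)"
    if "precompact_topology (G\<lparr>carrier := H\<rparr>) \<zeta>" for \<zeta>
  proof -
    have \<zeta>: "group_topology (G\<lparr>carrier := H\<rparr>) \<zeta>" "Hausdorff_space \<zeta>"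
      using that by (auto simp: precompact_topology_def)
    show ?thesis
      using bohr_modification_eq[OF extension_topology_properties(1)[OF H \<zeta>]]
      by (simp add: characters_of_extension_topology[OF H \<zeta>])
  qed
  let ?A = "\<lambda>\<tau>. continuous_characters G \<tau>"
  let ?B = "\<lambda>\<zeta>. {\<phi> \<in> discrete_dual G. dual_map (G\<lparr>carrier := H\<rparr>) (\<lambda>x. x) \<phi>
                  \<in> continuous_characters (G\<lparr>carrier := H\<rparr>) \<zeta>}"
  show ?thesis
  proof (rule conjI; intro allI impI)
    show "finest_precompact_extension G H \<zeta> (bohr_modification G (extension_topology G \<zeta>))"
      if "precompact_topology (G\<lparr>carrier := H\<rparr>) \<zeta>" for \<zeta>
      unfolding modification[OF that] by (rule finest_precompact_extension_bohr[OF H that])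
    fix \<tau> \<zeta> assume "precompact_topology G \<tau> \<and> \<zeta> = subtopology \<tau> H"
    then have \<tau>: "precompact_topology G \<tau>" and \<zeta>: "\<zeta> = subtopology \<tau> H" by simp_all
    let ?X = "characters_continuous_on G H \<zeta>" and ?C = "continuous_circle_characters G \<tau>"
    let ?\<sigma> = "bohr_topology G ?X"
    have \<zeta>p: "precompact_topology (G\<lparr>carrier := H\<rparr>) \<zeta>"
      unfolding \<zeta> by (rule precompact_subtopology[OF H \<tau>])
    have gt: "group_topology G \<tau>" using \<tau> by (simp add: precompact_topology_def)
    have \<zeta>gt: "group_topology (G\<lparr>carrier := H\<rparr>) \<zeta>" using \<zeta>p by (simp add: precompact_topology_def)
    have X: "?X \<subseteq> circle_characters G" by (rule characters_continuous_on_subset)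
    have finest: "finest_precompact_extension G H \<zeta> ?\<sigma>"
      by (rule finest_precompact_extension_bohr[OF H \<zeta>p])
    have \<sigma>p: "precompact_topology G ?\<sigma>" and \<sigma>H: "subtopology ?\<sigma> H = \<zeta>" and le: "coarser \<tau> ?\<sigma>"
      using finest \<tau> \<zeta> by (auto simp: finest_precompact_extension_def)
    have \<sigma>gt: "group_topology G ?\<sigma>" using \<sigma>p by (simp add: precompact_topology_def)
    have finest_iff: "finest_precompact_extension G H \<zeta> \<tau> \<longleftrightarrow> \<tau> = ?\<sigma>"
      using finest finest_precompact_extension_unique by blast
    have CX: "?C \<subseteq> ?X" using restrict_continuous_character[OF H gt] by (auto simp: \<zeta>)
    have dual_iff: "?C = ?X \<longleftrightarrow> \<tau> = ?\<sigma>"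
    proof
      assume "?C = ?X"
      then show "\<tau> = ?\<sigma>" using precompact_eq_bohr_topology[OF \<tau>] by simp
    next
      assume "\<tau> = ?\<sigma>"
      then have "?X \<subseteq> ?C" using bohr_topology_continuous[OF X] by simp
      then show "?C = ?X" using CX by blast
    qed
    have dual_imp_embedded: "B_embedded G \<tau> H" if "?C = ?X"
      unfolding B_embedded_iff[OF H gt]
    proof (intro ballI impI)
      fix \<psi> assume \<psi>: "\<psi> \<in> circle_characters G" "\<forall>h\<in>H. \<psi> h = 1"
      have "neighbourhood_in \<zeta> \<one>\<^bsub>G\<^esub> {x \<in> H. norm (\<psi> x - 1) < \<epsilon>}" if "0 < \<epsilon>" for \<epsilon>
      proof -
        have "{x \<in> H. norm (\<psi> x - 1) < \<epsilon>} = H" using \<psi>(2) that by auto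
        moreover have "topspace \<zeta> = H" using \<zeta>gt by (simp add: group_topology_def)
        ultimately show ?thesis
          using openin_topspace[of \<zeta>] subgroup.one_closed[OF H] by (simp add: neighbourhood_in_openin)
      qed
      then have "\<psi> \<in> ?X" using \<psi>(1) characters_continuous_on_iff[OF H] by blast
      then show "\<psi> \<in> ?C" using \<open>?C = ?X\<close> by simp
    qed
    have embedded_imp_eq: "\<tau> = ?\<sigma>" if "B_embedded G \<tau> H"
    proof (rule merzon_lemma[OF H gt \<sigma>gt le])
      show "subtopology \<tau> H = subtopology ?\<sigma> H" using \<sigma>H \<zeta> by simp
      show "neighbourhood_in \<tau> \<one>\<^bsub>G\<^esub> (N <#>\<^bsub>G\<^esub> H)" if "neighbourhood_in ?\<sigma> \<one>\<^bsub>G\<^esub> N" for N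
      proof (rule precompact_saturation_neighbourhood[OF H gt \<sigma>p _ that])
        show "\<psi> \<in> ?C" if "\<psi> \<in> circle_characters G" "\<forall>h\<in>H. \<psi> h = 1" for \<psi>
          using \<open>B_embedded G \<tau> H\<close> that unfolding B_embedded_iff[OF H gt] by blast
      qed
    qed
    show "(finest_precompact_extension G H \<zeta> \<tau> \<longleftrightarrow> B_embedded G \<tau> H) \<and>
        (B_embedded G \<tau> H \<longleftrightarrow> ?A \<tau> = ?B \<zeta>) \<and>
        (?A \<tau> = ?B \<zeta> \<longleftrightarrow> \<tau> = bohr_modification G (extension_topology G \<zeta>))"
      unfolding continuous_characters_eq_preimage_iff[OF H gt \<zeta>gt] modification[OF \<zeta>p]
      using finest_iff dual_iff dual_imp_embedded embedded_imp_eq by blast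
  qed
qed

end
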